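(* Let $G$ be a connected cubic graph on $n\geq 6$ vertices whose vertex set can be partitioned into vertex sets of vertex-disjoint triangles and diamonds, with at least one triangle and at least one diamond. If $G$ is isomorphic to the graph $\eta$, or to the graph $\omega_k$ for some $k\geq 1$, then Dominator wins the Maker--Breaker total domination game on $G$ when he moves first, and Staller wins when she moves first. In all other cases the graph $G$ is $\mathcal{S}$.
   Context: Graphs are finite and simple; a cubic graph is a $3$-regular graph. The Maker--Breaker total domination (MBTD) game on a graph $G$: two players, Dominator and Staller, alternately claim one previously unclaimed vertex of $G$ per move. Staller wins if at some point she has claimed all vertices of the open neighbourhood $N_G(v)$ of some vertex $v$ of $G$; otherwise Dominator wins. A graph is $\mathcal{S}$ if Staller has a winning strategy regardless of who moves first. A diamond is the complete graph on four vertices minus one edge. A triangle means an induced $K_3$ which is not part of a diamond. The graph $\eta$ (on 18 vertices) consists of two triangles $Y=\{y_1,y_2,y_3\}$ and $W=\{w_1,w_2,w_3\}$, three diamonds $H=\{h_1,\dots,h_4\}$, $K=\{k_1,\dots,k_4\}$, $M=\{m_1,\dots,m_4\}$, where a diamond on $\{z_1,z_2,z_3,z_4\}$ has edges $z_1z_2,z_2z_3,z_3z_4,z_4z_1,z_2z_4$, together with the edges $h_1y_1,\ y_2k_1,\ y_3k_3,\ h_3w_1,\ w_2m_1,\ w_3m_3$. For $k\ge 1$, the graph $\omega_k$ (on $10+4k$ vertices) consists of two triangles $A=\{a_1,a_2,a_3\}$ and $B=\{b_1,b_2,b_3\}$, a diamond $H=\{h_1,\dots,h_4\}$ with edges $h_1h_2,h_2h_3,h_3h_4,h_4h_1,h_2h_4$,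 and diamonds $D_1,\dots,D_k$ with $D_i=\{z^i_1,z^i_2,z^i_3,z^i_4\}$ and edges $z^i_1z^i_2,z^i_2z^i_3,z^i_3z^i_4,z^i_4z^i_1,z^i_2z^i_4$ for $1\le i\le k$, together with the edges $a_1b_1,\ b_2h_1,\ b_3h_3,\ a_2z^1_1,\ z^k_3a_3$ and $z^i_3z^{i+1}_1$ for $1\le i\le k-1$. *)

theory Defs
  imports "Graph_Theory.Graph_Theory" "HOL-Library.Disjoint_Sets"
begin

section \<open>Graphs\<close>

text \<open>
  A finite simple graph is a \<^locale>\<open>pair_graph\<close>: each undirected edge is represented by the two
  arcs \<open>(u, v)\<close> and \<open>(v, u)\<close>.
\<close>

definition open_nbhd :: "'a pair_pre_digraph \<Rightarrow> 'a \<Rightarrow> 'a set" where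
  "open_nbhd G v = {u. (v, u) \<in> parcs G}"

definition cubic :: "'a pair_pre_digraph \<Rightarrow> bool" where
  "cubic G \<longleftrightarrow> (\<forall>v \<in> pverts G. card (open_nbhd G v) = 3)"

definition undirected_graph :: "'a set \<Rightarrow> ('a \<times> 'a) set \<Rightarrow> 'a pair_pre_digraph" where
  "undirected_graph V E = \<lparr> pverts = V, parcs = E \<union> E\<inverse> \<rparr>"

definition triangle_edges :: "(nat \<Rightarrow> 'a) \<Rightarrow> ('a \<times> 'a) set" where
  "triangle_edges t = {(t 1, t 2), (t 2, t 3), (t 3, t 1)}"

definition diamond_edges :: "(nat \<Rightarrow> 'a) \<Rightarrow> ('a \<times> 'a) set" where
  "diamond_edges z = {(z 1, z 2), (z 2, z 3), (z 3, z 4), (z 4, z 1), (z 2, z 4)}"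

definition diamond_graph :: "nat pair_pre_digraph" where
  "diamond_graph = undirected_graph {1..4} (diamond_edges (\<lambda>i. i))"

definition is_diamond :: "'a pair_pre_digraph \<Rightarrow> 'a set \<Rightarrow> bool" where
  "is_diamond G X \<longleftrightarrow>
     X \<subseteq> pverts G \<and> digraph_iso (with_proj G \<restriction> X) (with_proj diamond_graph)"

definition is_triangle :: "'a pair_pre_digraph \<Rightarrow> 'a set \<Rightarrow> bool" where
  "is_triangle G X \<longleftrightarrow>
     X \<subseteq> pverts G \<and> complete_digraph 3 (with_proj G \<restriction> X) \<and>
     \<not> (\<exists>Z. is_diamond G Z \<and> X \<subseteq> Z)"

definition triangle_diamond_partition :: "'a pair_pre_digraph \<Rightarrow> 'a set set \<Rightarrow> bool" where
  "triangle_diamond_partition G P \<longleftrightarrow>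
     partition_on (pverts G) P \<and>
     (\<forall>X \<in> P. is_triangle G X \<or> is_diamond G X) \<and>
     (\<exists>X \<in> P. is_triangle G X) \<and> (\<exists>X \<in> P. is_diamond G X)"

section \<open>The exceptional graphs\<close>

datatype eta_vertex = eY nat | eW nat | eH nat | eK nat | eM nat

definition eta :: "eta_vertex pair_pre_digraph" where
  "eta = undirected_graph
     (eY ` {1..3} \<union> eW ` {1..3} \<union> eH ` {1..4} \<union> eK ` {1..4} \<union> eM ` {1..4})
     (triangle_edges eY \<union> triangle_edges eW \<union>
      diamond_edges eH \<union> diamond_edges eK \<union> diamond_edges eM \<union>
      {(eH 1, eY 1), (eY 2, eK 1), (eY 3, eK 3), (eH 3, eW 1), (eW 2, eM 1), (eW 3, eM 3)})"

text \<open>The vertex \<open>oZ i j\<close> is the vertex \<open>z\<^sup>i\<^sub>j\<close> of the \<open>i\<close>-th diamond of the chain.\<close>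

datatype omega_vertex = oA nat | oB nat | oH nat | oZ nat nat

definition omega :: "nat \<Rightarrow> omega_vertex pair_pre_digraph" where
  "omega k = undirected_graph
     (oA ` {1..3} \<union> oB ` {1..3} \<union> oH ` {1..4} \<union> (\<Union>i \<in> {1..k}. oZ i ` {1..4}))
     (triangle_edges oA \<union> triangle_edges oB \<union> diamond_edges oH \<union>
      (\<Union>i \<in> {1..k}. diamond_edges (oZ i)) \<union>
      {(oA 1, oB 1), (oB 2, oH 1), (oB 3, oH 3), (oA 2, oZ 1 1), (oZ k 3, oA 3)} \<union>
      {(oZ i 3, oZ (i + 1) 1) | i. i \<in> {1..<k}})"

section \<open>The Maker--Breaker total domination game\<close>

datatype player = Dominator | Staller

fun opponent :: "player \<Rightarrow> player" where
  "opponent Dominator = Staller"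
| "opponent Staller = Dominator"

text \<open>
  A play is recorded as the list of claimed vertices in the order in which they are claimed.
  \<open>mover p i\<close> is the player making move number \<open>i\<close> (counted from \<open>0\<close>) when \<open>p\<close> starts.
  Plays are continued until all vertices are claimed; this is harmless since Staller's winning
  condition, once reached, is not affected by later moves.
\<close>

definition mover :: "player \<Rightarrow> nat \<Rightarrow> player" where
  "mover p i = (if even i then p else opponent p)"

definition claimed :: "player \<Rightarrow> player \<Rightarrow> 'a list \<Rightarrow> 'a set" where
  "claimed p q h = {h ! i | i. i < length h \<and> mover p i = q}"

definition complete_play :: "'a pair_pre_digraph \<Rightarrow> 'a list \<Rightarrow> bool" where
  "complete_play G h \<longleftrightarrow> distinct h \<and> set h = pverts G"

definition staller_wins_play :: "'a pair_pre_digraph \<Rightarrow> player \<Rightarrow> 'a list \<Rightarrow> bool" where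
  "staller_wins_play G p h \<longleftrightarrow>
     (\<exists>m \<le> length h. \<exists>v \<in> pverts G. open_nbhd G v \<subseteq> claimed p Staller (take m h))"

definition winner :: "'a pair_pre_digraph \<Rightarrow> player \<Rightarrow> 'a list \<Rightarrow> player" where
  "winner G p h = (if staller_wins_play G p h then Staller else Dominator)"

text \<open>
  A strategy maps the history of the play to the next vertex to claim. It has to return an unclaimed
  vertex whenever there is one, so that following it is always possible.
\<close>

definition strategy :: "'a pair_pre_digraph \<Rightarrow> ('a list \<Rightarrow> 'a) \<Rightarrow> bool" where
  "strategy G \<sigma> \<longleftrightarrow>
     (\<forall>h. distinct h \<and> set h \<subset> pverts G \<longrightarrow> \<sigma> h \<in> pverts G - set h)"

definition follows :: "player \<Rightarrow> player \<Rightarrow> ('a list \<Rightarrow> 'a) \<Rightarrow> 'a list \<Rightarrow> bool" where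
  "follows p q \<sigma> h \<longleftrightarrow> (\<forall>i < length h. mover p i = q \<longrightarrow> h ! i = \<sigma> (take i h))"

text \<open>\<open>wins_MBTD G p q\<close>: player \<open>q\<close> has a winning strategy when player \<open>p\<close> moves first.\<close>

definition wins_MBTD :: "'a pair_pre_digraph \<Rightarrow> player \<Rightarrow> player \<Rightarrow> bool" where
  "wins_MBTD G p q \<longleftrightarrow>
     (\<exists>\<sigma>. strategy G \<sigma> \<and>
       (\<forall>h. complete_play G h \<and> follows p q \<sigma> h \<longrightarrow> winner G p h = q))"

definition graph_S :: "'a pair_pre_digraph \<Rightarrow> bool" where
  "graph_S G \<longleftrightarrow> (\<forall>p. wins_MBTD G p Staller)"

end

theory Submission imports Defs begin

text \<open>
  Staller plays as Maker on the hypergraph whose edges are the open neighbourhoods, so everything is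
  decided by positions \<open>(A, B)\<close>: her vertices and Dominator's. Almost all of her moves are forcing: if
  a neighbourhood misses only two free vertices, she claims one and Dominator must claim the other.
  In this way Staller, holding an entrance of a diamond, crosses it and obtains the vertex at its exit;
  so she passes through any untouched chain of diamonds (\<open>push\<close>). Arriving at a triangle, she claims
  one of its other two vertices, Dominator is forced to claim the third, and she travels on through
  the next chain. The graph is thus a cubic multigraph whose vertices are the triangles and whose edges
  are the chains, and Staller makes a walk in it. The graph is finite, so the walk returns to a triangle
  already visited, and this completes a neighbourhood (\<open>walk\<close>).

  Let \<open>d\<close> be Dominator's first vertex. The part of the multigraph on which Staller can walk without
  meeting \<open>d\<close> contains a good starting point almost always. A triangle with a loop is one
  (\<open>loop_start\<close>), since its loop carries a diamond, which supplies a threat; a triangle without a loop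
  is one too (\<open>plain_start\<close>, \<open>plain_wins\<close>), after a discussion of Dominator's reply next to that
  triangle. Going through the positions of \<open>d\<close> (\<open>dominator_in_triangle\<close>, \<open>dominator_in_diamond\<close>),
  one finds that there is no such start only for two triangles joined by three chains, which Staller
  wins directly (\<open>theta_wins\<close>), and for dumbbells, that is, two triangles with loops joined by a
  bridge. In a dumbbell, a bridge with a diamond or a loop with two diamonds gives Staller a win far
  from \<open>d\<close> (\<open>bridge_start\<close>, \<open>double_loop_start\<close>). What survives is a dumbbell with a loop of one
  diamond, and with either a bridge that is a single edge or one diamond on each of the three chains:
  these are the graphs \<open>\<omega>\<^sub>k\<close> and \<open>\<eta>\<close> (\<open>staller_wins_or_exceptional\<close>).

  On \<open>\<omega>\<^sub>k\<close> and \<open>\<eta>\<close> Dominator starts at an end of the bridge edge, or in the diamond of the bridge. The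
  neighbourhoods that he has not yet hit contain edges of a disjoint union of tiny games, each of which
  he wins as the second player (\<open>maker_loses_sum\<close>). When Staller starts on a dumbbell, she takes a port of
  a loop diamond, answers are forced, and she leaves through the bridge to close the other loop
  (\<open>dumbbell_staller_first\<close>). Finally, winning positions are turned into strategies on
  histories (\<open>staller_strategy\<close>, \<open>dominator_strategy\<close>), and Dominator's win is carried along isomorphisms.
\<close>

section \<open>Maker--Breaker positions\<close>

text \<open>
  The positions that Maker wins when it is her move, \<open>A\<close> and \<open>B\<close> being the vertices already claimed by
  Maker and Breaker. The rule \<open>finish\<close> covers a winning last move, after which no free vertex
  may be left; the rule \<open>move\<close> therefore demands that Breaker can reply, so that its last premise is not
  vacuous.
\<close>

inductive maker_wins :: "'a set \<Rightarrow> 'a set set \<Rightarrow> 'a set \<Rightarrow> 'a set \<Rightarrow> bool"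
  for V :: "'a set" and H :: "'a set set" where
  won: "e \<in> H \<Longrightarrow> e \<subseteq> A \<Longrightarrow> maker_wins V H A B"
| finish: "e \<in> H \<Longrightarrow> e \<subseteq> insert x A \<Longrightarrow> x \<in> V - (A \<union> B) \<Longrightarrow> maker_wins V H A B"
| move: "a \<in> V - (A \<union> B) \<Longrightarrow> V - (insert a A \<union> B) \<noteq> {} \<Longrightarrow>
    (\<And>b. b \<in> V - (insert a A \<union> B) \<Longrightarrow> maker_wins V H (insert a A) (insert b B)) \<Longrightarrow>
    maker_wins V H A B"

text \<open>
  A vertex of Breaker never helps Maker: a Breaker who owns fewer vertices may pretend to own the others,
  and when he claims one of these he has only lost a move, which the induction hypothesis for an
  arbitrary reply covers.
\<close>

lemma maker_wins_antimono:
  "maker_wins V H A B \<Longrightarrow> B' \<subseteq> B \<Longrightarrow> maker_wins V H A B'"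
proof (induction arbitrary: B' rule: maker_wins.induct)
  case (won e A B)
  then show ?case by (auto intro: maker_wins.won)
next
  case (finish e x A B)
  then show ?case by (intro maker_wins.finish[of e H x]) auto
next
  case (move a A B)
  obtain b0 where b0: "b0 \<in> V - (insert a A \<union> B)" using move.hyps by blast
  show ?case
  proof (rule maker_wins.move[of a])
    show "a \<in> V - (A \<union> B')" "V - (insert a A \<union> B') \<noteq> {}" using move by auto
    fix b assume b: "b \<in> V - (insert a A \<union> B')"
    show "maker_wins V H (insert a A) (insert b B')"
    proof (cases "b \<in> B")
      case True
      then show ?thesis using move.IH[OF b0, of "insert b B'"] move.prems by blast
    next
      case False
      then show ?thesis using move.IH[of b "insert b B'"] b move.prems by blast
    qed
  qed
qed

text \<open>
  The one step from which all of Maker's attacks are built: an edge lacks only \<open>x\<close> and \<open>y\<close>, so the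
  claim of \<open>y\<close> forces the reply \<open>x\<close>.
\<close>

lemma maker_forces:
  assumes "e \<in> H" "e \<subseteq> insert x (insert y A)" "x \<in> V - (A \<union> B)" "y \<in> V - (A \<union> B)" "x \<noteq> y"
    and "maker_wins V H (insert y A) (insert x B)"
  shows "maker_wins V H A B"
proof (rule maker_wins.move[of y])
  show "y \<in> V - (A \<union> B)" by fact
  show "V - (insert y A \<union> B) \<noteq> {}" using assms by auto
  fix b assume "b \<in> V - (insert y A \<union> B)"
  show "maker_wins V H (insert y A) (insert b B)"
  proof (cases "b = x")
    case True then show ?thesis using assms by simp
  next
    case False
    then show ?thesis using assms by (intro maker_wins.finish[of e H x]) auto
  qed
qed

definition maker_wins_after :: "'a set \<Rightarrow> 'a set set \<Rightarrow> 'a set \<Rightarrow> 'a set \<Rightarrow> bool" where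
  "maker_wins_after V H A B \<longleftrightarrow> (\<exists>e \<in> H. e \<subseteq> A) \<or>
     V - (A \<union> B) \<noteq> {} \<and> (\<forall>b \<in> V - (A \<union> B). maker_wins V H A (insert b B))"

text \<open>
  Together with the definition of \<open>maker_wins_after\<close> this is the usual backward induction, in which a
  player without a winning move has lost; it is the form needed to extract strategies for either side.
\<close>

lemma maker_wins_iff:
  "maker_wins V H A B \<longleftrightarrow>
     (\<exists>e \<in> H. e \<subseteq> A) \<or> (\<exists>a \<in> V - (A \<union> B). maker_wins_after V H (insert a A) B)"
proof
  assume "maker_wins V H A B"
  then show "(\<exists>e \<in> H. e \<subseteq> A) \<or> (\<exists>a \<in> V - (A \<union> B). maker_wins_after V H (insert a A) B)"
  proof (cases rule: maker_wins.cases)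
    case (won e) then show ?thesis by blast
  next
    case (finish e x)
    then have "maker_wins_after V H (insert x A) B" by (auto simp: maker_wins_after_def)
    then show ?thesis using finish by blast
  next
    case (move a)
    then have "maker_wins_after V H (insert a A) B" unfolding maker_wins_after_def by blast
    then show ?thesis using move by blast
  qed
next
  assume "(\<exists>e \<in> H. e \<subseteq> A) \<or> (\<exists>a \<in> V - (A \<union> B). maker_wins_after V H (insert a A) B)"
  then show "maker_wins V H A B"
  proof
    assume "\<exists>e \<in> H. e \<subseteq> A"
    then show ?thesis by (auto intro: maker_wins.won)
  next
    assume "\<exists>a \<in> V - (A \<union> B). maker_wins_after V H (insert a A) B"
    then obtain a where a: "a \<in> V - (A \<union> B)" "maker_wins_after V H (insert a A) B" by blast
    from a(2) consider e where "e \<in> H" "e \<subseteq> insert a A"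
      | "V - (insert a A \<union> B) \<noteq> {}" "\<forall>b \<in> V - (insert a A \<union> B). maker_wins V H (insert a A) (insert b B)"
      unfolding maker_wins_after_def by blast
    then show ?thesis
    proof cases
      case 1 then show ?thesis using a(1) by (rule maker_wins.finish)
    next
      case 2 then show ?thesis using maker_wins.move[OF a(1)] by blast
    qed
  qed
qed

subsection \<open>From positions to strategies\<close>

lemma claimed_Nil [simp]: "claimed p q [] = {}"
  by (simp add: claimed_def)

lemma claimed_snoc:
  "claimed p q (h @ [x]) = (if mover p (length h) = q then insert x (claimed p q h) else claimed p q h)"
proof -
  let ?I = "{i. i < length h \<and> mover p i = q}"
  have "{i. i < length (h @ [x]) \<and> mover p i = q} =
      (if mover p (length h) = q then insert (length h) ?I else ?I)"
    by (auto simp: less_Suc_eq)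
  moreover have "(\<lambda>i. (h @ [x]) ! i) ` ?I = (\<lambda>i. h ! i) ` ?I"
    by (intro image_cong refl) (simp add: nth_append)
  ultimately show ?thesis by (simp add: claimed_def setcompr_eq_image)
qed

lemma claimed_take_Suc:
  assumes "m < length h"
  shows "claimed p q (take (Suc m) h) =
    (if mover p m = q then insert (h ! m) (claimed p q (take m h)) else claimed p q (take m h))"
  using assms by (simp add: take_Suc_conv_app_nth claimed_snoc)

lemma claimed_subset: "claimed p q h \<subseteq> set h"
  by (auto simp: claimed_def)

lemma claimed_take_mono: "claimed p q (take m h) \<subseteq> claimed p q h"
  by (auto simp: claimed_def)

lemma player_neq_iff [simp]: "q \<noteq> Staller \<longleftrightarrow> q = Dominator" "q \<noteq> Dominator \<longleftrightarrow> q = Staller"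
  by (cases q; simp)+

lemma mover_Suc [simp]: "mover p (Suc i) = opponent (mover p i)"
  by (cases p) (auto simp: mover_def)

lemma claimed_Un: "claimed p Staller h \<union> claimed p Dominator h = set h"
proof -
  have "h ! i \<in> claimed p Staller h \<union> claimed p Dominator h" if "i < length h" for i
    using that by (cases "mover p i") (auto simp: claimed_def)
  then show ?thesis using claimed_subset[of p] by (fastforce simp: in_set_conv_nth)
qed

abbreviation winning_sets :: "'a pair_pre_digraph \<Rightarrow> 'a set set" where
  "winning_sets G \<equiv> open_nbhd G ` pverts G"

text \<open>
  Claimed vertices are never given back, so it suffices to look at the end of the play.
\<close>

lemma staller_wins_play_iff:
  "staller_wins_play G p h \<longleftrightarrow> (\<exists>e \<in> winning_sets G. e \<subseteq> claimed p Staller h)"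
proof
  assume "staller_wins_play G p h"
  then show "\<exists>e \<in> winning_sets G. e \<subseteq> claimed p Staller h"
    unfolding staller_wins_play_def using claimed_take_mono by fastforce
next
  assume "\<exists>e \<in> winning_sets G. e \<subseteq> claimed p Staller h"
  then show "staller_wins_play G p h"
    unfolding staller_wins_play_def by (intro exI[of _ "length h"]) auto
qed

text \<open>
  A strategy may be chosen history by history. The property \<open>P\<close> will say that the chosen move keeps a won
  position won.
\<close>

lemma greedy_strategy:
  assumes "\<And>h. \<exists>x. distinct h \<and> set h \<subset> pverts G \<longrightarrow> x \<in> pverts G - set h \<and> P h x"
  obtains \<sigma> where "strategy G \<sigma>" "\<And>h. distinct h \<Longrightarrow> set h \<subset> pverts G \<Longrightarrow> P h (\<sigma> h)"
proof -
  from assms obtain \<sigma> where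
    "\<And>h. distinct h \<and> set h \<subset> pverts G \<longrightarrow> \<sigma> h \<in> pverts G - set h \<and> P h (\<sigma> h)"
    by metis
  then show ?thesis using that[of \<sigma>] by (auto simp: strategy_def)
qed

lemma complete_play_step:
  assumes "complete_play G h" "m < length h"
  shows "distinct (take m h)" "set (take m h) \<subset> pverts G" "h ! m \<in> pverts G - set (take m h)"
proof -
  have dh: "distinct h" and s: "set h = pverts G" using assms(1) by (auto simp: complete_play_def)
  then have d: "distinct (take (Suc m) h)" by simp
  show "distinct (take m h)" using dh by simp
  have "h ! m \<notin> set (take m h)" using d assms(2) by (simp add: take_Suc_conv_app_nth)
  moreover have "h ! m \<in> pverts G" using nth_mem[OF assms(2)] by (simp add: s)
  moreover have "set (take m h) \<subseteq> pverts G" using set_take_subset[of m h] by (simp add: s)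
  ultimately show "set (take m h) \<subset> pverts G" "h ! m \<in> pverts G - set (take m h)" by blast+
qed

text \<open>
  Staller always moves to a position that is again won. The invariant persists to the end of the
  play, where no vertex is free and a won position must contain a completed neighbourhood.
\<close>

lemma staller_strategy:
  fixes G :: "'a pair_pre_digraph"
  defines "V \<equiv> pverts G" and "H \<equiv> winning_sets G"
  assumes start: "case p of Staller \<Rightarrow> maker_wins V H {} {} | Dominator \<Rightarrow> maker_wins_after V H {} {}"
  shows "wins_MBTD G p Staller"
proof -
  let ?S = "claimed p Staller" and ?D = "claimed p Dominator"
  let ?good = "\<lambda>h x. maker_wins V H (?S h) (?D h) \<longrightarrow> maker_wins_after V H (insert x (?S h)) (?D h)"
  have "\<exists>x. distinct h \<and> set h \<subset> pverts G \<longrightarrow> x \<in> pverts G - set h \<and> ?good h x" for h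
  proof (cases "maker_wins V H (?S h) (?D h)")
    case True
    then consider "\<exists>e \<in> H. e \<subseteq> ?S h" | "\<exists>a \<in> V - set h. maker_wins_after V H (insert a (?S h)) (?D h)"
      using maker_wins_iff[of V H "?S h" "?D h"] by (auto simp: claimed_Un)
    then show ?thesis
    proof cases
      case 1
      then have "maker_wins_after V H (insert x (?S h)) (?D h)" for x
        by (auto simp: maker_wins_after_def)
      then show ?thesis by blast
    next
      case 2 then show ?thesis by (auto simp: V_def)
    qed
  qed blast
  then obtain \<sigma> where \<sigma>: "strategy G \<sigma>"
    "\<And>h. distinct h \<Longrightarrow> set h \<subset> pverts G \<Longrightarrow> ?good h (\<sigma> h)"
    by (rule greedy_strategy) blast
  have "winner G p h = Staller" if h: "complete_play G h" "follows p Staller \<sigma> h" for h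
  proof -
    have inv: "if mover p m = Staller then maker_wins V H (?S (take m h)) (?D (take m h))
        else maker_wins_after V H (?S (take m h)) (?D (take m h))" if "m \<le> length h" for m
      using that
    proof (induction m)
      case 0 then show ?case using start by (cases p) (auto simp: mover_def)
    next
      case (Suc m)
      then have m: "m < length h" by simp
      note step = complete_play_step[OF h(1) m]
      show ?case
      proof (cases "mover p m")
        case Staller
        then have "maker_wins V H (?S (take m h)) (?D (take m h))" using Suc by auto
        moreover have "h ! m = \<sigma> (take m h)" using h(2) m Staller by (auto simp: follows_def)
        ultimately show ?thesis using \<sigma>(2)[OF step(1,2)] Staller m
          by (simp add: claimed_take_Suc)
      next
        case Dominator
        then have "maker_wins_after V H (?S (take m h)) (?D (take m h))" using Suc by auto
        moreover have "h ! m \<in> V - (?S (take m h) \<union> ?D (take m h))"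
          using step(3) by (auto simp: V_def claimed_Un)
        ultimately have "maker_wins V H (?S (take m h)) (insert (h ! m) (?D (take m h)))"
          unfolding maker_wins_after_def by (blast intro: maker_wins.won)
        then show ?thesis using Dominator m by (simp add: claimed_take_Suc)
      qed
    qed
    have "V - (?S h \<union> ?D h) = {}" using h(1) by (auto simp: V_def complete_play_def claimed_Un)
    then have "\<exists>e \<in> H. e \<subseteq> ?S h"
      using inv[of "length h"] maker_wins_iff[of V H "?S h" "?D h"]
      by (cases "mover p (length h)") (auto simp: maker_wins_after_def)
    then show ?thesis by (auto simp: winner_def staller_wins_play_iff H_def)
  qed
  then show ?thesis using \<sigma>(1) unfolding wins_MBTD_def by blast
qed

text \<open>
  Dominator keeps the position one that Staller does not win; at the end no neighbourhood is completed.
\<close>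

lemma dominator_strategy:
  fixes G :: "'a pair_pre_digraph"
  defines "V \<equiv> pverts G" and "H \<equiv> winning_sets G"
  assumes start: "\<not> maker_wins_after V H {} {}"
  shows "wins_MBTD G Dominator Dominator"
proof -
  let ?p = Dominator
  let ?S = "claimed ?p Staller" and ?D = "claimed ?p Dominator"
  let ?good = "\<lambda>h x. \<not> maker_wins_after V H (?S h) (?D h) \<longrightarrow> \<not> maker_wins V H (?S h) (insert x (?D h))"
  have "\<exists>x. distinct h \<and> set h \<subset> pverts G \<longrightarrow> x \<in> pverts G - set h \<and> ?good h x" for h
    unfolding maker_wins_after_def claimed_Un V_def by blast
  then obtain \<sigma> where \<sigma>: "strategy G \<sigma>"
    "\<And>h. distinct h \<Longrightarrow> set h \<subset> pverts G \<Longrightarrow> ?good h (\<sigma> h)"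
    by (rule greedy_strategy) blast
  have "winner G ?p h = Dominator" if h: "complete_play G h" "follows ?p Dominator \<sigma> h" for h
  proof -
    have inv: "if mover ?p m = Staller then \<not> maker_wins V H (?S (take m h)) (?D (take m h))
        else \<not> maker_wins_after V H (?S (take m h)) (?D (take m h))" if "m \<le> length h" for m
      using that
    proof (induction m)
      case 0 then show ?case using start by (auto simp: mover_def)
    next
      case (Suc m)
      then have m: "m < length h" by simp
      note step = complete_play_step[OF h(1) m]
      show ?case
      proof (cases "mover ?p m")
        case Dominator
        then have "\<not> maker_wins_after V H (?S (take m h)) (?D (take m h))" using Suc by auto
        moreover have "h ! m = \<sigma> (take m h)" using h(2) m Dominator by (auto simp: follows_def)
        ultimately show ?thesis using \<sigma>(2)[OF step(1,2)] Dominator m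
          by (simp add: claimed_take_Suc)
      next
        case Staller
        then have "\<not> maker_wins V H (?S (take m h)) (?D (take m h))" using Suc by auto
        moreover have "h ! m \<in> V - (?S (take m h) \<union> ?D (take m h))"
          using step(3) by (auto simp: V_def claimed_Un)
        ultimately have "\<not> maker_wins_after V H (insert (h ! m) (?S (take m h))) (?D (take m h))"
          using maker_wins_iff[of V H "?S (take m h)"] by blast
        then show ?thesis using Staller m by (simp add: claimed_take_Suc)
      qed
    qed
    have "\<not> (\<exists>e \<in> H. e \<subseteq> ?S h)" using inv[of "length h"]
      by (cases "mover ?p (length h)") (auto simp: maker_wins_after_def intro: maker_wins.won)
    then show ?thesis by (auto simp: winner_def staller_wins_play_iff H_def)
  qed
  then show ?thesis using \<sigma>(1) unfolding wins_MBTD_def by blast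
qed

text \<open>
  It is enough to win as the second player, because dropping Dominator's first vertex leaves a won position.
\<close>

lemma graph_S_if_maker_wins_second:
  assumes "pverts G \<noteq> {}" and "\<And>d. d \<in> pverts G \<Longrightarrow> maker_wins (pverts G) (winning_sets G) {} {d}"
  shows "graph_S G"
proof -
  have "maker_wins (pverts G) (winning_sets G) {} {}"
    using assms maker_wins_antimono by (metis all_not_in_conv empty_subsetI)
  moreover have "maker_wins_after (pverts G) (winning_sets G) {} {}"
    using assms by (auto simp: maker_wins_after_def)
  ultimately have "wins_MBTD G p Staller" for p
    by (intro staller_strategy) (cases p; simp)
  then show ?thesis by (simp add: graph_S_def)
qed

subsection \<open>Sums of games\<close>

lemma maker_loses_move:
  assumes "\<not> maker_wins V H A B" "a \<in> V - (A \<union> B)"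
  shows "\<not> (\<exists>e\<in>H. e \<subseteq> insert a A)"
    and "V - (insert a A \<union> B) = {} \<or> (\<exists>b \<in> V - (insert a A \<union> B). \<not> maker_wins V H (insert a A) (insert b B))"
  using assms maker_wins_iff[of V H A B] by (auto simp: maker_wins_after_def)

text \<open>
  Breaker wins a game that contains disjoint lost games \<open>(X i, E i)\<close> by answering in the component in which
  Maker has just moved, since every edge still alive contains an edge of some component. If that
  component is full, or Maker has moved outside all of them, any other reply will do, because additional
  vertices of Breaker are harmless.
\<close>

lemma maker_loses_sum:
  assumes inv: "\<And>i. i \<in> I \<Longrightarrow> \<not> maker_wins (X i) (E i) (A \<inter> X i) (B \<inter> X i)"
    and fam: "\<And>i. i \<in> I \<Longrightarrow> X i \<subseteq> V" "disjoint_family_on X I"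
    and E: "\<And>i e. i \<in> I \<Longrightarrow> e \<in> E i \<Longrightarrow> e \<subseteq> X i"
    and cover: "\<And>e. e \<in> H \<Longrightarrow> e \<inter> B - A \<noteq> {} \<or> (\<exists>i \<in> I. \<exists>f \<in> E i. f \<subseteq> e)"
  shows "\<not> maker_wins V H A B"
proof
  assume "maker_wins V H A B"
  then show False using inv cover
  proof (induction rule: maker_wins.induct)
    case (won e A B)
    then consider "e \<inter> B - A \<noteq> {}" | i f where "i \<in> I" "f \<in> E i" "f \<subseteq> e" by blast
    then show ?case
    proof cases
      case 1 then show ?thesis using won by blast
    next
      case 2
      then have "f \<subseteq> A \<inter> X i" using won E by blast
      then have "maker_wins (X i) (E i) (A \<inter> X i) (B \<inter> X i)" using 2 by (intro maker_wins.won)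
      then show ?thesis using 2 won.prems(1) by blast
    qed
  next
    case (finish e x A B)
    then consider "e \<inter> B - A \<noteq> {}" | i f where "i \<in> I" "f \<in> E i" "f \<subseteq> e" by blast
    then show ?case
    proof cases
      case 1 then show ?thesis using finish by blast
    next
      case 2
      then have f: "f \<subseteq> insert x A \<inter> X i" using finish E by blast
      have "maker_wins (X i) (E i) (A \<inter> X i) (B \<inter> X i)"
      proof (cases "x \<in> X i")
        case True then show ?thesis using f 2 finish by (intro maker_wins.finish[of f _ x]) auto
      next
        case False then show ?thesis using f 2 by (intro maker_wins.won[of f]) auto
      qed
      then show ?thesis using 2 finish.prems(1) by blast
    qed
  next
    case (move a A B)
    have cov: "\<And>b e. b \<noteq> a \<Longrightarrow> e \<in> H \<Longrightarrow> e \<inter> insert b B - insert a A \<noteq> {} \<or> (\<exists>i \<in> I. \<exists>f \<in> E i. f \<subseteq> e)"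
      using move.prems(2) move.hyps(1) by fastforce
    have other: "\<not> maker_wins (X i) (E i) (insert a A \<inter> X i) (insert b B \<inter> X i)"
      if "i \<in> I" "a \<notin> X i" for i b
    proof
      assume "maker_wins (X i) (E i) (insert a A \<inter> X i) (insert b B \<inter> X i)"
      moreover have "insert a A \<inter> X i = A \<inter> X i" using that by auto
      ultimately have "maker_wins (X i) (E i) (A \<inter> X i) (B \<inter> X i)"
        using maker_wins_antimono[of "X i" "E i" "A \<inter> X i" "insert b B \<inter> X i" "B \<inter> X i"] by auto
      then show False using move.prems that by blast
    qed
    have "\<exists>b \<in> V - (insert a A \<union> B). \<forall>i \<in> I. \<not> maker_wins (X i) (E i) (insert a A \<inter> X i) (insert b B \<inter> X i)"
    proof (cases "\<exists>i \<in> I. a \<in> X i")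
      case False then show ?thesis using move.hyps(2) other by blast
    next
      case True
      then obtain j where j: "j \<in> I" "a \<in> X j" by blast
      have uniq: "a \<notin> X i" if "i \<in> I" "i \<noteq> j" for i
        using disjoint_family_onD[OF fam(2) that(1) j(1)] j that by blast
      have eq: "insert a (A \<inter> X j) = insert a A \<inter> X j" using j by auto
      have aj: "a \<in> X j - (A \<inter> X j \<union> B \<inter> X j)" using j move.hyps by auto
      note lost = maker_loses_move[OF move.prems(1)[OF j(1)] aj, unfolded eq]
      from lost(2) show ?thesis
      proof
        assume none: "X j - (insert a A \<inter> X j \<union> B \<inter> X j) = {}"
        obtain b where b: "b \<in> V - (insert a A \<union> B)" using move.hyps by blast
        have bj: "insert b B \<inter> X j = B \<inter> X j" using none b by auto
        have "\<not> maker_wins (X j) (E j) (insert a A \<inter> X j) (insert b B \<inter> X j)"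
          unfolding bj by (subst maker_wins_iff) (use lost(1) none in blast)
        then show ?thesis using b other uniq by metis
      next
        assume "\<exists>b \<in> X j - (insert a A \<inter> X j \<union> B \<inter> X j).
          \<not> maker_wins (X j) (E j) (insert a A \<inter> X j) (insert b (B \<inter> X j))"
        then obtain b where b: "b \<in> X j - (insert a A \<inter> X j \<union> B \<inter> X j)"
          "\<not> maker_wins (X j) (E j) (insert a A \<inter> X j) (insert b (B \<inter> X j))" by blast
        have "insert b B \<inter> X j = insert b (B \<inter> X j)" using b by auto
        moreover have "b \<in> V - (insert a A \<union> B)" using b fam(1) j by auto
        ultimately show ?thesis using b(2) other uniq by metis
      qed
    qed
    then obtain b where b: "b \<in> V - (insert a A \<union> B)"
      "\<And>i. i \<in> I \<Longrightarrow> \<not> maker_wins (X i) (E i) (insert a A \<inter> X i) (insert b B \<inter> X i)" by blast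
    show ?case by (rule move.IH[OF b(1) b(2) cov]) (use b in auto)
  qed
qed

section \<open>Graphs made of triangles and diamonds\<close>

text \<open>
  The structure of the graph in functional form. A port is a vertex with exactly one neighbour \<open>mu p\<close> outside
  its own triangle or diamond: the vertices \<open>Tp\<close> of the triangles, permuted cyclically by \<open>rot\<close>, and the
  vertices \<open>Dp\<close> of degree two in the diamonds, exchanged by \<open>opp\<close>. The two remaining
  vertices of the diamond of \<open>c\<close> are \<open>m1 c\<close> and \<open>m2 c\<close>. Connectedness is stated as the absence of
  nonempty proper subsets closed under neighbours.
\<close>

locale triangle_diamond_graph =
  fixes V :: "'a set" and N :: "'a \<Rightarrow> 'a set" and Tp Dp :: "'a set"
    and rot mu opp m1 m2 :: "'a \<Rightarrow> 'a"
  assumes V_eq: "V = Tp \<union> Dp \<union> m1 ` Dp \<union> m2 ` Dp"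
    and finite_V: "finite V"
    and sep: "Tp \<inter> Dp = {}" "\<And>c. c \<in> Dp \<Longrightarrow> m1 c \<notin> Tp \<union> Dp" "\<And>c. c \<in> Dp \<Longrightarrow> m2 c \<notin> Tp \<union> Dp"
      "\<And>c c'. c \<in> Dp \<Longrightarrow> c' \<in> Dp \<Longrightarrow> m1 c \<noteq> m2 c'"
    and m_inj: "\<And>c c'. c \<in> Dp \<Longrightarrow> c' \<in> Dp \<Longrightarrow> m1 c = m1 c' \<or> m2 c = m2 c' \<Longrightarrow> c' = c \<or> c' = opp c"
    and m_opp [simp]: "\<And>c. c \<in> Dp \<Longrightarrow> m1 (opp c) = m1 c" "\<And>c. c \<in> Dp \<Longrightarrow> m2 (opp c) = m2 c"
    and rot [simp]: "\<And>t. t \<in> Tp \<Longrightarrow> rot t \<in> Tp" "\<And>t. t \<in> Tp \<Longrightarrow> rot t \<noteq> t"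
      "\<And>t. t \<in> Tp \<Longrightarrow> rot (rot (rot t)) = t"
    and opp [simp]: "\<And>c. c \<in> Dp \<Longrightarrow> opp c \<in> Dp" "\<And>c. c \<in> Dp \<Longrightarrow> opp c \<noteq> c" "\<And>c. c \<in> Dp \<Longrightarrow> opp (opp c) = c"
    and mu_port: "\<And>p. p \<in> Tp \<union> Dp \<Longrightarrow> mu p \<in> Tp \<union> Dp"
    and mu_mu [simp]: "\<And>p. p \<in> Tp \<union> Dp \<Longrightarrow> mu (mu p) = p"
    and mu_neq: "\<And>p. p \<in> Tp \<union> Dp \<Longrightarrow> mu p \<noteq> p"
    and mu_rot: "\<And>t. t \<in> Tp \<Longrightarrow> mu t \<noteq> rot t" and mu_opp: "\<And>c. c \<in> Dp \<Longrightarrow> mu c \<noteq> opp c"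
    and N_triangle: "\<And>t. t \<in> Tp \<Longrightarrow> N t = {rot t, rot (rot t), mu t}"
    and N_diamond: "\<And>c. c \<in> Dp \<Longrightarrow> N c = {m1 c, m2 c, mu c}" "\<And>c. c \<in> Dp \<Longrightarrow> N (m1 c) = {c, opp c, m2 c}"
      "\<And>c. c \<in> Dp \<Longrightarrow> N (m2 c) = {c, opp c, m1 c}"
    and connected: "\<And>S. S \<subseteq> V \<Longrightarrow> S \<noteq> {} \<Longrightarrow> (\<And>v. v \<in> S \<Longrightarrow> N v \<subseteq> S) \<Longrightarrow> S = V"
    and Tp_nonempty: "Tp \<noteq> {}" and Dp_nonempty: "Dp \<noteq> {}"
begin

abbreviation tri :: "'a \<Rightarrow> 'a set" where "tri t \<equiv> {t, rot t, rot (rot t)}"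

definition cell :: "'a \<Rightarrow> 'a set" where "cell c = {c, opp c, m1 c, m2 c}"

abbreviation wins :: "'a set \<Rightarrow> 'a set \<Rightarrow> bool" where "wins A B \<equiv> maker_wins V (N ` V) A B"

lemma in_V [simp, intro]: "t \<in> Tp \<Longrightarrow> t \<in> V" "c \<in> Dp \<Longrightarrow> c \<in> V" "c \<in> Dp \<Longrightarrow> m1 c \<in> V" "c \<in> Dp \<Longrightarrow> m2 c \<in> V"
  by (auto simp: V_eq)

lemma port_in_V [simp]: "p \<in> Tp \<union> Dp \<Longrightarrow> mu p \<in> V"
  using mu_port by blast

lemma not_both [simp]: "p \<in> Dp \<Longrightarrow> p \<notin> Tp" "p \<in> Tp \<Longrightarrow> p \<notin> Dp"
  using sep by auto

lemma rot_rot_neq [simp]: "t \<in> Tp \<Longrightarrow> rot (rot t) \<noteq> t" "t \<in> Tp \<Longrightarrow> t \<noteq> rot (rot t)" "t \<in> Tp \<Longrightarrow> t \<noteq> rot t"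
  "t \<in> Tp \<Longrightarrow> rot (rot t) \<noteq> rot t" "t \<in> Tp \<Longrightarrow> rot t \<noteq> rot (rot t)"
  using rot by metis+

lemma mu_rot_rot: "t \<in> Tp \<Longrightarrow> mu t \<noteq> rot (rot t)"
  using mu_rot[of "mu t"] by (metis UnI1 mu_mu rot(1,3))

lemma mu_inj: "p \<in> Tp \<union> Dp \<Longrightarrow> p' \<in> Tp \<union> Dp \<Longrightarrow> mu p = mu p' \<longleftrightarrow> p = p'"
  using mu_mu by metis

lemma cell_distinct [simp]:
  assumes "c \<in> Dp"
  shows "m1 c \<noteq> c" "m2 c \<noteq> c" "m1 c \<noteq> opp c" "m2 c \<noteq> opp c" "m1 c \<noteq> m2 c"
    "c \<noteq> m1 c" "c \<noteq> m2 c" "opp c \<noteq> m1 c" "opp c \<noteq> m2 c" "m2 c \<noteq> m1 c" "c \<noteq> opp c"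
  using assms sep(2,3,4) opp by (metis Un_iff)+

lemma cell_subset: "c \<in> Dp \<Longrightarrow> cell c \<subseteq> V"
  by (auto simp: cell_def)

lemma cell_opp [simp]: "c \<in> Dp \<Longrightarrow> cell (opp c) = cell c"
  by (auto simp: cell_def)

lemma cell_Tp: "c \<in> Dp \<Longrightarrow> cell c \<inter> Tp = {}"
  using sep by (auto simp: cell_def)

text \<open>
  Distinct diamonds are disjoint, and the ports of one diamond are \<open>c\<close> and \<open>opp c\<close>.
\<close>

lemma cells_meet:
  assumes D: "c \<in> Dp" "c' \<in> Dp" and x: "x \<in> cell c" "x \<in> cell c'"
  shows "c' = c \<or> c' = opp c"
proof -
  have port: "x \<in> Dp \<Longrightarrow> x = c \<or> x = opp c" "x \<in> Dp \<Longrightarrow> x = c' \<or> x = opp c'"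
    using D x sep(2)[OF D(1)] sep(2)[OF D(2)] sep(3)[OF D(1)] sep(3)[OF D(2)]
    by (auto simp: cell_def)
  show ?thesis
  proof (cases "x \<in> Dp")
    case True
    then have "x = c \<or> x = opp c" "x = c' \<or> x = opp c'" using port by auto
    then show ?thesis using opp(3)[OF D(1)] opp(3)[OF D(2)] by metis
  next
    case False
    then have "x \<noteq> c" "x \<noteq> opp c" "x \<noteq> c'" "x \<noteq> opp c'" using D opp(1) by metis+
    then have "x = m1 c \<or> x = m2 c" "x = m1 c' \<or> x = m2 c'"
      using x by (simp_all add: cell_def)
    then have "m1 c = m1 c' \<or> m2 c = m2 c'" using sep(4)[OF D] sep(4)[OF D(2,1)] by metis
    then show ?thesis using m_inj[OF D] by blast
  qed
qed

lemma tri_eq: "t \<in> Tp \<Longrightarrow> x \<in> tri t \<Longrightarrow> tri x = tri t"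
  by auto

lemma tri_Tp: "t \<in> Tp \<Longrightarrow> tri t \<subseteq> Tp"
  by auto

subsection \<open>Chains of diamonds\<close>

text \<open>
  \<open>chain p cs q\<close>: whoever leaves through the port \<open>p\<close> enters successive diamonds at the ports \<open>cs\<close>, leaving each
  by the opposite port, and reaches a triangle at \<open>q\<close>.
\<close>

inductive chain :: "'a \<Rightarrow> 'a list \<Rightarrow> 'a \<Rightarrow> bool" where
  Nil: "mu p \<in> Tp \<Longrightarrow> chain p [] (mu p)"
| Cons: "mu p \<in> Dp \<Longrightarrow> chain (opp (mu p)) cs q \<Longrightarrow> chain p (mu p # cs) q"

lemma chain_unique: "chain p cs q \<Longrightarrow> chain p cs' q' \<Longrightarrow> cs = cs' \<and> q = q'"
proof (induction arbitrary: cs' q' rule: chain.induct)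
  case (Nil p)
  from Nil(2,1) show ?case by (cases rule: chain.cases) auto
next
  case (Cons p cs q)
  from Cons.prems Cons.hyps(1) obtain ds where "cs' = mu p # ds" "chain (opp (mu p)) ds q'"
    by (cases rule: chain.cases) auto
  then show ?case using Cons.IH by auto
qed

lemma chain_set: "chain p cs q \<Longrightarrow> set cs \<subseteq> Dp"
  by (induction rule: chain.induct) auto

lemma chain_end: "chain p cs q \<Longrightarrow> q \<in> Tp"
  by (induction rule: chain.induct) auto

lemma chain_suffix: "chain p (cs @ c # cs') q \<Longrightarrow> chain (opp c) cs' q"
proof (induction cs arbitrary: p)
  case Nil then show ?case by (cases rule: chain.cases) auto
next
  case (Cons a cs)
  from Cons.prems show ?case by (cases rule: chain.cases) (auto intro: Cons.IH)
qed

text \<open>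
  The statement for \<open>p \<in> Dp\<close> is the generalisation that the induction needs: it describes the way back from
  \<open>q\<close> through \<open>cs\<close> and on past the diamond of \<open>p\<close>.
\<close>

lemma chain_rev_aux:
  "chain p cs q \<Longrightarrow> p \<in> Tp \<union> Dp \<Longrightarrow>
     (p \<in> Tp \<longrightarrow> chain q (rev (map opp cs)) p) \<and>
     (p \<in> Dp \<longrightarrow> (\<forall>es t. chain (opp p) es t \<longrightarrow> chain q (rev (map opp cs) @ p # es) t))"
proof (induction rule: chain.induct)
  case (Nil p)
  have m: "mu (mu p) = p" using Nil by simp
  show ?case using chain.Nil[of "mu p"] chain.Cons[of "mu p"] by (auto simp: m)
next
  case (Cons p cs q)
  let ?c = "mu p"
  have m: "mu ?c = p" and o: "opp (opp ?c) = ?c" "opp ?c \<in> Dp" using Cons by simp_all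
  have IH: "chain ?c es t \<Longrightarrow> chain q (rev (map opp cs) @ opp ?c # es) t" for es t
    using Cons.IH o by auto
  show ?case
  proof (intro conjI impI allI)
    assume "p \<in> Tp"
    then have "chain ?c [] p" using chain.Nil[of ?c] by (simp add: m)
    then show "chain q (rev (map opp (?c # cs))) p" using IH by simp
  next
    fix es t assume "p \<in> Dp" "chain (opp p) es t"
    then have "chain ?c (p # es) t" using chain.Cons[of ?c] by (simp add: m)
    then show "chain q (rev (map opp (?c # cs)) @ p # es) t" using IH by simp
  qed
qed

lemma chain_rev: "chain p cs q \<Longrightarrow> p \<in> Tp \<Longrightarrow> chain q (rev (map opp cs)) p"
  using chain_rev_aux by blast

text \<open>
  Crossing one edge and, if this leads into a diamond, crossing that diamond as well is an injective
  map on the finite set of ports. Iterating it therefore leads back to \<open>p\<close>, so a triangle is reached.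
\<close>

lemma chain_exists:
  assumes "p \<in> Tp"
  shows "\<exists>cs q. chain p cs q"
proof -
  define f where "f x = (if x \<in> Tp \<union> Dp then (if mu x \<in> Dp then opp (mu x) else mu x) else x)" for x
  let ?P = "Tp \<union> Dp"
  have closed: "f x \<in> ?P" if "x \<in> ?P" for x using that mu_port[of x] by (auto simp: f_def)
  have unstep: "x = mu (if f x \<in> Dp then opp (f x) else f x)" if "x \<in> ?P" for x
    using that mu_port[OF that] by (auto simp: f_def)
  have "inj f"
  proof (rule injI)
    fix x y assume eq: "f x = f y"
    consider "x \<in> ?P" "y \<in> ?P" | "x \<notin> ?P" "y \<notin> ?P" | "x \<in> ?P" "y \<notin> ?P" | "x \<notin> ?P" "y \<in> ?P" by blast
    then show "x = y"
    proof cases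
      case 1 then show ?thesis using unstep eq by metis
    next
      case 2 then show ?thesis using eq by (simp add: f_def)
    next
      case 3 then have "f y = y" by (simp add: f_def)
      then show ?thesis using closed[of x] eq 3 by simp
    next
      case 4 then have "f x = x" by (simp add: f_def)
      then show ?thesis using closed[of y] eq 4 by simp
    qed
  qed
  moreover have "(f ^^ n) p \<in> ?P" for n by (induction n) (use assms closed in auto)
  then have "finite {y. \<exists>n. y = (f ^^ n) p}"
    using finite_subset[of "{y. \<exists>n. y = (f ^^ n) p}" V] finite_V by (fastforce simp: V_eq)
  ultimately obtain n where n: "n > 0" "(f ^^ n) p = p" by (rule funpow_inj_finite)
  have "\<exists>cs q. chain x cs q" if "(f ^^ k) x \<in> Tp" "k > 0" "x \<in> ?P" for k x
    using that
  proof (induction k arbitrary: x)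
    case (Suc k)
    show ?case
    proof (cases "mu x \<in> Tp")
      case True then show ?thesis using chain.Nil by blast
    next
      case False
      then have D: "mu x \<in> Dp" using mu_port Suc.prems by blast
      then have fx: "f x = opp (mu x)" using Suc.prems(3) by (simp add: f_def)
      have "k > 0" using Suc.prems(1) fx D by (cases k) auto
      moreover have "(f ^^ k) (f x) \<in> Tp" using Suc.prems(1) by (simp add: funpow_swap1)
      ultimately obtain cs q where "chain (f x) cs q"
        using Suc.IH closed[OF Suc.prems(3)] by blast
      then show ?thesis using chain.Cons[OF D] fx by auto
    qed
  qed simp
  from this[of n p] show ?thesis using n assms by simp
qed

definition ch :: "'a \<Rightarrow> 'a list" where "ch p = (THE cs. \<exists>q. chain p cs q)"
text \<open>
  The chain of diamonds starting at the triangle port \<open>p\<close> is \<open>ch p\<close>, its vertices are \<open>K p\<close>, and \<open>nu p\<close> is the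
  triangle port at its other end. Thus \<open>nu\<close> is a perfect matching of the triangle ports, and its pairs are
  the edges of the cubic multigraph of triangles.
\<close>

definition nu :: "'a \<Rightarrow> 'a" where "nu p = (THE q. \<exists>cs. chain p cs q)"
definition K :: "'a \<Rightarrow> 'a set" where "K p = (\<Union>c \<in> set (ch p). cell c)"

lemma chain_iff:
  assumes "chain p cs q"
  shows "ch p = cs \<and> nu p = q"
proof
  show "ch p = cs" unfolding ch_def
  proof (rule the_equality)
    show "\<exists>q. chain p cs q" using assms by blast
    show "cs' = cs" if "\<exists>q. chain p cs' q" for cs' using that chain_unique[OF assms] by metis
  qed
  show "nu p = q" unfolding nu_def
  proof (rule the_equality)
    show "\<exists>cs. chain p cs q" using assms by blast
    show "q' = q" if "\<exists>cs. chain p cs q'" for q' using that chain_unique[OF assms] by metis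
  qed
qed

lemma chain_ch: "p \<in> Tp \<Longrightarrow> chain p (ch p) (nu p)"
proof -
  assume "p \<in> Tp"
  then obtain cs q where c: "chain p cs q" using chain_exists by blast
  then show ?thesis using chain_iff[OF c] by simp
qed

lemma nu_Tp [simp]: "p \<in> Tp \<Longrightarrow> nu p \<in> Tp"
  using chain_ch chain_end by blast

lemma nu_nu [simp]: "p \<in> Tp \<Longrightarrow> nu (nu p) = p"
  and ch_nu: "p \<in> Tp \<Longrightarrow> ch (nu p) = rev (map opp (ch p))"
  using chain_rev[OF chain_ch] chain_iff by blast+

lemma nu_eq_iff: "p \<in> Tp \<Longrightarrow> p' \<in> Tp \<Longrightarrow> nu p = nu p' \<longleftrightarrow> p = p'"
  using nu_nu by metis

lemma ch_Dp: "p \<in> Tp \<Longrightarrow> set (ch p) \<subseteq> Dp"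
  using chain_ch chain_set by blast

lemma K_nu [simp]: "p \<in> Tp \<Longrightarrow> K (nu p) = K p"
  using ch_Dp[of p] by (force simp: K_def ch_nu)

lemma chain_nth_Suc:
  "chain p cs q \<Longrightarrow> Suc i < length cs \<Longrightarrow> cs ! Suc i = mu (opp (cs ! i))"
proof (induction arbitrary: i rule: chain.induct)
  case (Cons p cs q)
  show ?case
  proof (cases i)
    case 0
    then obtain c cs' where "cs = c # cs'" using Cons.prems by (cases cs) auto
    then show ?thesis using Cons.hyps(2) 0 by (auto elim: chain.cases)
  next
    case (Suc j) then show ?thesis using Cons.IH[of j] Cons.prems by simp
  qed
qed simp

lemma chain_nil_iff: "p \<in> Tp \<Longrightarrow> ch p = [] \<longleftrightarrow> mu p \<in> Tp" "p \<in> Tp \<Longrightarrow> ch p = [] \<Longrightarrow> nu p = mu p"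
  "p \<in> Tp \<Longrightarrow> ch p \<noteq> [] \<Longrightarrow> hd (ch p) = mu p"
  using chain_ch[of p] by (auto elim: chain.cases)

text \<open>
  A chain returning to its first port would be invariant under reversal. In its middle, \<open>mu\<close> or \<open>opp\<close> would
  have a fixed point.
\<close>

lemma nu_neq [simp]: "p \<in> Tp \<Longrightarrow> nu p \<noteq> p"
proof
  assume p: "p \<in> Tp" "nu p = p"
  define cs where "cs = ch p"
  have c: "chain p cs p" using chain_ch[OF p(1)] p(2) by (simp add: cs_def)
  have pal: "cs = rev (map opp cs)" using ch_nu[OF p(1)] p(2) by (simp add: cs_def)
  have nth: "cs ! i = opp (cs ! (length cs - Suc i))" if "i < length cs" for i
    using arg_cong[OF pal, of "\<lambda>l. l ! i"] that by (simp add: rev_nth)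
  have D: "cs ! i \<in> Dp" if "i < length cs" for i using chain_set[OF c] that by auto
  show False
  proof (cases "even (length cs)")
    case True
    then obtain k where k: "length cs = 2 * k" by blast
    show ?thesis
    proof (cases k)
      case 0
      then have "mu p = p" using c k by (auto elim: chain.cases)
      then show ?thesis using mu_neq p by blast
    next
      case (Suc j)
      have "cs ! Suc j = opp (cs ! j)" using nth[of "Suc j"] k Suc by simp
      moreover have "cs ! Suc j = mu (opp (cs ! j))" using chain_nth_Suc[OF c, of j] k Suc by simp
      moreover have "opp (cs ! j) \<in> Dp" using D[of j] k Suc by simp
      ultimately show ?thesis using mu_neq by (metis UnI2)
    qed
  next
    case False
    then obtain k where k: "length cs = 2 * k + 1" by (blast elim: oddE)
    then have "cs ! k = opp (cs ! k)" using nth[of k] by simp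
    then show ?thesis using D[of k] k opp(2) by fastforce
  qed
qed

text \<open>
  A diamond entered at \<open>c\<close> determines the rest of the chain, and hence its end.
\<close>

lemma ch_meet:
  assumes "x \<in> Tp" "y \<in> Tp" "c \<in> set (ch x)" "c \<in> set (ch y)"
  shows "x = y"
proof -
  obtain a b a' b' where "ch x = a @ c # b" "ch y = a' @ c # b'"
    using assms(3,4) by (meson split_list)
  then have "chain (opp c) b (nu x)" "chain (opp c) b' (nu y)"
    using chain_ch[OF assms(1)] chain_ch[OF assms(2)] chain_suffix by metis+
  then show ?thesis using chain_unique nu_eq_iff assms by blast
qed

lemma opp_notin_ch: "p \<in> Tp \<Longrightarrow> c \<in> set (ch p) \<Longrightarrow> opp c \<notin> set (ch p)"
proof
  assume p: "p \<in> Tp" "c \<in> set (ch p)" "opp c \<in> set (ch p)"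
  have "opp (opp c) \<in> set (ch (nu p))" using p by (simp add: ch_nu)
  then have "c \<in> set (ch (nu p))" using p ch_Dp[of p] by (simp add: subset_iff)
  then show False using ch_meet[of p "nu p" c] p nu_neq[of p] by simp
qed

lemma distinct_ch: "p \<in> Tp \<Longrightarrow> distinct (ch p)"
proof (rule ccontr)
  assume p: "p \<in> Tp" "\<not> distinct (ch p)"
  then obtain a b e c where "ch p = a @ [c] @ b @ [c] @ e" by (metis not_distinct_decomp)
  then have "chain (opp c) (b @ c # e) (nu p)" "chain (opp c) e (nu p)"
    using chain_ch[OF p(1)] chain_suffix[of p a c "b @ c # e"] chain_suffix[of p "a @ c # b" c e] by auto
  then have "b @ c # e = e" using chain_unique by blast
  then show False using arg_cong[of _ _ length] by fastforce
qed

lemma K_meet: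
  assumes "x \<in> Tp" "y \<in> Tp" "v \<in> K x" "v \<in> K y"
  shows "y = x \<or> y = nu x"
proof -
  obtain c c' where c: "c \<in> set (ch x)" "v \<in> cell c" "c' \<in> set (ch y)" "v \<in> cell c'"
    using assms by (auto simp: K_def)
  then have D: "c \<in> Dp" "c' \<in> Dp" using ch_Dp assms by blast+
  from cells_meet[OF D c(2,4)] consider "c' = c" | "c' = opp c" by blast
  then show ?thesis
  proof cases
    case 1 then show ?thesis using ch_meet assms c by blast
  next
    case 2
    then have "c' \<in> set (ch (nu x))" using c assms by (simp add: ch_nu)
    then show ?thesis using ch_meet assms c by (metis nu_Tp)
  qed
qed

lemma K_subset: "p \<in> Tp \<Longrightarrow> K p \<subseteq> V - Tp"
  using ch_Dp cell_subset cell_Tp unfolding K_def by blast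

lemma mu_cases:
  assumes "p \<in> Tp"
  obtains "mu p = nu p" "K p = {}" "ch p = []" | "mu p \<in> Dp" "cell (mu p) \<subseteq> K p" "mu p \<in> set (ch p)"
proof (cases "ch p = []")
  case True then show ?thesis using that(1) chain_nil_iff[OF assms] by (simp add: K_def)
next
  case False
  then have "mu p \<in> set (ch p)" using chain_nil_iff(3)[OF assms] by (metis hd_in_set)
  then show ?thesis using that(2) ch_Dp[OF assms] by (auto simp: K_def)
qed

subsection \<open>Forced sequences\<close>

lemma force:
  assumes "v \<in> V" "N v \<subseteq> insert x (insert y A)" "x \<in> V - (A \<union> B)" "y \<in> V - (A \<union> B)" "x \<noteq> y"
    and "wins (insert y A) (insert x B)"
  shows "wins A B"
  by (rule maker_forces[of "N v" _ x y]) (use assms in auto)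

lemma finish:
  assumes "v \<in> V" "N v \<subseteq> insert x A" "x \<in> V - (A \<union> B)"
  shows "wins A B"
  by (rule maker_wins.finish[of "N v" _ x]) (use assms in auto)

text \<open>
  Staller holds the vertex before the diamond. The neighbourhood of \<open>c\<close> lets her take \<open>m1 c\<close> against
  \<open>m2 c\<close>; then the neighbourhood of \<open>m2 c\<close> lets her take \<open>opp c\<close> against \<open>c\<close>, and she stands at the exit.
\<close>

lemma cross_diamond:
  assumes c: "c \<in> Dp" "mu c \<in> A" "cell c \<inter> (A \<union> B) = {}"
    and w: "wins (insert (opp c) (insert (m1 c) A)) (insert c (insert (m2 c) B))"
  shows "wins A B"
proof -
  have free: "c \<notin> A" "c \<notin> B" "opp c \<notin> A" "opp c \<notin> B" "m1 c \<notin> A" "m1 c \<notin> B" "m2 c \<notin> A" "m2 c \<notin> B"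
    using c(3) by (auto simp: cell_def)
  show ?thesis
  proof (rule force[of c "m2 c" "m1 c"])
    show "wins (insert (m1 c) A) (insert (m2 c) B)"
    proof (rule force[of "m2 c" c "opp c"])
      show "N (m2 c) \<subseteq> insert c (insert (opp c) (insert (m1 c) A))" using c by (simp add: N_diamond)
    qed (use c free w in simp_all)
    show "N c \<subseteq> insert (m2 c) (insert (m1 c) A)" using c by (simp add: N_diamond)
  qed (use c free in simp_all)
qed

lemma push_chain:
  assumes "chain p cs q" "p \<in> A" "p \<in> Tp \<union> Dp" "distinct cs" "\<And>c. c \<in> set cs \<Longrightarrow> opp c \<notin> set cs"
    and "(\<Union>c \<in> set cs. cell c) \<inter> (A \<union> B) = {}"
    and "\<And>A' B'. A \<subseteq> A' \<Longrightarrow> A' \<subseteq> A \<union> (\<Union>c \<in> set cs. cell c) \<Longrightarrow> B \<subseteq> B' \<Longrightarrow>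
      B' \<subseteq> B \<union> (\<Union>c \<in> set cs. cell c) \<Longrightarrow> mu q \<in> A' \<Longrightarrow> wins A' B'"
  shows "wins A B"
  using assms
proof (induction arbitrary: A B rule: chain.induct)
  case (Nil p)
  then show ?case by simp
next
  case (Cons p cs q)
  let ?c = "mu p"
  have c: "?c \<in> Dp" "mu ?c = p" using Cons by auto
  have rest: "cell c' \<inter> cell ?c = {}" if "c' \<in> set cs" for c'
  proof -
    have "c' \<in> Dp" using chain_set[OF Cons.hyps(2)] that by blast
    moreover have "c' \<noteq> ?c" "c' \<noteq> opp ?c" using Cons.prems(3,4) that by auto
    ultimately show ?thesis using cells_meet[OF c(1)] by blast
  qed
  let ?A = "insert (opp ?c) (insert (m1 ?c) A)" and ?B = "insert ?c (insert (m2 ?c) B)"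
  have "wins ?A ?B"
  proof (rule Cons.IH)
    show "opp ?c \<in> ?A" "opp ?c \<in> Tp \<union> Dp" using c by auto
    show "distinct cs" using Cons.prems by simp
    show "opp c' \<notin> set cs" if "c' \<in> set cs" for c' using Cons.prems(4) that by simp
    show "(\<Union>c\<in>set cs. cell c) \<inter> (?A \<union> ?B) = {}"
      using rest Cons.prems(5) c by (fastforce simp: cell_def)
    fix A' B' assume "?A \<subseteq> A'" "A' \<subseteq> ?A \<union> (\<Union>c\<in>set cs. cell c)" "?B \<subseteq> B'"
      "B' \<subseteq> ?B \<union> (\<Union>c\<in>set cs. cell c)" "mu q \<in> A'"
    then show "wins A' B'" by (intro Cons.prems(6)) (auto simp: cell_def)
  qed
  moreover have "cell ?c \<inter> (A \<union> B) = {}" using Cons.prems(5) by auto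
  ultimately show ?case using c Cons.prems(1) by (rule_tac cross_diamond[of ?c A B]) simp_all
qed

text \<open>
  Crossing the diamonds one after another, Staller travels from \<open>p\<close> to the triangle of \<open>nu p\<close> and
  owns the outer neighbour of \<open>nu p\<close>, while only vertices of the chain have been claimed.
\<close>

lemma push:
  assumes "p \<in> Tp" "p \<in> A" "K p \<inter> (A \<union> B) = {}"
    and "\<And>A' B'. A \<subseteq> A' \<Longrightarrow> A' \<subseteq> A \<union> K p \<Longrightarrow> B \<subseteq> B' \<Longrightarrow> B' \<subseteq> B \<union> K p \<Longrightarrow> mu (nu p) \<in> A' \<Longrightarrow> wins A' B'"
  shows "wins A B"
  by (rule push_chain[OF chain_ch[OF assms(1)]])
    (use assms distinct_ch opp_notin_ch in \<open>auto simp: K_def\<close>)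

text \<open>
  The middle vertices have the neighbourhoods \<open>{c, opp c, m2 c}\<close> and \<open>{c, opp c, m1 c}\<close>, so taking \<open>opp c\<close> is
  a double threat.
\<close>

lemma diamond_win:
  assumes c: "c \<in> Dp" "c \<in> A" "opp c \<notin> A \<union> B" "m1 c \<notin> A \<union> B" "m2 c \<notin> A \<union> B"
  shows "wins A B"
proof (rule force[of "m1 c" "m2 c" "opp c"])
  show "N (m1 c) \<subseteq> insert (m2 c) (insert (opp c) A)" using c by (simp add: N_diamond)
  show "wins (insert (opp c) A) (insert (m2 c) B)"
  proof (rule finish[of "m2 c" "m1 c"])
    show "N (m2 c) \<subseteq> insert (m1 c) (insert (opp c) A)" using c by (simp add: N_diamond)
  qed (use c in simp_all)
qed (use c in simp_all)

lemma start:
  assumes "a \<in> V - (A \<union> B)" "V - (insert a A \<union> B) \<noteq> {}"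
    and "\<And>b. b \<in> V \<Longrightarrow> b \<notin> insert a A \<Longrightarrow> b \<notin> B \<Longrightarrow> wins (insert a A) (insert b B)"
  shows "wins A B"
  by (rule maker_wins.move[of a]) (use assms in auto)

text \<open>
  A port of an untouched diamond is a move with tempo: by \<open>diamond_win\<close> Dominator has to reply inside that
  diamond.
\<close>

lemma diamond_start:
  assumes c: "c \<in> Dp" "cell c \<inter> (A \<union> B) = {}"
    and w: "\<And>b. b \<in> cell c \<Longrightarrow> b \<noteq> c \<Longrightarrow> wins (insert c A) (insert b B)"
  shows "wins A B"
proof (rule start[of c])
  have free: "c \<notin> A \<union> B" "opp c \<notin> A \<union> B" "m1 c \<notin> A \<union> B" "m2 c \<notin> A \<union> B"
    using c(2) by (auto simp: cell_def)
  have "opp c \<in> V - (insert c A \<union> B)" using c free by simp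
  then show "V - (insert c A \<union> B) \<noteq> {}" "c \<in> V - (A \<union> B)" using c free by auto
  fix b assume b: "b \<in> V" "b \<notin> insert c A" "b \<notin> B"
  show "wins (insert c A) (insert b B)"
  proof (cases "b \<in> cell c")
    case True then show ?thesis using w b by auto
  next
    case False
    then have "b \<noteq> opp c" "b \<noteq> m1 c" "b \<noteq> m2 c" by (auto simp: cell_def)
    then show ?thesis using c free by (intro diamond_win[of c]) simp_all
  qed
qed

section \<open>Staller's walks\<close>

definition triangle :: "'a \<Rightarrow> 'a \<Rightarrow> 'a \<Rightarrow> bool" where
  "triangle q r s \<longleftrightarrow> q \<in> Tp \<and> (r = rot q \<and> s = rot (rot q) \<or> s = rot q \<and> r = rot (rot q))"

lemma triangle_ex: "q \<in> Tp \<Longrightarrow> triangle q (rot q) (rot (rot q))"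
  by (simp add: triangle_def)

lemma triangle_swap: "triangle q r s \<Longrightarrow> triangle q s r"
  by (auto simp: triangle_def)

lemma triangle_rotate: "triangle q r s \<Longrightarrow> triangle r s q"
  by (auto simp: triangle_def)

lemma triangleD:
  assumes "triangle q r s"
  shows "q \<in> Tp" "r \<in> Tp" "s \<in> Tp" "q \<noteq> r" "q \<noteq> s" "r \<noteq> s" "r \<noteq> q" "s \<noteq> q" "s \<noteq> r"
  using assms by (auto simp: triangle_def)

lemma triangle_N: "triangle q r s \<Longrightarrow> N q = {r, s, mu q}"
  by (auto simp: triangle_def N_triangle)

lemma triangle_mu: "triangle q r s \<Longrightarrow> mu q \<noteq> r" "triangle q r s \<Longrightarrow> mu q \<noteq> s" "triangle q r s \<Longrightarrow> mu q \<noteq> q"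
  using mu_rot mu_rot_rot mu_neq by (auto simp: triangle_def)

lemma triangle_tri: "triangle q r s \<Longrightarrow> tri q = {q, r, s}"
  by (auto simp: triangle_def)

lemma triangle_unique: "triangle q r s \<Longrightarrow> triangle q r' s' \<Longrightarrow> r' = r \<and> s' = s \<or> r' = s \<and> s' = r"
  by (auto simp: triangle_def)

lemma nu_if_mu: "p \<in> Tp \<Longrightarrow> mu p \<in> Tp \<Longrightarrow> nu p = mu p"
  using chain_nil_iff by blast

lemma mu_in_K:
  assumes "g \<in> Tp" "p \<in> Tp" "mu g \<in> K p"
  shows "g = p \<or> g = nu p"
  using assms(1)
proof (cases rule: mu_cases)
  case 1
  then show ?thesis using assms K_subset[of p] nu_Tp[of g] by auto
next
  case 2
  then have "mu g \<in> K g" by (auto simp: cell_def)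
  then show ?thesis using K_meet assms by blast
qed

text \<open>
  The end of a walk. At a visited triangle Staller owns \<open>x\<close>, and the port \<open>e\<close> through which she once entered is
  still free, because entering gives her only the neighbour of \<open>e\<close>. Returning at the third port \<open>s\<close>
  gives her \<open>mu s\<close>, and \<open>e\<close> completes the neighbourhood of \<open>s\<close>.
\<close>

lemma walk_closes:
  assumes st: "triangle s e x" and p: "p \<in> Tp" "p \<in> A" "nu p = s" "K p \<inter> (A \<union> B) = {}"
    and "x \<in> A" "e \<notin> A" "e \<notin> B"
  shows "wins A B"
proof (rule push[OF p(1,2,4)])
  fix A' B' assume A': "A \<subseteq> A'" "A' \<subseteq> A \<union> K p" "B \<subseteq> B'" "B' \<subseteq> B \<union> K p" "mu (nu p) \<in> A'"
  have e: "e \<in> Tp" "s \<in> Tp" using triangleD[OF st] by auto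
  then have "e \<notin> K p" using K_subset[OF p(1)] by blast
  then show "wins A' B'"
    using A' assms e by (intro finish[of s e]) (auto simp: triangle_N[OF st])
qed

text \<open>
  Staller's walk, by induction on the number of triangle ports not yet visited. The set \<open>Q\<close> contains the
  ports through which a triangle may be entered; each of them has a way out that leads to \<open>Q\<close> again.
  At any stage \<open>Vis\<close> consists of the ports of the visited triangles, \<open>p\<close> is the port that Staller has just taken,
  and \<open>Th\<close> contains the third ports, which Dominator was forced to take. All other visited ports outside the
  first triangle \<open>{a, g, h}\<close> are ends of chains already traversed (\<open>matched\<close>), so that the walk can only come
  back at a third port, where \<open>walk_closes\<close> applies, or at \<open>g\<close> or \<open>h\<close>.

  The hypothesis \<open>mode\<close> deals with the first triangle: either \<open>g\<close> and \<open>h\<close> are joined by a loop, so that the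
  walk never returns there, or Staller owns \<open>a\<close> while \<open>h\<close> and \<open>mu g\<close> are free. In the latter case a return
  to the first triangle has to be noticed one step earlier, which is why the ports of the current
  triangle that lead to \<open>g\<close> or \<open>h\<close> are considered before the others.
\<close>

lemma walk:
  assumes Q: "Q \<subseteq> Tp"
    and succ: "\<And>q. q \<in> Q \<Longrightarrow> q \<notin> {a, g, h} \<Longrightarrow> \<exists>r s. triangle q r s \<and> nu r \<in> Q"
    and base: "triangle a g h"
    and Vis: "Vis \<subseteq> Tp" "\<And>q r s. triangle q r s \<Longrightarrow> q \<in> Vis \<Longrightarrow> r \<in> Vis" "a \<in> Vis" "Th \<subseteq> Vis" "p \<in> Vis"
    and p: "p \<notin> Th" "p \<noteq> g" "p \<noteq> h" "p \<in> A" "nu p \<in> Q" "g \<notin> Th" "h \<notin> Th"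
    and matched: "\<And>v. v \<in> Vis \<Longrightarrow> v \<notin> Th \<Longrightarrow> v \<notin> {p, g, h} \<Longrightarrow> nu v \<in> Vis \<and> nu v \<notin> Th \<and> nu v \<notin> {p, g, h}"
    and fresh: "\<And>q r s. q \<in> Q \<Longrightarrow> q \<notin> Vis \<Longrightarrow> triangle q r s \<Longrightarrow> r \<notin> A \<union> B"
    and Kfresh: "\<And>q. q \<in> Q \<Longrightarrow> q \<in> Vis \<Longrightarrow> q \<in> Th \<union> {p, g, h} \<Longrightarrow> K q \<inter> (A \<union> B) = {}"
      "\<And>q. q \<in> Q \<Longrightarrow> q \<notin> Vis \<Longrightarrow> K q \<inter> (A \<union> B) = {}"
    and thirds: "\<And>s. s \<in> Th \<Longrightarrow> s \<in> Q \<Longrightarrow> \<exists>e x. triangle s e x \<and> x \<in> A \<and> e \<notin> A \<union> B"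
    and mode: "nu g = h \<or> (a \<in> A \<and> h \<notin> A \<union> B \<and> mu g \<notin> A \<union> B \<and> (g \<in> Q \<longrightarrow> nu g \<notin> Vis) \<and>
      (h \<in> Q \<longrightarrow> nu h \<notin> Vis) \<and> (\<forall>q \<in> Q - Vis. q \<notin> A \<union> B) \<and>
      (g \<notin> Q \<longrightarrow> (\<forall>q r s. q \<in> Q \<longrightarrow> triangle q r s \<longrightarrow> mu g \<noteq> r)))"
  shows "wins A B"
  using Vis p matched fresh Kfresh thirds mode
proof (induction "card (Tp - Vis)" arbitrary: Vis Th p A B rule: less_induct)
  case less
  note Vis = less.prems(1-5) and p = less.prems(6-12) and matched = less.prems(13)
    and fresh = less.prems(14) and Kfresh = less.prems(15,16) and thirds = less.prems(17) and mode = less.prems(18)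
  have ghT: "g \<in> Tp" "h \<in> Tp" "a \<in> Tp" "g \<noteq> h" "a \<noteq> g" "a \<noteq> h" using triangleD[OF base] by auto
  have ghV: "g \<in> Vis" "h \<in> Vis" using base Vis(2,3) triangle_swap by blast+
  have pT: "p \<in> Tp" using Vis by blast
  define q where "q = nu p"
  have qT: "q \<in> Tp" and nuq: "nu q = p" and Kq: "K q = K p" and qQ: "q \<in> Q" and qp: "q \<noteq> p"
    using pT p by (simp_all add: q_def)
  have Kp: "K p \<inter> (A \<union> B) = {}"
  proof (cases "q \<in> Vis")
    case True
    then have "q \<in> Th \<union> {p, g, h}" using matched[of q] nuq by auto
    then show ?thesis using Kfresh(1)[OF qQ True] Kq by simp
  next
    case False then show ?thesis using Kfresh(2)[OF qQ] Kq by simp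
  qed
  have KpT: "K p \<inter> Tp = {}" using K_subset[OF pT] by blast
  show ?case
  proof (cases "q \<in> Vis")
    case True
    have "q \<noteq> g"
    proof
      assume "q = g"
      then show False using mode nuq p qQ Vis(5) by auto
    qed
    moreover have "q \<noteq> h"
    proof
      assume "q = h"
      then show False using mode nuq p qQ Vis(5) ghT by (metis nu_nu)
    qed
    ultimately have "q \<in> Th" using matched[of q] True nuq qp by auto
    then obtain e x where ex: "triangle q e x" "x \<in> A" "e \<notin> A \<union> B" using thirds qQ by blast
    show ?thesis
      by (rule walk_closes[OF ex(1) pT p(4) q_def[symmetric] Kp ex(2)]) (use ex(3) in simp_all)
  next
    case False
    have notV: "r \<notin> Vis" if "triangle q r s" for r s
      using that False Vis(2) triangle_rotate triangle_swap by blast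
    have fr: "r \<notin> A" "r \<notin> B" "s \<notin> A" "s \<notin> B" if "triangle q r s" for r s
      using fresh[OF qQ False that] fresh[OF qQ False triangle_swap[OF that]] by auto
    consider r s where "triangle q r s" "nu r = g" "g \<in> Q" "nu g \<noteq> h"
      | r s where "triangle q r s" "nu r = h" "h \<in> Q" "nu g \<noteq> h"
          "\<And>r' s'. triangle q r' s' \<Longrightarrow> nu r' = g \<Longrightarrow> g \<notin> Q"
      | r s where "triangle q r s" "nu r \<in> Q"
          "\<And>r' s'. nu g \<noteq> h \<Longrightarrow> triangle q r' s' \<Longrightarrow> nu r' = g \<Longrightarrow> g \<notin> Q"
          "\<And>r' s'. nu g \<noteq> h \<Longrightarrow> triangle q r' s' \<Longrightarrow> nu r' = h \<Longrightarrow> h \<notin> Q"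
      using succ[OF qQ] False Vis(3) ghV by (metis insertE singletonD)
    then show ?thesis
    proof cases
      case 1
      \<comment> \<open>the walk returns at \<open>g\<close>: the free port \<open>h\<close> completes the neighbourhood of \<open>g\<close>\<close>
      note rs = triangleD[OF 1(1)]
      have m: "a \<in> A" "h \<notin> A" "h \<notin> B" using mode 1(4) by auto
      have nug: "nu g = r" using 1(2) rs by auto
      show ?thesis
      proof (rule push[OF pT p(4) Kp])
        fix A' B' assume A': "A \<subseteq> A'" "A' \<subseteq> A \<union> K p" "B \<subseteq> B'" "B' \<subseteq> B \<union> K p" "mu (nu p) \<in> A'"
        have free: "x \<notin> A' \<union> B'" if "x \<in> {r, s, h}" for x
          using that A' fr[OF 1(1)] m KpT rs ghT by blast
        show "wins A' B'"
        proof (rule force[of q s r])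
          show "N q \<subseteq> insert s (insert r A')" using A' q_def triangle_N[OF 1(1)] by auto
          show "wins (insert r A') (insert s B')"
          proof (rule walk_closes[of g h a r])
            show "triangle g h a" using base triangle_rotate by blast
            have "g \<noteq> p" "g \<noteq> q" using p(2) False ghV by auto
            then have "K g \<inter> K p = {}" using K_meet[of p g] pT ghT q_def by blast
            moreover have "K g \<inter> (A \<union> B) = {}" using Kfresh(1)[OF 1(3) ghV(1)] by simp
            moreover have "K g \<inter> Tp = {}" "K r = K g" using K_subset[of g] K_nu[of g] nug ghT by auto
            ultimately show "K r \<inter> (insert r A' \<union> insert s B') = {}" using A' rs by blast
          qed (use free m A' rs ghT 1 notV[OF 1(1)] notV[OF triangle_swap[OF 1(1)]] ghV in auto)
        qed (use free rs qT in auto)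
      qed
    next
      case 2
      \<comment> \<open>the walk returns at \<open>h\<close>: Staller claims \<open>h\<close> against \<open>mu g\<close> and runs along that chain from the other side, so that she attacks both \<open>q\<close> and \<open>r\<close>\<close>
      note rs = triangleD[OF 2(1)]
      have m: "a \<in> A" "h \<notin> A" "h \<notin> B" "mu g \<notin> A" "mu g \<notin> B" "q \<notin> A" "q \<notin> B"
        using mode 2(4) qQ False by auto
      have nuh: "nu h = r" using 2(2) rs by auto
      have hnot: "h \<noteq> p" "h \<noteq> q" "h \<noteq> r" "h \<noteq> s"
        using p(3) False notV[OF 2(1)] notV[OF triangle_swap[OF 2(1)]] ghV by auto
      have Kh: "K h \<inter> K p = {}" "K h \<inter> (A \<union> B) = {}" "K h \<inter> Tp = {}"
        using K_meet[of p h] hnot pT ghT q_def Kfresh(1)[OF 2(3) ghV(2)] K_subset[of h] by auto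
      have mug: "mu g \<notin> {q, r, s}"
      proof
        assume mg: "mu g \<in> {q, r, s}"
        then have "nu g = mu g" using nu_if_mu ghT rs by blast
        then have "mu g \<noteq> q" using nuq p ghT nu_nu by metis
        then obtain r' s' where "triangle q r' s'" "nu g = r'"
          using mg \<open>nu g = mu g\<close> 2(1) triangle_swap by blast
        then show False using 2(4,5) mode ghT qQ \<open>nu g = mu g\<close> nu_nu by metis
      qed
      have mugK: "mu g \<notin> K p" "mu g \<notin> K h" "mu g \<in> V"
      proof -
        show "mu g \<in> V" using ghT by simp
        have "g \<noteq> p" "g \<noteq> q" "g \<noteq> h" "g \<noteq> nu h" using p ghV False ghT nuh notV[OF 2(1)] by auto
        show "mu g \<notin> K p" "mu g \<notin> K h"
          using ghT(1) \<open>g \<noteq> p\<close> \<open>g \<noteq> q\<close> \<open>g \<noteq> h\<close> \<open>g \<noteq> nu h\<close> mu_in_K[of g p] mu_in_K[of g h] pT ghT q_def by auto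
      qed
      show ?thesis
      proof (rule push[OF pT p(4) Kp])
        fix A' B' assume A': "A \<subseteq> A'" "A' \<subseteq> A \<union> K p" "B \<subseteq> B'" "B' \<subseteq> B \<union> K p" "mu (nu p) \<in> A'"
        have free: "x \<notin> A' \<union> B'" if "x \<in> {q, r, s, h, mu g}" for x
          using that A' fr[OF 2(1)] m KpT rs ghT mugK by blast
        show "wins A' B'"
        proof (rule force[of g "mu g" h])
          show "N g \<subseteq> insert (mu g) (insert h A')"
            using triangle_N[OF triangle_rotate[OF base]] A' m by auto
          show "wins (insert h A') (insert (mu g) B')"
          proof (rule push[of h])
            have "mu g \<notin> K h" "h \<notin> K h" using mugK Kh ghT by auto
            then show "K h \<inter> (insert h A' \<union> insert (mu g) B') = {}" using Kh A' by blast
            fix A'' B'' assume A'': "insert h A' \<subseteq> A''" "A'' \<subseteq> insert h A' \<union> K h" "insert (mu g) B' \<subseteq> B''"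
              "B'' \<subseteq> insert (mu g) B' \<union> K h" "mu (nu h) \<in> A''"
            have free': "x \<notin> A'' \<union> B''" if "x \<in> {q, r, s}" for x
              using that free[of x] A'' Kh(3) rs mug hnot by blast
            show "wins A'' B''"
            proof (rule force[of q r s])
              show "N q \<subseteq> insert r (insert s A'')" using triangle_N[OF 2(1)] A' A'' q_def by auto
              show "wins (insert s A'') (insert r B'')"
              proof (rule finish[of r q])
                show "N r \<subseteq> insert q (insert s A'')"
                  using triangle_N[OF triangle_rotate[OF 2(1)]] A'' nuh by auto
              qed (use free' rs in auto)
            qed (use free' rs in auto)
          qed (use ghT in auto)
        qed (use free ghT mugK triangle_mu[OF triangle_rotate[OF base]] in auto)
      qed
    next
      case 3
      \<comment> \<open>an ordinary step: she leaves through \<open>r\<close> and Dominator has to take \<open>s\<close>\<close>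
      note rs = triangleD[OF 3(1)]
      have rsV: "r \<notin> Vis" "s \<notin> Vis" using notV[OF 3(1)] notV[OF triangle_swap[OF 3(1)]] .
      show ?thesis
      proof (rule push[OF pT p(4) Kp])
        fix A' B' assume A': "A \<subseteq> A'" "A' \<subseteq> A \<union> K p" "B \<subseteq> B'" "B' \<subseteq> B \<union> K p" "mu (nu p) \<in> A'"
        have free: "x \<notin> A' \<union> B'" if "x \<in> Tp" "x \<notin> A \<union> B" for x using that A' KpT by blast
        show "wins A' B'"
        proof (rule force[of q s r])
          show "N q \<subseteq> insert s (insert r A')" using A' q_def triangle_N[OF 3(1)] by auto
          show "wins (insert r A') (insert s B')"
          proof (rule less.hyps[of "Vis \<union> {q, r, s}" "insert s Th" r])
            have "Tp - (Vis \<union> {q, r, s}) \<subset> Tp - Vis" using qT False by blast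
            then show "card (Tp - (Vis \<union> {q, r, s})) < card (Tp - Vis)"
              using finite_V by (intro psubset_card_mono) (auto simp: V_eq)
            show "Vis \<union> {q, r, s} \<subseteq> Tp" using Vis rs by auto
            show "r' \<in> Vis \<union> {q, r, s}" if "triangle q' r' s'" "q' \<in> Vis \<union> {q, r, s}" for q' r' s'
              using that Vis(2)[OF that(1)] triangle_unique[OF that(1)] 3(1) triangle_rotate by blast
            fix v assume v: "v \<in> Vis \<union> {q, r, s}" "v \<notin> insert s Th" "v \<notin> {r, g, h}"
            show "nu v \<in> Vis \<union> {q, r, s} \<and> nu v \<notin> insert s Th \<and> nu v \<notin> {r, g, h}"
            proof -
              consider "v = p" | "v = q" | "v \<in> Vis" "v \<noteq> p" using v by blast
              then show ?thesis
              proof cases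
                case 1 then show ?thesis using q_def rs False Vis(4) ghV by auto
              next
                case 2 then show ?thesis using nuq p Vis(5) rsV by auto
              next
                case 3 then show ?thesis using matched[of v] v rsV by auto
              qed
            qed
          next
            fix q' r' s' assume q': "q' \<in> Q" "q' \<notin> Vis \<union> {q, r, s}" "triangle q' r' s'"
            then have "r' \<notin> {r, s}" using 3(1) triangle_rotate triangle_unique by blast
            then show "r' \<notin> insert r A' \<union> insert s B'"
              using fresh[OF q'(1) _ q'(3)] free[of r'] triangleD[OF q'(3)] q'(2) by auto
          next
            have Kstep: "K x \<inter> (insert r A' \<union> insert s B') = {}"
              if "x \<in> Tp" "x \<noteq> p" "x \<noteq> q" "K x \<inter> (A \<union> B) = {}" for x
            proof -
              have "K x \<inter> K p = {}" using K_meet[of p x] that pT q_def by blast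
              moreover have "K x \<inter> Tp = {}" using K_subset[OF that(1)] by blast
              ultimately show ?thesis using that A' rs by blast
            qed
            have QT: "x \<in> Tp" if "x \<in> Q" for x using Q that by blast
            show "K q' \<inter> (insert r A' \<union> insert s B') = {}"
              if "q' \<in> Q" "q' \<in> Vis \<union> {q, r, s}" "q' \<in> insert s Th \<union> {r, g, h}" for q'
              using that Kstep[OF QT[OF that(1)]] Kfresh[OF that(1)] p rs rsV False ghV Vis by blast
            show "K q' \<inter> (insert r A' \<union> insert s B') = {}" if "q' \<in> Q" "q' \<notin> Vis \<union> {q, r, s}" for q'
              using that Kstep[OF QT[OF that(1)]] Kfresh(2)[OF that(1)] Vis by blast
          next
            fix s' assume s': "s' \<in> insert s Th" "s' \<in> Q"
            show "\<exists>e x. triangle s' e x \<and> x \<in> insert r A' \<and> e \<notin> insert r A' \<union> insert s B'"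
            proof (cases "s' = s")
              case True
              have "triangle s q r" using 3(1) triangle_rotate by blast
              moreover have "q \<notin> A \<union> B" using fresh[OF _ rsV(2) \<open>triangle s q r\<close>] s' True by blast
              ultimately show ?thesis using free[OF qT] rs True by auto
            next
              case ne: False
              then obtain e x where ex: "triangle s' e x" "x \<in> A" "e \<notin> A \<union> B" using thirds s' by blast
              then have "e \<in> Vis" using Vis(2,4) s' ne by blast
              then show ?thesis using ex free[of e] A' Vis rsV by (intro exI[of _ e] exI[of _ x]) auto
            qed
          next
            show "nu g = h \<or> (a \<in> insert r A' \<and> h \<notin> insert r A' \<union> insert s B' \<and> mu g \<notin> insert r A' \<union> insert s B' \<and>
              (g \<in> Q \<longrightarrow> nu g \<notin> Vis \<union> {q, r, s}) \<and> (h \<in> Q \<longrightarrow> nu h \<notin> Vis \<union> {q, r, s}) \<and>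
              (\<forall>q' \<in> Q - (Vis \<union> {q, r, s}). q' \<notin> insert r A' \<union> insert s B') \<and>
              (g \<notin> Q \<longrightarrow> (\<forall>q r s. q \<in> Q \<longrightarrow> triangle q r s \<longrightarrow> mu g \<noteq> r)))"
            proof (cases "nu g = h")
              case ne: False
              note m = mode[simplified ne simp_thms]
              have QT: "x \<in> Tp" if "x \<in> Q" for x using Q that by blast
              have end_g: "nu g \<noteq> x" if "g \<in> Q" "x \<in> {r, s}" for x
                using that 3(3)[OF ne 3(1)] 3(3)[OF ne triangle_swap[OF 3(1)]] nu_nu[OF ghT(1)] by blast
              have end_h: "nu h \<noteq> x" if "h \<in> Q" "x \<in> {r, s}" for x
                using that 3(4)[OF ne 3(1)] 3(4)[OF ne triangle_swap[OF 3(1)]] nu_nu[OF ghT(2)] by blast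
              have gq: "g \<noteq> p" "g \<noteq> q" "h \<noteq> p" "nu g \<noteq> q" "nu h \<noteq> q"
                using p False ghV nuq nu_nu[OF ghT(1)] nu_nu[OF ghT(2)] by auto
              have "mu g \<notin> K p" using mu_in_K[OF ghT(1) pT] gq q_def by blast
              moreover have "mu g \<noteq> r" "mu g \<noteq> s"
                using m end_g nu_if_mu[OF ghT(1)] rs(2,3) qQ 3(1) triangle_swap[OF 3(1)] by blast+
              ultimately have mg: "mu g \<notin> insert r A' \<union> insert s B'" using m A' by blast
              have "h \<notin> insert r A' \<union> insert s B'" using m free[OF ghT(2)] ghV rsV by blast
              moreover have "q' \<notin> insert r A' \<union> insert s B'" if "q' \<in> Q - (Vis \<union> {q, r, s})" for q'
                using that m free[of q'] QT[of q'] by blast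
              ultimately show ?thesis using m mg A' end_g end_h gq by blast
            qed simp
          qed (use rs rsV p Vis 3 ghV A' in auto)
        qed (use free fr[OF 3(1)] rs qT in auto)
      qed
    qed
  qed
qed

section \<open>First moves for Staller\<close>

text \<open>
  The outer neighbour of an entrance lies in the same chain or is its first port; this makes the union
  of whole chains a closed set in \<open>ports_connected\<close>.
\<close>

lemma chain_neighbours:
  "chain p cs q \<Longrightarrow> p \<in> Tp \<union> Dp \<Longrightarrow> c \<in> set cs \<Longrightarrow> mu c \<in> insert p (opp ` set cs)"
proof (induction rule: chain.induct)
  case (Cons p cs q)
  then show ?case
  proof (cases "c = mu p")
    case True then show ?thesis using Cons.prems by simp
  next
    case False
    then show ?thesis using Cons by auto
  qed
qed simp

text \<open>
  Connectedness of the graph, transferred to the multigraph of triangles.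
\<close>

lemma ports_connected:
  assumes C: "C \<subseteq> Tp" "C \<noteq> {}" and tri: "\<And>q r s. triangle q r s \<Longrightarrow> q \<in> C \<Longrightarrow> r \<in> C"
    and nu: "\<And>q. q \<in> C \<Longrightarrow> nu q \<in> C"
  shows "C = Tp" "V = Tp \<union> (\<Union>p \<in> C. K p)"
proof -
  let ?S = "C \<union> (\<Union>p \<in> C. K p)"
  have S: "?S = V"
  proof (rule connected)
    show "?S \<subseteq> V" using C K_subset by blast
    show "?S \<noteq> {}" using C by blast
    fix v assume "v \<in> ?S"
    then consider "v \<in> C" | p c where "p \<in> C" "c \<in> set (ch p)" "v \<in> cell c" by (auto simp: K_def)
    then show "N v \<subseteq> ?S"
    proof cases
      case 1
      then have v: "v \<in> Tp" using C by blast
      note t = triangle_ex[OF v]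
      have "rot v \<in> C" "rot (rot v) \<in> C" using tri[OF t 1] tri[OF triangle_swap[OF t] 1] by auto
      moreover from v have "mu v \<in> ?S"
      proof (cases rule: mu_cases)
        case 1 then show ?thesis using nu \<open>v \<in> C\<close> by auto
      next
        case 2 then show ?thesis using \<open>v \<in> C\<close> by (auto simp: cell_def)
      qed
      ultimately show ?thesis using triangle_N[OF t] by simp
    next
      case 2
      have pT: "p \<in> Tp" using 2 C by blast
      have cD: "c \<in> Dp" using 2 ch_Dp[OF pT] by blast
      have port: "mu e \<in> ?S" if "e \<in> set (ch p)" "p \<in> C" for e p
      proof -
        have pT: "p \<in> Tp" using that C by blast
        have "mu e \<in> insert p (opp ` set (ch p))"
          using chain_neighbours[OF chain_ch[OF pT]] that pT by blast
        then show ?thesis using that by (auto simp: K_def cell_def)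
      qed
      have "opp c \<in> set (ch (nu p))" using 2 pT by (simp add: ch_nu)
      then have "mu c \<in> ?S" "mu (opp c) \<in> ?S" using port 2 nu by blast+
      moreover have "cell c \<subseteq> ?S" using 2 by (auto simp: K_def)
      moreover have "v = c \<or> v = opp c \<or> v = m1 c \<or> v = m2 c" using 2(3) by (simp add: cell_def)
      ultimately show ?thesis using cD by (elim disjE) (simp_all add: N_diamond cell_def)
    qed
  qed
  show "C = Tp"
  proof
    show "Tp \<subseteq> C"
    proof
      fix t assume t: "t \<in> Tp"
      then have "t \<in> ?S" using S by simp
      then show "t \<in> C" using t K_subset C by blast
    qed
  qed fact
  then show "V = Tp \<union> (\<Union>p \<in> C. K p)" using S by simp
qed

text \<open>
  Two triangles joined by three edges would be a component without a diamond.
\<close>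

lemma no_prism:
  assumes "triangle q r s"
  shows "\<not> triangle (mu q) (mu r) (mu s)"
proof
  assume t: "triangle (mu q) (mu r) (mu s)"
  note T = triangleD[OF assms] triangleD[OF t]
  have nuK: "nu x = mu x \<and> K x = {}" if "x \<in> Tp" "mu x \<in> Tp" for x
    using chain_nil_iff[OF that(1)] that by (auto simp: K_def)
  have mm: "mu (mu q) = q" "mu (mu r) = r" "mu (mu s) = s" using T by auto
  let ?C = "{q, r, s, mu q, mu r, mu s}"
  have "V = Tp \<union> (\<Union>p \<in> ?C. K p)"
  proof (rule ports_connected(2))
    show "?C \<subseteq> Tp" using T by auto
    show "r' \<in> ?C" if "triangle q' r' s'" "q' \<in> ?C" for q' r' s'
      using that assms t triangle_rotate triangle_swap triangle_unique
      by (smt (verit, best) insertE insertI1 insertI2 singletonD)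
    show "nu q' \<in> ?C" if "q' \<in> ?C" for q' using that nuK T mm by auto
  qed simp
  moreover have "K p = {}" if "p \<in> ?C" for p using that nuK T mm by auto
  ultimately have "V = Tp" by simp
  then show False using Dp_nonempty in_V(2) not_both by blast
qed

subsection \<open>A triangle with a loop\<close>

text \<open>
  Staller claims \<open>a\<close>. She now threatens to take \<open>mu g\<close>, the entrance of a diamond of the loop: the neighbourhood of
  \<open>g\<close> forces the reply \<open>h\<close>, and \<open>diamond_win\<close> follows. Whatever Dominator does against this lies at \<open>h\<close> or on
  the loop, where it does not hinder a walk that starts at \<open>a\<close> and never returns to this triangle.
\<close>

lemma loop_start:
  assumes t: "triangle a g h" and loop: "nu g = h"
    and Q: "Q \<subseteq> Tp" "\<And>q. q \<in> Q \<Longrightarrow> \<exists>r s. triangle q r s \<and> nu r \<in> Q" "nu a \<in> Q"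
    and d: "d \<notin> {a, g, h}" "d \<notin> K g" "\<And>q r s. q \<in> Q \<Longrightarrow> triangle q r s \<Longrightarrow> r \<noteq> d" "\<And>q. q \<in> Q \<Longrightarrow> d \<notin> K q"
  shows "wins {} {d}"
proof (rule start[of a])
  note T = triangleD[OF t]
  define c where "c = mu g"
  have tg: "triangle g h a" using t triangle_rotate by blast
  from T(2) have "c \<in> Dp \<and> cell c \<subseteq> K g"
  proof (cases rule: mu_cases)
    case 1 then show ?thesis using triangle_mu(1)[OF tg] loop by auto
  qed (simp add: c_def)
  then have c: "c \<in> Dp" "cell c \<subseteq> K g" by auto
  have KT: "K x \<inter> Tp = {}" if "x \<in> Tp" for x using K_subset[OF that] by blast
  show "a \<in> V - ({} \<union> {d})" "V - (insert a {} \<union> {d}) \<noteq> {}" using T d by auto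
  fix b assume b: "b \<in> V" "b \<notin> insert a {}" "b \<notin> {d}"
  show "wins (insert a {}) (insert b {d})"
  proof (cases "b \<in> insert h (cell c)")
    case False
    have cT: "c \<notin> Tp" "opp c \<notin> Tp" "m1 c \<notin> Tp" "m2 c \<notin> Tp" "c \<in> K g" "opp c \<in> K g" "m1 c \<in> K g" "m2 c \<in> K g"
      using cell_Tp[OF c(1)] c(2) by (auto simp: cell_def)
    have bc: "b \<noteq> h" "b \<noteq> c" "b \<noteq> opp c" "b \<noteq> m1 c" "b \<noteq> m2 c" using False by (auto simp: cell_def)
    have free: "x \<notin> {a, b, d, h}" if "x \<in> {c, opp c, m1 c, m2 c}" for x
      using that cT bc d T by auto
    show ?thesis
    proof (rule force[of g h c])
      show "N g \<subseteq> insert h (insert c (insert a {}))" using triangle_N[OF tg] by (auto simp: c_def)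
      show "wins (insert c (insert a {})) (insert h (insert b {d}))"
        by (rule diamond_win[of c]) (use c free[of c] free[of "opp c"] free[of "m1 c"] free[of "m2 c"] in auto)
    qed (use T c free[of c] bc d in auto)
  next
    case True
    then have b': "b = h \<or> b \<in> K g" using c by blast
    have gh: "g \<noteq> h" "nu h = g" "K h = K g" using loop T by auto
    have outside: "nu r \<noteq> g \<and> nu r \<noteq> h" if "r \<in> Tp" "r \<noteq> g" "r \<noteq> h" for r
      using that loop gh(2) nu_nu[OF that(1)] by metis
    show ?thesis
    proof (rule walk[where Q = "Q - {g, h}" and Vis = "{a, g, h}" and Th = "{}" and p = a, OF _ _ t])
      show "Q - {g, h} \<subseteq> Tp" using Q by blast
      show "\<exists>r s. triangle q r s \<and> nu r \<in> Q - {g, h}" if q: "q \<in> Q - {g, h}" "q \<notin> {a, g, h}" for q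
      proof -
        obtain r s where rs: "triangle q r s" "nu r \<in> Q" using Q(2) q by blast
        have "r \<notin> {a, g, h}"
        proof
          assume "r \<in> {a, g, h}"
          then have "q \<in> {a, g, h}" using rs(1) t triangle_rotate triangle_swap triangle_unique by blast
          then show False using q by blast
        qed
        then show ?thesis using rs outside[of r] triangleD(2)[OF rs(1)] by blast
      qed
      show "r \<in> {a, g, h}" if "triangle q r s" "q \<in> {a, g, h}" for q r s
        using that t triangle_rotate triangle_swap triangle_unique by blast
      show "nu a \<in> Q - {g, h}" using Q(3) outside[of a] T by auto
      show "r \<notin> insert a {} \<union> insert b {d}" if "q \<in> Q - {g, h}" "q \<notin> {a, g, h}" "triangle q r s" for q r s
      proof -
        have "r \<notin> {a, g, h}"
        proof
          assume "r \<in> {a, g, h}"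
          then have "q \<in> {a, g, h}" using that(3) t triangle_rotate triangle_swap triangle_unique by blast
          then show False using that by blast
        qed
        moreover have "r \<noteq> d" using d(3) that by blast
        moreover have "r \<notin> K g" using KT[OF T(2)] triangleD[OF that(3)] by blast
        ultimately show ?thesis using b' by auto
      qed
      have "K q \<inter> (insert a {} \<union> insert b {d}) = {}" if q: "q \<in> Q - {g, h}" for q
      proof -
        have qT: "q \<in> Tp" using q Q by blast
        have "K q \<inter> K g = {}" using K_meet[OF T(2) qT] q loop by blast
        then show ?thesis using KT[OF qT] T b' d(4) q by blast
      qed
      then show "\<And>q. q \<in> Q - {g, h} \<Longrightarrow> q \<in> {a, g, h} \<Longrightarrow> q \<in> {} \<union> {a, g, h} \<Longrightarrow>
          K q \<inter> (insert a {} \<union> insert b {d}) = {}"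
        "\<And>q. q \<in> Q - {g, h} \<Longrightarrow> q \<notin> {a, g, h} \<Longrightarrow> K q \<inter> (insert a {} \<union> insert b {d}) = {}" by blast+
    qed (use T loop in auto)
  qed
qed

subsection \<open>A triangle without a loop\<close>

definition completes :: "'a \<Rightarrow> 'a \<Rightarrow> 'a set \<Rightarrow> 'a set \<Rightarrow> bool" where
  [simp]: "completes v x A B \<longleftrightarrow> v \<in> V \<and> N v \<subseteq> insert x A \<and> x \<in> V \<and> x \<notin> A \<and> x \<notin> B"

text \<open>
  A list of forcing moves as one checkable condition. In the step \<open>(v, y, x)\<close> Staller claims \<open>y\<close> and threatens to
  complete the neighbourhood of \<open>v\<close> at \<open>x\<close>; the predicate \<open>P\<close> is required of the position reached at the end.
\<close>

fun forced_line :: "('a \<times> 'a \<times> 'a) list \<Rightarrow> ('a set \<Rightarrow> 'a set \<Rightarrow> bool) \<Rightarrow> 'a set \<Rightarrow> 'a set \<Rightarrow> bool" where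
  "forced_line [] P A B \<longleftrightarrow> P A B"
| "forced_line ((v, y, x) # ls) P A B \<longleftrightarrow> v \<in> V \<and> N v \<subseteq> insert x (insert y A) \<and> x \<in> V \<and> x \<notin> A \<and> x \<notin> B \<and>
     y \<in> V \<and> y \<notin> A \<and> y \<notin> B \<and> x \<noteq> y \<and> forced_line ls P (insert y A) (insert x B)"

lemma forced_line_wins: "forced_line ls wins A B \<Longrightarrow> wins A B"
proof (induction ls arbitrary: A B)
  case (Cons l ls)
  obtain v y x where "l = (v, y, x)" by (cases l)
  then show ?case using Cons force[of v x y A B] by auto
qed simp

lemma forced_line_completes: "forced_line ls (completes v x) A B \<Longrightarrow> wins A B"
proof (induction ls arbitrary: A B)
  case Nil
  then show ?case using finish[of v x A B] by auto
next
  case (Cons l ls)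
  obtain v' y' x' where "l = (v', y', x')" by (cases l)
  then show ?case using Cons force[of v' x' y' A B] by auto
qed

text \<open>
  Staller owns both ends of the edge leaving \<open>p\<close>, and the far side is still fresh. If it is a
  diamond, \<open>diamond_win\<close> applies. If it is a triangle \<open>{mu p, x, y}\<close>, the claim of \<open>y\<close> forces \<open>x\<close>, and then \<open>mu x\<close> completes
  the neighbourhood of \<open>x\<close>; the names are chosen such that \<open>mu x\<close> is free.
\<close>

lemma cross:
  assumes p: "p \<in> Tp" "p \<in> A" "mu p \<in> A" "mu p \<notin> B"
    and D: "mu p \<in> Dp \<Longrightarrow> cell (mu p) \<inter> (A \<union> B) \<subseteq> {mu p}"
    and t: "\<And>x y. triangle (mu p) x y \<Longrightarrow> x \<notin> A \<union> B"
      "\<And>x y. triangle (mu p) x y \<Longrightarrow> mu x \<notin> A \<union> B \<or> mu y \<notin> A \<union> B"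
  shows "wins A B"
proof (cases "mu p \<in> Dp")
  case True
  have free: "x \<notin> A \<union> B" if "x \<in> cell (mu p)" "x \<noteq> mu p" for x
    using D[OF True] that by blast
  show ?thesis
    by (rule diamond_win[OF True p(3)]) (use free True in \<open>simp_all add: cell_def\<close>)
next
  case False
  then have u: "mu p \<in> Tp" "mu (mu p) = p" using p mu_port by auto
  obtain x y where xy: "triangle (mu p) x y" "mu x \<notin> A \<union> B"
    using triangle_ex[OF u(1)] t(2) triangle_swap by blast
  note T = triangleD[OF xy(1)]
  have free: "x \<notin> A" "x \<notin> B" "y \<notin> A" "y \<notin> B" "mu x \<notin> A" "mu x \<notin> B"
    using t(1)[OF xy(1)] t(1)[OF triangle_swap[OF xy(1)]] xy(2) by auto
  have tx: "triangle x y (mu p)" using xy(1) triangle_rotate by blast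
  show ?thesis
  proof (rule force[of "mu p" x y])
    show "N (mu p) \<subseteq> insert x (insert y A)" using triangle_N[OF xy(1)] u p by simp
    show "wins (insert y A) (insert x B)"
    proof (rule finish[of x "mu x"])
      show "N x \<subseteq> insert (mu x) (insert y A)" using triangle_N[OF tx] p by simp
      show "mu x \<in> V - (insert y A \<union> insert x B)"
        using free T triangle_mu[OF tx] by simp
    qed (use T in simp)
  qed (use free T in simp_all)
qed

lemma mu_cell_K: "p \<in> Tp \<Longrightarrow> mu p \<in> Dp \<Longrightarrow> cell (mu p) \<subseteq> K p"
  by (metis mu_cases nu_Tp not_both(1))

text \<open>
  A set of triangle ports on which Staller can walk in both directions without meeting Dominator's
  vertex \<open>d\<close>. The last condition concerns edges that leave a triangle of \<open>W\<close> at a port outside \<open>W\<close>: they do not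
  lead to a triangle of \<open>W\<close>, so that a reply at the end of such an edge does not disturb the walk.
\<close>

definition walkable :: "'a \<Rightarrow> 'a set \<Rightarrow> bool" where
  "walkable d W \<longleftrightarrow> W \<subseteq> Tp \<and> (\<forall>p \<in> W. nu p \<in> W \<and> (\<exists>r s. triangle p r s \<and> r \<in> W) \<and> d \<notin> tri p \<and> d \<notin> K p) \<and>
     (\<forall>q r s w. q \<in> W \<longrightarrow> triangle q r s \<longrightarrow> w \<in> W \<longrightarrow> mu r \<in> tri w \<longrightarrow> r \<in> W)"

lemma walkableD:
  assumes "walkable d W"
  shows "W \<subseteq> Tp" "\<And>p. p \<in> W \<Longrightarrow> nu p \<in> W" "\<And>p. p \<in> W \<Longrightarrow> \<exists>r s. triangle p r s \<and> r \<in> W"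
    "\<And>p. p \<in> W \<Longrightarrow> d \<noteq> p" "\<And>p q r. p \<in> W \<Longrightarrow> triangle p q r \<Longrightarrow> q \<noteq> d" "\<And>p. p \<in> W \<Longrightarrow> d \<notin> K p"
    "\<And>q r s w. q \<in> W \<Longrightarrow> triangle q r s \<Longrightarrow> w \<in> W \<Longrightarrow> mu r \<in> tri w \<Longrightarrow> r \<in> W"
proof -
  show "\<And>p q r. p \<in> W \<Longrightarrow> triangle p q r \<Longrightarrow> q \<noteq> d"
    using assms triangle_tri unfolding walkable_def by blast
  show "W \<subseteq> Tp" "\<And>p. p \<in> W \<Longrightarrow> nu p \<in> W" "\<And>p. p \<in> W \<Longrightarrow> \<exists>r s. triangle p r s \<and> r \<in> W"
    "\<And>p. p \<in> W \<Longrightarrow> d \<noteq> p" "\<And>p. p \<in> W \<Longrightarrow> d \<notin> K p"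
    using assms unfolding walkable_def by blast+
  show "\<And>q r s w. q \<in> W \<Longrightarrow> triangle q r s \<Longrightarrow> w \<in> W \<Longrightarrow> mu r \<in> tri w \<Longrightarrow> r \<in> W"
    using assms unfolding walkable_def by meson
qed

lemma walkable_succ:
  assumes W: "walkable d W" "q \<in> W"
  shows "\<exists>r s. triangle q r s \<and> nu r \<in> W"
  using walkableD(2,3)[OF W(1)] W(2) by metis

text \<open>
  Dominator has answered at \<open>g\<close> in the first triangle. The walk starts at \<open>a\<close> with the second alternative of the
  hypothesis \<open>mode\<close> of \<open>walk\<close>.
\<close>

lemma walk_around:
  assumes W: "walkable d W" and t: "triangle a g h" and a: "a \<in> W"
    and noloop: "nu g \<notin> {a, g, h}" "nu h \<notin> {a, g, h}" and mug: "mu g \<noteq> d"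
  shows "wins {a} {g, d}"
proof (rule walk[where Q = W and Vis = "{a, g, h}" and Th = "{}" and p = a, OF _ _ t])
  note T = triangleD[OF t] and WD = walkableD[OF W]
  have tg: "triangle g h a" using t triangle_rotate by blast
  show "W \<subseteq> Tp" by fact
  show "\<And>q. q \<in> W \<Longrightarrow> \<exists>r s. triangle q r s \<and> nu r \<in> W" using walkable_succ[OF W] .
  show closed: "r \<in> {a, g, h}" if "triangle q r s" "q \<in> {a, g, h}" for q r s
    using that t triangle_rotate triangle_swap triangle_unique by blast
  show "nu a \<in> W" using WD(2) a .
  show "r \<notin> {a} \<union> {g, d}" if "q \<in> W" "q \<notin> {a, g, h}" "triangle q r s" for q r s
  proof -
    have "triangle r q s" using that(3) triangle_rotate triangle_swap by blast
    then have "r \<notin> {a, g, h}" using closed that(2) by blast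
    then show ?thesis using WD(5)[OF that(1,3)] by auto
  qed
  have "K q \<inter> ({a} \<union> {g, d}) = {}" if "q \<in> W" for q
  proof -
    have "q \<in> Tp" using WD(1) that by blast
    then show ?thesis using K_subset[of q] T(1,2) WD(6)[OF that] by blast
  qed
  then show "\<And>q. q \<in> W \<Longrightarrow> q \<in> {a, g, h} \<Longrightarrow> q \<in> {} \<union> {a, g, h} \<Longrightarrow> K q \<inter> ({a} \<union> {g, d}) = {}"
    "\<And>q. q \<in> W \<Longrightarrow> q \<notin> {a, g, h} \<Longrightarrow> K q \<inter> ({a} \<union> {g, d}) = {}" by blast+
  have h: "h \<notin> {a} \<union> {g, d}" using T WD(5)[OF a triangle_swap[OF t]] by auto
  have m: "mu g \<notin> {a} \<union> {g, d}" using triangle_mu[OF tg] mug by auto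
  have far: "mu g \<noteq> r" if "g \<notin> W" "q \<in> W" "triangle q r s" for q r s
    using WD(7)[OF a t that(2)] that triangle_tri[OF that(3)] by blast
  have "\<forall>q \<in> W - {a, g, h}. q \<notin> {a} \<union> {g, d}" using WD(4) by auto
  then show "nu g = h \<or>
    a \<in> {a} \<and> h \<notin> {a} \<union> {g, d} \<and> mu g \<notin> {a} \<union> {g, d} \<and> (g \<in> W \<longrightarrow> nu g \<notin> {a, g, h}) \<and>
    (h \<in> W \<longrightarrow> nu h \<notin> {a, g, h}) \<and> (\<forall>q\<in>W - {a, g, h}. q \<notin> {a} \<union> {g, d}) \<and>
    (g \<notin> W \<longrightarrow> (\<forall>q r s. q \<in> W \<longrightarrow> triangle q r s \<longrightarrow> mu g \<noteq> r))"
    using h m far noloop by blast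
qed (use triangleD[OF t] in auto)

text \<open>
  Two triangles joined by two edges form a block of six vertices. Staller's first vertex \<open>a\<close> leaves several
  forced lines, and no single reply of Dominator meets them all.
\<close>

lemma double_edge_start:
  assumes t: "triangle a g h" and u: "triangle (mu a) (mu g) q" and ne: "mu h \<noteq> q"
    and d: "d \<notin> {a, g, h, mu a, mu g, mu h, q}"
  shows "wins {} {d}"
proof (rule start[of a])
  have tg: "triangle g h a" and th: "triangle h a g" using t triangle_rotate by blast+
  have ug: "triangle (mu g) q (mu a)" and uq: "triangle q (mu a) (mu g)" using u triangle_rotate by blast+
  note T = triangleD[OF t] and U = triangleD[OF u]
  have mm: "mu (mu a) = a" "mu (mu g) = g" "mu (mu h) = h" using T by auto
  have Ns: "N a = {g, h, mu a}" "N g = {h, a, mu g}" "N h = {a, g, mu h}"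
    "N (mu a) = {mu g, q, a}" "N (mu g) = {q, mu a, g}"
    using triangle_N[OF t] triangle_N[OF tg] triangle_N[OF th] triangle_N[OF u] triangle_N[OF ug] mm by auto
  have qq: "q \<noteq> a" "q \<noteq> g" "q \<noteq> h"
    using triangle_mu[OF ug] triangle_mu[OF u] mm t u ug triangle_mu[OF t] triangle_unique
      triangle_rotate triangle_swap by metis+
  have uh: "mu h \<noteq> mu a" "mu h \<noteq> mu g" "mu a \<noteq> mu g" using T mu_inj by auto
  have out: "mu a \<notin> {a, g, h}" "mu g \<notin> {a, g, h}" "mu h \<notin> {a, g, h}"
    using triangle_mu[OF t] triangle_mu[OF tg] triangle_mu[OF th] by auto
  have dist: "distinct [a, g, h, mu a, mu g, mu h, q, d]"
    using T U qq uh out ne d by auto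
  then have dist': "distinct [d, q, mu h, mu g, mu a, h, g, a]" by auto
  have inV: "a \<in> V" "g \<in> V" "h \<in> V" "mu a \<in> V" "mu g \<in> V" "mu h \<in> V" "q \<in> V" using T U by auto
  show "a \<in> V - ({} \<union> {d})" "V - (insert a {} \<union> {d}) \<noteq> {}" using inV dist by auto
  fix b assume b: "b \<in> V" "b \<notin> insert a {}" "b \<notin> {d}"
  consider "mu g \<noteq> b" "q \<noteq> b" "h \<noteq> b" | "b = q" | "b = mu g" | "b = h" by blast
  then show "wins (insert a {}) (insert b {d})"
  proof cases
    case 1
    then have "forced_line [(mu a, mu g, q)] (completes g h) {a} {b, d}" using dist dist' inV b by (simp add: Ns)
    from forced_line_completes[OF this] show ?thesis by simp
  next
    case 2
    then have "forced_line [(h, g, mu h), (a, h, mu a)] (completes g (mu g)) {a} {b, d}" using dist dist' inV b by (simp add: Ns)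
    from forced_line_completes[OF this] show ?thesis by simp
  next
    case 3
    then have "forced_line [(h, g, mu h), (a, mu a, h)] (completes (mu g) q) {a} {b, d}" using dist dist' inV b by (simp add: Ns)
    from forced_line_completes[OF this] show ?thesis by simp
  next
    case 4
    then have "forced_line [(h, g, mu h), (mu a, q, mu g)] (completes (mu g) (mu a)) {a} {b, d}" using dist dist' inV b by (simp add: Ns)
    from forced_line_completes[OF this] show ?thesis by simp
  qed
qed

text \<open>
  The situations in which \<open>cross\<close> is applied: Staller has just taken the end \<open>mu p\<close> of an edge that leaves the
  first triangle. As no second edge joins the two triangles, the far side has been touched at most by \<open>d\<close>, and
  at only one of the two points \<open>mu x\<close>, \<open>mu y\<close>.
\<close>

lemma cross_fresh:
  assumes W: "walkable d W" "p \<in> W" and t: "triangle p q r"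
    and noloop: "nu p \<notin> {p, q, r}"
    and nodbl: "\<And>x y. triangle (mu p) x y \<Longrightarrow> x \<noteq> mu q \<and> x \<noteq> mu r"
    and A: "p \<in> A" "mu p \<in> A" "A \<subseteq> {p, q, r, mu p}" and B: "B \<subseteq> {d, p, q, r, mu q, mu r}" and d: "mu p \<noteq> d"
  shows "wins A B"
proof (rule cross)
  note T = triangleD[OF t] and WD = walkableD[OF W(1)]
  have tq: "triangle q r p" and tr: "triangle r p q" using t triangle_rotate by blast+
  have R: "x = p \<or> x = q \<or> x = r" if "triangle x y z" "y = p \<or> y = q \<or> y = r" for x y z
    using that t triangle_rotate triangle_swap triangle_unique by blast
  show "p \<in> Tp" "p \<in> A" "mu p \<in> A" using T A by auto
  have u: "mu p \<noteq> mu q" "mu p \<noteq> mu r" "mu p \<noteq> p" "mu p \<noteq> q" "mu p \<noteq> r"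
    using T mu_inj triangle_mu[OF t] by auto
  then show "mu p \<notin> B" using B d by auto
  show "cell (mu p) \<inter> (A \<union> B) \<subseteq> {mu p}" if D: "mu p \<in> Dp"
  proof -
    have "cell (mu p) \<subseteq> K p" using mu_cell_K[OF T(1) D] .
    moreover have "mu q \<notin> K p" "mu r \<notin> K p" using mu_in_K[OF T(2,1)] mu_in_K[OF T(3,1)] noloop T by auto
    moreover have "K p \<inter> Tp = {}" "d \<notin> K p" using K_subset[OF T(1)] WD(6)[OF W(2)] by auto
    ultimately show ?thesis using A B T(1,2,3) by blast
  qed
  fix x y assume xy: "triangle (mu p) x y"
  note U = triangleD[OF xy]
  have nup: "nu p = mu p" using nu_if_mu T(1) U(1) by blast
  then have uW: "mu p \<in> W" using WD(2) W(2) by metis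
  have not_R: "z \<notin> {p, q, r}" if "triangle (mu p) z z'" for z z' using R[OF that] u by blast
  have mu_out: "mu z \<notin> {p, q, r, mu p, mu q, mu r}" if z: "triangle (mu p) z z'" for z z'
  proof -
    have zT: "z \<in> Tp" "mu (mu z) = z" using triangleD[OF z] by auto
    have "mu z \<noteq> p" using zT triangleD[OF z] by auto
    moreover have "mu z \<noteq> q" "mu z \<noteq> r" using zT nodbl[OF z] by auto
    moreover have "mu z \<noteq> mu p" "mu z \<noteq> mu q" "mu z \<noteq> mu r" using not_R[OF z] zT T mu_inj by auto
    ultimately show ?thesis by blast
  qed
  show "x \<notin> A \<union> B" using A B not_R[OF xy] nodbl[OF xy] WD(5)[OF uW xy] U by auto
  have "mu x \<noteq> mu y" using U mu_inj by auto
  then have "mu x \<noteq> d \<or> mu y \<noteq> d" by auto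
  then show "mu x \<notin> A \<union> B \<or> mu y \<notin> A \<union> B"
    using mu_out[OF xy] mu_out[OF triangle_swap[OF xy]] A B by blast
qed

text \<open>
  Staller claims \<open>a\<close>. If Dominator replies at \<open>g\<close> or \<open>h\<close>, she walks around. If he replies at the outer neighbour of
  a vertex of the triangle, a forcing move inside the triangle lets her take, with tempo, the outer neighbour of
  a vertex that she owns, and she crosses there. Against any other reply she takes \<open>g\<close> and \<open>h\<close>
  with forced answers at \<open>mu h\<close> and \<open>mu a\<close>, and completes the neighbourhood of \<open>g\<close> at \<open>mu g\<close>.
\<close>

lemma plain_start_without_double_edge:
  assumes W: "walkable d W" and t: "triangle a g h" and a: "a \<in> W" and g: "g \<in> W"
    and noloop: "\<And>x. x \<in> {a, g, h} \<Longrightarrow> nu x \<notin> {a, g, h}"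
    and nodbl: "\<And>x y z z'. x \<in> {a, g, h} \<Longrightarrow> y \<in> {a, g, h} \<Longrightarrow> triangle (mu x) z z' \<Longrightarrow> z \<noteq> mu y"
    and d: "d \<notin> {mu a, mu g, mu h}"
  shows "wins {} {d}"
proof (rule start[of a])
  have tg: "triangle g h a" and th: "triangle h a g" using t triangle_rotate by blast+
  note T = triangleD[OF t]
  have Ns: "N a = {g, h, mu a}" "N g = {h, a, mu g}" "N h = {a, g, mu h}"
    using triangle_N[OF t] triangle_N[OF tg] triangle_N[OF th] .
  have u: "mu a \<noteq> mu g" "mu a \<noteq> mu h" "mu g \<noteq> mu h" using T mu_inj by auto
  have out: "mu a \<notin> {a, g, h}" "mu g \<notin> {a, g, h}" "mu h \<notin> {a, g, h}"
    using triangle_mu[OF t] triangle_mu[OF tg] triangle_mu[OF th] by auto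
  have dR: "d \<notin> {a, g, h}"
    using walkableD(4)[OF W a] walkableD(5)[OF W a t] walkableD(5)[OF W a triangle_swap[OF t]] by auto
  have dist: "distinct [a, g, h, mu a, mu g, mu h, d]" using T u out d dR by auto
  then have dist': "distinct [d, mu h, mu g, mu a, h, g, a]" by auto
  have inV: "a \<in> V" "g \<in> V" "h \<in> V" "mu a \<in> V" "mu g \<in> V" "mu h \<in> V" using T by auto
  show "a \<in> V - ({} \<union> {d})" "V - (insert a {} \<union> {d}) \<noteq> {}" using inV dist by auto
  fix b assume b: "b \<in> V" "b \<notin> insert a {}" "b \<notin> {d}"
  have crossing: "wins A B" if "p \<in> W" "triangle p q r" "{p, q, r} = {a, g, h}" "p \<in> A" "mu p \<in> A"
    "A \<subseteq> {p, q, r, mu p}" "B \<subseteq> {d, p, q, r, mu q, mu r}" for p q r A B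
  proof (rule cross_fresh[OF W that(1,2) _ _ that(4-7)])
    have p: "p \<in> {a, g, h}" "q \<in> {a, g, h}" "r \<in> {a, g, h}" using that(3) by blast+
    show "nu p \<notin> {p, q, r}" using noloop[OF p(1)] that(3) by blast
    show "\<And>x y. triangle (mu p) x y \<Longrightarrow> x \<noteq> mu q \<and> x \<noteq> mu r" using nodbl p by blast
    show "mu p \<noteq> d" using p(1) d by blast
  qed
  consider "b = g" | "b = h" | "b = mu a" | "b = mu g" | "b = mu h"
    | "g \<noteq> b" "h \<noteq> b" "mu a \<noteq> b" "mu g \<noteq> b" "mu h \<noteq> b" by blast
  then show "wins (insert a {}) (insert b {d})"
  proof cases
    case 1
    then show ?thesis using walk_around[OF W t a] noloop d by auto
  next
    case 2
    have "nu h \<notin> {a, h, g}" "nu g \<notin> {a, h, g}" "mu h \<noteq> d" using noloop[of g] noloop[of h] d by auto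
    then show ?thesis using walk_around[OF W triangle_swap[OF t] a] 2 by simp
  next
    case 3
    have "wins {mu g, g, a} {h, mu h, mu a, d}"
      by (rule crossing[OF g tg]) auto
    then have "forced_line [(h, g, mu h), (g, mu g, h)] wins {a} {b, d}"
      using 3 dist dist' inV by (simp add: Ns)
    from forced_line_wins[OF this] show ?thesis by simp
  next
    case 4
    have "wins {mu a, g, a} {h, mu h, mu g, d}"
      by (rule crossing[OF a t]) auto
    then have "forced_line [(h, g, mu h), (a, mu a, h)] wins {a} {b, d}"
      using 4 dist dist' inV by (simp add: Ns)
    from forced_line_wins[OF this] show ?thesis by simp
  next
    case 5
    have "wins {mu a, h, a} {g, mu g, mu h, d}"
      by (rule crossing[OF a t]) auto
    then have "forced_line [(g, h, mu g), (a, mu a, g)] wins {a} {b, d}"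
      using 5 dist dist' inV by (simp add: Ns)
    from forced_line_wins[OF this] show ?thesis by simp
  next
    case 6
    then have "forced_line [(h, g, mu h), (a, h, mu a)] (completes g (mu g)) {a} {b, d}"
      using dist dist' inV b by (simp add: Ns)
    from forced_line_completes[OF this] show ?thesis by simp
  qed
qed

text \<open>
  If two of the three outer neighbours lie in one triangle there is a double edge, and Staller uses that;
  the third edge cannot lead to the same triangle by \<open>no_prism\<close>.
\<close>

lemma plain_start:
  assumes W: "walkable d W" and t: "triangle a g h" and a: "a \<in> W"
    and noloop: "\<And>x. x \<in> {a, g, h} \<Longrightarrow> nu x \<notin> {a, g, h}"
    and d: "d \<notin> {mu a, mu g, mu h}"
  shows "wins {} {d}"
proof -
  have perm: "{x, y, z} = {a, g, h}" if "triangle x y z" "x \<in> {a, g, h}" for x y z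
    using that t triangle_rotate triangle_swap triangle_unique by (smt (verit) empty_iff insert_commute insert_iff)
  obtain r s where rs: "triangle a r s" "r \<in> W" using walkableD(3)[OF W a] by blast
  have dR: "d \<notin> {a, g, h}"
    using walkableD(4)[OF W a] walkableD(5)[OF W a t] walkableD(5)[OF W a triangle_swap[OF t]] by auto
  show ?thesis
  proof (cases "\<exists>x y z'. x \<in> {a, g, h} \<and> y \<in> {a, g, h} \<and> triangle (mu x) (mu y) z'")
    case True
    then obtain x y w where xy: "x \<in> {a, g, h}" "y \<in> {a, g, h}" "triangle (mu x) (mu y) w" by blast
    have xT: "x \<in> Tp" "y \<in> Tp" using xy triangleD[OF t] by auto
    have "x \<noteq> y" using triangleD[OF xy(3)] by auto
    then obtain z where z: "triangle x y z" using xy(1,2) t triangle_rotate triangle_swap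
      by (smt (verit) empty_iff insert_iff)
    have R: "{x, y, z} = {a, g, h}" using perm[OF z xy(1)] .
    have "a \<in> {x, y, z}" "r \<in> {x, y, z}" "a \<noteq> r" using R perm[OF rs(1)] triangleD[OF rs(1)] by auto
    then have "x \<in> W \<or> y \<in> W" using a rs(2) by auto
    then have "mu x \<in> W \<or> mu y \<in> W"
      using walkableD(2)[OF W] nu_if_mu xT triangleD[OF xy(3)] by metis
    then have "d \<notin> {mu x, mu y, w}"
    proof
      assume "mu x \<in> W"
      then show ?thesis using walkableD(4,5)[OF W] xy(3) triangle_swap by blast
    next
      assume "mu y \<in> W"
      then show ?thesis using walkableD(4,5)[OF W] xy(3) triangle_swap triangle_rotate by blast
    qed
    moreover have "mu z \<noteq> w" using no_prism[OF z] xy(3) by blast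
    moreover have "d \<notin> {x, y, z}" using dR unfolding R .
    moreover have "z \<in> {a, g, h}" using R by blast
    then have "d \<noteq> mu z" using d by blast
    ultimately show ?thesis using double_edge_start[OF z xy(3)] by blast
  next
    case False
    have no: "z \<noteq> mu y" if "x \<in> {a, g, h}" "y \<in> {a, g, h}" "triangle (mu x) z z'" for x y z z'
      using that False by blast
    show ?thesis
    proof (rule plain_start_without_double_edge[OF W rs(1) a rs(2)])
      have R: "{a, r, s} = {a, g, h}" using perm[OF rs(1)] by blast
      show "nu x \<notin> {a, r, s}" if "x \<in> {a, r, s}" for x using that noloop unfolding R by blast
      show "z \<noteq> mu y" if "x \<in> {a, r, s}" "y \<in> {a, r, s}" "triangle (mu x) z z'" for x y z z'
        using that no unfolding R by blast
      have "r \<in> {a, g, h}" "s \<in> {a, g, h}" using R by blast+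
      then show "d \<notin> {mu a, mu r, mu s}" using d by auto
    qed
  qed
qed

section \<open>Reducing to dumbbells\<close>

text \<open>
  The triangle of \<open>x\<close> has no loop in the multigraph.
\<close>

definition plain :: "'a \<Rightarrow> bool" where
  "plain x \<longleftrightarrow> (\<forall>y \<in> tri x. nu y \<notin> tri x)"

lemma tri_same: "triangle q r s \<Longrightarrow> tri r = tri q" "triangle q r s \<Longrightarrow> tri s = tri q"
  by (auto simp: triangle_def)

lemma tri_mem: "triangle q r s \<Longrightarrow> x \<in> {q, r, s} \<Longrightarrow> tri x = tri q"
  using tri_same by (elim insertE) (simp only:, blast+)

lemma tri_self: "x \<in> tri x" by simp

lemma tri_eqI: "x \<in> Tp \<Longrightarrow> z \<in> tri x \<Longrightarrow> tri z = tri x"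
  using tri_eq by blast

lemma tri_in_Tp: "x \<in> Tp \<Longrightarrow> z \<in> tri x \<Longrightarrow> z \<in> Tp"
  using tri_Tp by blast

lemma triangle_in_tri: "triangle q r s \<Longrightarrow> x \<in> tri q \<Longrightarrow> x = q \<or> x = r \<or> x = s"
  using triangle_tri by blast

lemma triangle_complete: "q \<in> Tp \<Longrightarrow> r \<in> tri q \<Longrightarrow> r \<noteq> q \<Longrightarrow> \<exists>s. triangle q r s"
  by (auto simp: triangle_def)

lemma loop_form:
  assumes x: "x \<in> Tp" "\<not> plain x"
  shows "\<exists>p q r. triangle p q r \<and> tri p = tri x \<and> nu q = r"
proof -
  obtain y where y: "y \<in> tri x" "nu y \<in> tri x" using x(2) by (auto simp: plain_def)
  have yT: "y \<in> Tp" and ty: "tri y = tri x" using tri_in_Tp[OF x(1) y(1)] tri_eqI[OF x(1) y(1)] by auto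
  have "nu y \<in> tri y" "nu y \<noteq> y" using y ty yT by auto
  then obtain s where "triangle y (nu y) s" using triangle_complete yT by blast
  then have t: "triangle s y (nu y)" using triangle_rotate by blast
  then have "tri s = tri x" using tri_same(1)[OF t] ty by simp
  then show ?thesis using t by blast
qed

lemma loop_form_at:
  assumes y: "y \<in> Tp" "\<not> plain y" "nu y \<notin> tri y"
  shows "\<exists>q r. triangle y q r \<and> nu q = r"
proof -
  obtain p q r where t: "triangle p q r" "tri p = tri y" "nu q = r" using loop_form y by blast
  note T = triangleD[OF t(1)]
  have P: "{p, q, r} = tri y" using t(1,2) triangle_tri by simp
  then have "y \<in> {p, q, r}" by blast
  moreover have "y \<noteq> q" "y \<noteq> r" using y(3) t(3) T P nu_nu[OF T(2)] by auto
  ultimately show ?thesis using t by blast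
qed

text \<open>
  The only obstacle to \<open>plain_start\<close> is \<open>d\<close> being the outer neighbour of the third vertex \<open>s\<close> of the triangle. Then
  the triangle at the other end of the chain of \<open>a\<close> is used: \<open>d\<close> is an outer neighbour of \<open>s\<close> and therefore of
  no vertex there, so it is a good start both with and without a loop.
\<close>

lemma plain_wins:
  assumes W: "walkable d W" and a: "a \<in> W" "plain a"
  shows "wins {} {d}"
proof -
  note WD = walkableD[OF W]
  have aT: "a \<in> Tp" using WD(1) a by blast
  obtain r s where t: "triangle a r s" "r \<in> W" using WD(3)[OF a(1)] by blast
  note T = triangleD[OF t(1)]
  have R: "tri a = {a, r, s}" using t(1) triangle_tri by blast
  have noloop: "nu x \<notin> {a, r, s}" if "x \<in> {a, r, s}" for x
    using a(2) that unfolding plain_def R by blast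
  have not_d: "mu x \<noteq> d" if "x \<in> W" for x
  proof -
    have "x \<in> Tp" using that WD(1) by blast
    then show ?thesis
    proof (cases rule: mu_cases)
      case 1 then show ?thesis using WD(2,4)[of x] WD(4)[of "nu x"] that by auto
    next
      case 2 then show ?thesis using WD(6)[OF that] by (auto simp: cell_def)
    qed
  qed
  show ?thesis
  proof (cases "d = mu s")
    case False
    then have "d \<notin> {mu a, mu r, mu s}" using not_d a t by auto
    then show ?thesis using plain_start[OF W t(1) a(1)] noloop by blast
  next
    case True
    define w where "w = nu a"
    have w: "w \<in> W" "w \<in> Tp" "nu w = a" "w \<notin> {a, r, s}" using WD(2)[OF a(1)] aT noloop[of a] by (auto simp: w_def)
    have tw: "triangle w (rot w) (rot (rot w))" using triangle_ex w by blast
    have far: "x \<notin> {a, r, s}" if "x \<in> tri w" for x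
    proof
      assume "x \<in> {a, r, s}"
      then have "tri x = tri a" "tri x = tri w" using tri_eqI[OF aT] R tri_eqI[OF w(2) that] by auto
      then show False using w(4) R tri_self by metis
    qed
    have ndw: "mu x \<noteq> d" if "x \<in> tri w" for x
    proof -
      have "x \<in> Tp" "x \<noteq> s" using tri_in_Tp[OF w(2) that] far[OF that] by auto
      then show ?thesis using True mu_inj T by auto
    qed
    show ?thesis
    proof (cases "plain w")
      case True
      have "nu x \<notin> {w, rot w, rot (rot w)}" if "x \<in> {w, rot w, rot (rot w)}" for x
        using True that unfolding plain_def by blast
      moreover have "d \<notin> {mu w, mu (rot w), mu (rot (rot w))}" using ndw by auto
      ultimately show ?thesis using plain_start[OF W tw w(1)] by blast
    next
      case False
      have "nu w \<notin> tri w" using w(3) far by blast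
      then obtain q q' where q: "triangle w q q'" "nu q = q'" using loop_form_at[OF w(2) False] by blast
      note Q = triangleD[OF q(1)]
      have qw: "tri w = {w, q, q'}" using q(1) triangle_tri by blast
      show ?thesis
      proof (rule loop_start[OF q(1,2) WD(1) walkable_succ[OF W]])
        show "nu w \<in> W" using w a by simp
        show "d \<notin> {w, q, q'}" using WD(4)[OF w(1)] WD(5)[OF w(1) q(1)] WD(5)[OF w(1) triangle_swap[OF q(1)]] by auto
        show "d \<notin> K q"
        proof
          assume "d \<in> K q"
          then have "s = q \<or> s = q'" using mu_in_K[OF T(3) Q(2)] True q(2) by auto
          then show False using far qw by blast
        qed
      qed (use WD(5,6) in blast)+
    qed
  qed
qed

text \<open>
  \<open>F\<close> is a set of whole triangles that meets \<open>d\<close>, itself or by one of its chains. Staller walks outside \<open>F\<close>, which is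
  possible if no triangle outside is joined to \<open>F\<close> by two chains, as each of them then still has two ports to use.
\<close>

lemma walkable_outside:
  assumes F: "F \<subseteq> Tp" "\<And>q r s. triangle q r s \<Longrightarrow> q \<in> F \<Longrightarrow> r \<in> F"
    and d: "d \<in> F \<or> (\<exists>p \<in> F. d \<in> K p)"
    and one: "\<And>q r s. triangle q r s \<Longrightarrow> q \<notin> F \<Longrightarrow> nu q \<in> F \<Longrightarrow> nu r \<notin> F"
  shows "walkable d {p \<in> Tp - F. nu p \<notin> F}"
proof -
  have out: "r \<notin> F" if "triangle q r s" "q \<notin> F" for q r s
    using F(2) that triangle_rotate triangle_swap by blast
  have dt: "d \<notin> tri p \<and> d \<notin> K p" if p: "p \<in> Tp" "p \<notin> F" "nu p \<notin> F" for p
    using d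
  proof
    assume "d \<in> F"
    moreover have "tri p \<inter> F = {}"
      using out[OF triangle_ex[OF p(1)] p(2)] out[OF triangle_swap[OF triangle_ex[OF p(1)]] p(2)] p(2) by blast
    ultimately show ?thesis using F(1) K_subset[OF p(1)] by blast
  next
    assume "\<exists>p \<in> F. d \<in> K p"
    then obtain e where e: "e \<in> F" "d \<in> K e" by blast
    have eT: "e \<in> Tp" using e F by blast
    have "d \<notin> Tp" using K_subset[OF eT] e by blast
    moreover have "d \<notin> K p"
    proof
      assume "d \<in> K p"
      then have "p = e \<or> p = nu e" using K_meet[OF eT p(1)] e by blast
      then show False using p e nu_nu[OF eT] by auto
    qed
    ultimately show ?thesis using tri_in_Tp[OF p(1)] by blast
  qed
  have ex: "\<exists>r s. triangle p r s \<and> r \<in> Tp - F \<and> nu r \<notin> F" if p: "p \<in> Tp" "p \<notin> F" for p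
  proof -
    note t = triangle_ex[OF p(1)]
    note T = triangleD[OF t]
    have "triangle (rot p) (rot (rot p)) p" using t triangle_rotate by blast
    then have "nu (rot p) \<notin> F \<or> nu (rot (rot p)) \<notin> F" using one out[OF t p(2)] by blast
    then show ?thesis using t triangle_swap[OF t] out[OF t p(2)] out[OF triangle_swap[OF t] p(2)] T by blast
  qed
  show ?thesis unfolding walkable_def
  proof (intro conjI ballI allI impI)
    fix p assume p: "p \<in> {p \<in> Tp - F. nu p \<notin> F}"
    show "nu p \<in> {p \<in> Tp - F. nu p \<notin> F}" using p by auto
    show "\<exists>r s. triangle p r s \<and> r \<in> {p \<in> Tp - F. nu p \<notin> F}" using ex[of p] p by auto
    show "d \<notin> tri p" "d \<notin> K p" using dt p by auto
  next
    fix q r s w assume q: "q \<in> {p \<in> Tp - F. nu p \<notin> F}" "triangle q r s" "w \<in> {p \<in> Tp - F. nu p \<notin> F}" "mu r \<in> tri w"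
    have wT: "w \<in> Tp" "w \<notin> F" using q by auto
    have r: "r \<in> Tp" "r \<notin> F" using out[OF q(2)] q(1) triangleD[OF q(2)] by auto
    have "mu r \<in> Tp" using tri_in_Tp[OF wT(1) q(4)] .
    then have "nu r = mu r" using nu_if_mu r by blast
    moreover have "mu r \<notin> F"
      using q(4) wT(2) out[OF triangle_ex[OF wT(1)]] out[OF triangle_swap[OF triangle_ex[OF wT(1)]]] by auto
    ultimately show "r \<in> {p \<in> Tp - F. nu p \<notin> F}" using r by auto
  qed blast
qed

lemma outside_wins:
  assumes F: "F \<subseteq> Tp" "\<And>q r s. triangle q r s \<Longrightarrow> q \<in> F \<Longrightarrow> r \<in> F"
    and d: "d \<in> F \<or> (\<exists>p \<in> F. d \<in> K p)"
    and one: "\<And>q r s. triangle q r s \<Longrightarrow> q \<notin> F \<Longrightarrow> nu q \<in> F \<Longrightarrow> nu r \<notin> F"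
    and y: "y \<in> Tp" "y \<notin> F" "plain y"
  shows "wins {} {d}"
proof -
  have W: "walkable d {p \<in> Tp - F. nu p \<notin> F}" using walkable_outside F d one by blast
  note t = triangle_ex[OF y(1)]
  have out: "rot y \<notin> F" using F(2)[of "rot y"] y(2) triangle_rotate[OF t] triangle_swap by blast
  consider "nu y \<notin> F" | "nu (rot y) \<notin> F" using one[OF t y(2)] by blast
  then show ?thesis
  proof cases
    case 1 then show ?thesis using plain_wins[OF W, where a = y] y by simp
  next
    case 2
    have "tri (rot y) = tri y" using tri_same(1)[OF t] .
    then have "plain (rot y)" using y(3) unfolding plain_def by metis
    then show ?thesis using plain_wins[OF W, where a = "rot y"] y 2 out by simp
  qed
qed

subsection \<open>Two triangles joined by three chains\<close>

text \<open>
  Dominator holds \<open>a1\<close>, and the chain from \<open>a1\<close> to \<open>b1\<close> contains a diamond. Staller answers at \<open>b1\<close>. If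
  Dominator replies in her triangle, she goes through the chain to the triangle of \<open>a1\<close>, takes one
  of \<open>a2\<close>, \<open>a3\<close> against the other, and comes back through the chain of that port. The diamond at \<open>mu b1\<close> provides the threat against the
  other replies.
\<close>

lemma theta_start_diamond_at_claimed_port:
  assumes t: "triangle a1 a2 a3" and u: "triangle b1 b2 b3" and nu: "nu a1 = b1" "nu a2 = b2" "nu a3 = b3"
    and ne: "tri a1 \<noteq> tri b1" and K: "mu a1 \<in> Dp"
  shows "wins {} {a1}"
proof (rule start[of b1])
  have tb: "triangle b2 b3 b1" "triangle b3 b1 b2" using u triangle_rotate by blast+
  note T = triangleD[OF t] and U = triangleD[OF u]
  have nub: "nu b1 = a1" "nu b2 = a2" "nu b3 = a3" using nu T by auto
  have disj: "x \<noteq> y" if "x \<in> {a1, a2, a3}" "y \<in> {b1, b2, b3}" for x y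
  proof
    assume "x = y"
    then show False using tri_mem[OF t that(1)] tri_mem[OF u that(2)] ne by simp
  qed
  have Kb: "K b1 = K a1" "K b2 = K a2" "K b3 = K a3" using nu T K_nu by auto
  have KT: "K x \<inter> Tp = {}" if "x \<in> Tp" for x using K_subset[OF that] by blast
  have Kd: "K a1 \<inter> K a2 = {}" "K a1 \<inter> K a3 = {}" "K a2 \<inter> K a3 = {}"
    using K_meet[of a1 a2] K_meet[of a1 a3] K_meet[of a2 a3] T nu disj by blast+
  have Ns: "N a1 = {a2, a3, mu a1}" "N b1 = {b2, b3, mu b1}" "N b2 = {b3, b1, mu b2}" "N b3 = {b1, b2, mu b3}"
    using triangle_N[OF t] triangle_N[OF u] triangle_N[OF tb(1)] triangle_N[OF tb(2)] by auto
  have Kne: "K a1 \<noteq> {}" using mu_cell_K[OF T(1) K] by (auto simp: cell_def)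
  have inV: "a1 \<in> V" "a2 \<in> V" "a3 \<in> V" "b1 \<in> V" "b2 \<in> V" "b3 \<in> V"
    "mu a1 \<in> V" "mu b1 \<in> V" "mu b2 \<in> V" "mu b3 \<in> V" using T U by auto
  have u1: "mu b1 \<in> Dp" "cell (mu b1) \<subseteq> K a1"
    using mu_cases[OF U(1)] Kne Kb(1) by metis+
  have mm: "mu (mu b1) = b1" "mu (mu b2) = b2" "mu (mu b3) = b3" using U by auto
  have mi: "mu x = mu y \<longleftrightarrow> x = y" if "x \<in> Tp" "y \<in> Tp" for x y using mu_inj that by blast
  have mune: "mu b1 \<noteq> mu b2" "mu b1 \<noteq> mu b3" "mu b2 \<noteq> mu b3" "mu a1 \<noteq> mu b1" "mu a1 \<noteq> mu b2" "mu a1 \<noteq> mu b3"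
    using mi[OF U(1,2)] mi[OF U(1,3)] mi[OF U(2,3)] mi[OF T(1) U(1)] mi[OF T(1) U(2)] mi[OF T(1) U(3)]
      U(4,5,6) disj[of a1 b1] disj[of a1 b2] disj[of a1 b3] by blast+
  have muout: "mu b1 \<notin> {b1, b2, b3}" "mu b2 \<notin> {b1, b2, b3}" "mu b3 \<notin> {b1, b2, b3}"
    using triangle_mu[OF u] triangle_mu[OF tb(1)] triangle_mu[OF tb(2)] by auto
  have mua: "mu b1 \<noteq> a1" "mu b2 \<noteq> a1" "mu b3 \<noteq> a1"
  proof -
    show "mu b1 \<noteq> a1" using u1(1) T(1) by auto
    show "mu b2 \<noteq> a1" "mu b3 \<noteq> a1"
      using nu_if_mu[OF U(2)] nu_if_mu[OF U(3)] nub T by metis+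
  qed
  show "b1 \<in> V - ({} \<union> {a1})" "V - (insert b1 {} \<union> {a1}) \<noteq> {}" using inV disj[of a1 b1] U T disj[of a1 b2] by auto
  have cells: "mu b2 \<notin> cell (mu b1)" "mu b3 \<notin> cell (mu b1)"
  proof -
    have "mu b2 \<notin> K a1" using mu_in_K[OF U(2) T(1)] disj[of a1 b2] U(4) nu(1) by blast
    then show "mu b2 \<notin> cell (mu b1)" using u1(2) by blast
    have "mu b3 \<notin> K a1" using mu_in_K[OF U(3) T(1)] disj[of a1 b3] U(5) nu(1) by blast
    then show "mu b3 \<notin> cell (mu b1)" using u1(2) by blast
  qed
  fix b assume b: "b \<in> V" "b \<notin> insert b1 {}" "b \<notin> {a1}"
  have cycle: "wins {b1} {x, a1}" if x: "triangle b1 x y" "triangle a1 x' y'" "nu x = x'" "nu y = y'" for x y x' y'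
  proof -
    note X = triangleD[OF x(1)] and X' = triangleD[OF x(2)]
    have xs: "x \<in> {b2, b3}" "y \<in> {b2, b3}" "x' \<in> {a2, a3}" "y' \<in> {a2, a3}"
      using triangle_unique[OF u x(1)] triangle_unique[OF t x(2)] by auto
    have txa: "triangle x y b1" using x(1) triangle_rotate by blast
    have nn: "nu x' = x" "nu y' = y" "K y' = K y" using x X by auto
    have Kx: "K a1 \<inter> K x' = {}" using Kd xs by auto
    show ?thesis
    proof (rule push[OF U(1)])
      show "b1 \<in> {b1}" by simp
      show "K b1 \<inter> ({b1} \<union> {x, a1}) = {}" using KT[OF U(1)] U X T by auto
      fix A B assume AB: "{b1} \<subseteq> A" "A \<subseteq> {b1} \<union> K b1" "{x, a1} \<subseteq> B" "B \<subseteq> {x, a1} \<union> K b1" "mu (nu b1) \<in> A"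
      have free: "z \<notin> A \<union> B" if "z \<in> {x', y', y}" for z
        using that AB KT[OF U(1)] X X' disj xs U by blast
      show "wins A B"
      proof (rule force[of a1 y' x'])
        show "N a1 \<subseteq> insert y' (insert x' A)" using triangle_N[OF x(2)] AB nub by auto
        show "wins (insert x' A) (insert y' B)"
        proof (rule walk_closes[OF txa X'(2) _ nn(1)])
          show "x' \<in> insert x' A" by simp
          show "b1 \<in> insert x' A" using AB by blast
          show "y \<notin> insert x' A" "y \<notin> insert y' B" using free[of y] disj[of x' y] disj[of y' y] xs by blast+
          show "K x' \<inter> (insert x' A \<union> insert y' B) = {}"
          proof -
            have "A \<subseteq> Tp \<union> K a1" "B \<subseteq> Tp \<union> K a1" using AB(2,4) U(1) X(2) T(1) unfolding Kb(1) by blast+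
            then show ?thesis using Kx KT[OF X'(2)] X'(2,3) by blast
          qed
        qed
        show "a1 \<in> V" "y' \<in> V - (A \<union> B)" "x' \<in> V - (A \<union> B)" "y' \<noteq> x'"
          using free[of x'] free[of y'] X' by simp_all
      qed
    qed
  qed
  have ab1: "a1 \<noteq> b1" "a1 \<noteq> b2" "a1 \<noteq> b3"
    using disj[of a1 b1] disj[of a1 b2] disj[of a1 b3] by blast+
  have Dist: "distinct [b1, b2, b3, a1, mu b1, mu b2, mu b3]"
    using U(4,5,6) muout mua(1,2,3) mune(1,2,3) ab1 by auto
  then have Dist': "distinct [mu b3, mu b2, mu b1, a1, b3, b2, b1]"
    using distinct_rev[of "[b1, b2, b3, a1, mu b1, mu b2, mu b3]"] by simp
  have dw: "wins A B" if "A \<subseteq> {b1, b2, b3, mu b1}" "mu b1 \<in> A" "B \<subseteq> {a1, b1, b2, b3, mu b2, mu b3}" for A B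
  proof -
    have free: "z \<notin> A \<union> B" if "z \<in> cell (mu b1)" "z \<noteq> mu b1" for z
      using that \<open>A \<subseteq> _\<close> \<open>B \<subseteq> _\<close> cells u1(2) KT[OF T(1)] T U by blast
    have "opp (mu b1) \<in> cell (mu b1)" "m1 (mu b1) \<in> cell (mu b1)" "m2 (mu b1) \<in> cell (mu b1)" by (simp_all add: cell_def)
    then show ?thesis using that(2) u1(1) free by (intro diamond_win[of "mu b1"]) simp_all
  qed
  consider "b = b2" | "b = b3" | "b = mu b1" | "b = mu b2" | "b = mu b3"
    | "b2 \<noteq> b" "b3 \<noteq> b" "mu b1 \<noteq> b" "mu b2 \<noteq> b" "mu b3 \<noteq> b" by blast
  then show "wins (insert b1 {}) (insert b {a1})"
  proof cases
    case 1
    then show ?thesis using cycle[OF u t] nub by simp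
  next
    case 2
    then show ?thesis using cycle[OF triangle_swap[OF u] triangle_swap[OF t]] nub by simp
  next
    case 3
    have KU: "K b2 \<inter> K b1 = {}" "K b3 \<inter> K b1 = {}" using Kd Kb by auto
    have mb1: "mu b1 \<in> K b1" using mu_cell_K[OF U(1) u1(1)] by (auto simp: cell_def)
    have other: "wins {mu x, b1} {y, b, a1}" if "mu x \<in> Dp" "x \<in> {b2, b3}" "y \<in> {b2, b3}" for x y
    proof -
      have xT: "x \<in> Tp" "cell (mu x) \<subseteq> K x" "K x \<inter> K b1 = {}" using that U mu_cell_K KU by auto
      then have free: "z \<notin> {b1, y, b, a1}" if "z \<in> cell (mu x)" for z
        using that KT[OF xT(1)] mb1 3 U T \<open>y \<in> {b2, b3}\<close> by blast
      have "opp (mu x) \<in> cell (mu x)" "m1 (mu x) \<in> cell (mu x)" "m2 (mu x) \<in> cell (mu x)" by (simp_all add: cell_def)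
      then show ?thesis using that free by (intro diamond_win[of "mu x"]) simp_all
    qed
    consider "mu b2 \<in> Dp" | "mu b3 \<in> Dp" | "mu b2 = a2" "mu b3 = a3"
      using U nub by (metis mu_cases)
    then show ?thesis
    proof cases
      case 1
      have "forced_line [(b2, mu b2, b3)] wins {b1} {b, a1}"
        using other[OF 1, of b3] 3 inV Dist Dist' by (simp add: Ns)
      from forced_line_wins[OF this] show ?thesis by simp
    next
      case 2
      have "forced_line [(b3, mu b3, b2)] wins {b1} {b, a1}"
        using other[OF 2, of b2] 3 inV Dist Dist' by (simp add: Ns)
      from forced_line_wins[OF this] show ?thesis by simp
    next
      case d3: 3
      have out: "mu a1 \<notin> {b1, b2, b3, a1, a2, a3}" using K U T by auto
      have nb: "b \<notin> {b1, b2, b3, a1, a2, a3}" using not_both(1)[OF u1(1)] 3 U(1,2,3) T(1,2,3) by auto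
      have nm: "mu a1 \<noteq> b" using mune(4) 3 by simp
      have ab: "a \<notin> {b1, b2, b3}" if "a \<in> {a1, a2, a3}" for a using disj that by blast
      have abs: "a1 \<notin> {b1, b2, b3}" "a2 \<notin> {b1, b2, b3}" "a3 \<notin> {b1, b2, b3}"
        using ab[of a1] ab[of a2] ab[of a3] by blast+
      have D3: "distinct [b1, b2, b3, a1, a2, a3, mu a1, b]"
        using out nb nm abs U(4,5,6) T(4,5,6) by auto
      then have D3': "distinct [b, mu a1, a3, a2, a1, b3, b2, b1]"
        using distinct_rev[of "[b1, b2, b3, a1, a2, a3, mu a1, b]"] by simp
      have "forced_line [(b2, a2, b3), (b3, a3, b2)] (completes a1 (mu a1)) {b1} {b, a1}"
        using D3 D3' inV by (simp add: Ns d3)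
      from forced_line_completes[OF this] show ?thesis by simp
    qed
  next
    case 4
    have "wins {mu b1, b2, b1} {b3, mu b3, b, a1}" by (rule dw) (use 4 in auto)
    then have "forced_line [(b3, b2, mu b3), (b1, mu b1, b3)] wins {b1} {b, a1}"
      using 4 inV Dist Dist' by (simp add: Ns)
    from forced_line_wins[OF this] show ?thesis by simp
  next
    case 5
    have "wins {mu b1, b3, b1} {b2, mu b2, b, a1}" by (rule dw) (use 5 in auto)
    then have "forced_line [(b2, b3, mu b2), (b1, mu b1, b2)] wins {b1} {b, a1}"
      using 5 inV Dist Dist' by (simp add: Ns)
    from forced_line_wins[OF this] show ?thesis by simp
  next
    case 6
    have "forced_line [(b3, b2, mu b3), (b1, b3, mu b1)] (completes b2 (mu b2)) {b1} {b, a1}"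
      using 6 inV Dist Dist' by (simp add: Ns)
    from forced_line_completes[OF this] show ?thesis by simp
  qed
qed

text \<open>
  Here \<open>a1\<close> and \<open>b1\<close> are adjacent, so that Staller's reply \<open>b1\<close> makes the neighbourhood of \<open>a1\<close> lack only \<open>a2\<close> and
  \<open>a3\<close>. It also threatens to take \<open>mu b2\<close>, forcing \<open>b3\<close>, and to win in the diamond entered there. Against the
  parries, she goes back from \<open>a3\<close> to \<open>b3\<close>.
\<close>

lemma theta_start_diamond_elsewhere:
  assumes t: "triangle a1 a2 a3" and u: "triangle b1 b2 b3" and nu: "nu a1 = b1" "nu a2 = b2" "nu a3 = b3"
    and ne: "tri a1 \<noteq> tri b1" and K: "mu a1 = b1" "mu b2 \<in> Dp"
  shows "wins {} {a1}"
proof (rule start[of b1])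
  have tb: "triangle b2 b3 b1" "triangle b3 b1 b2" using u triangle_rotate by blast+
  note T = triangleD[OF t] and U = triangleD[OF u]
  have nub: "nu b1 = a1" "nu b2 = a2" "nu b3 = a3" using nu T by auto
  have disj: "x \<noteq> y" if "x \<in> {a1, a2, a3}" "y \<in> {b1, b2, b3}" for x y
  proof
    assume "x = y"
    then show False using tri_mem[OF t that(1)] tri_mem[OF u that(2)] ne by simp
  qed
  have ab1: "a1 \<noteq> b1" "a1 \<noteq> b2" "a1 \<noteq> b3" "a2 \<noteq> b1" "a2 \<noteq> b2" "a2 \<noteq> b3" "a3 \<noteq> b1" "a3 \<noteq> b2" "a3 \<noteq> b3"
    using disj[of a1 b1] disj[of a1 b2] disj[of a1 b3] disj[of a2 b1] disj[of a2 b2] disj[of a2 b3]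
      disj[of a3 b1] disj[of a3 b2] disj[of a3 b3] by blast+
  have KT: "K x \<inter> Tp = {}" if "x \<in> Tp" for x using K_subset[OF that] by blast
  have Ns: "N a1 = {a2, a3, b1}" "N b2 = {b3, b1, mu b2}" "N b3 = {b1, b2, mu b3}"
    using triangle_N[OF t] triangle_N[OF tb(1)] triangle_N[OF tb(2)] K(1) by auto
  define c where "c = mu b2"
  have c: "c \<in> Dp" "cell c \<subseteq> K b2" "c \<in> cell c" using K(2) mu_cell_K[OF U(2)] by (auto simp: c_def cell_def)
  have Kb: "K b2 \<inter> K b3 = {}" using K_meet[OF U(2,3)] nub(2) ab1 U(6) by blast
  have cT: "c \<notin> Tp" "opp c \<notin> Tp" "m1 c \<notin> Tp" "m2 c \<notin> Tp" using cell_Tp[OF c(1)] by (auto simp: cell_def)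
  show "b1 \<in> V - ({} \<union> {a1})" using U(1) ab1(1) by simp
  have "b2 \<in> V - (insert b1 {} \<union> {a1})" using U(2,4) ab1(2) by simp
  then show "V - (insert b1 {} \<union> {a1}) \<noteq> {}" by blast
  fix b assume b: "b \<in> V" "b \<notin> insert b1 {}" "b \<notin> {a1}"
  show "wins (insert b1 {}) (insert b {a1})"
  proof (cases "b \<in> insert b3 (cell c)")
    case False
    have ne: "x \<noteq> b" if "x \<in> insert b3 (cell c)" for x using False that by blast
    have in_cell: "c \<in> insert b3 (cell c)" "opp c \<in> insert b3 (cell c)" "m1 c \<in> insert b3 (cell c)" "m2 c \<in> insert b3 (cell c)"
      by (simp_all add: cell_def)
    have nT: "x \<noteq> y" if "y \<in> Tp" "x \<notin> Tp" for x y using that by blast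
    have "forced_line [(b2, c, b3)] wins {b1} {b, a1}"
    proof -
      have "wins {c, b1} {b3, b, a1}"
        by (rule diamond_win[OF c(1)])
          (use in_cell(2-4)[THEN ne] nT[OF U(1)] nT[OF U(3)] nT[OF T(1)] cT c(1) in simp_all)
      then show ?thesis
        using in_cell(1)[THEN ne] ne[of b3] nT[OF U(1) cT(1)] nT[OF U(3) cT(1)] nT[OF T(1) cT(1)] U c(1) ab1(3)
        by (simp add: Ns c_def[symmetric])
    qed
    from forced_line_wins[OF this] show ?thesis by simp
  next
    case True
    then have b': "b = b3 \<or> b \<in> K b2" using c(2) by blast
    have bT: "b \<notin> {a2, a3, b2}" using b' KT[OF U(2)] U(2,6) T(2,3) ab1 by blast
    have t3: "triangle b3 b2 b1" using tb triangle_swap by blast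
    have "wins {a3, b1} {a2, b, a1}"
    proof (rule walk_closes[OF t3 T(3) _ nu(3)])
      have "b \<notin> K b3" using b' Kb KT[OF U(3)] U(3) by blast
      moreover have "K a3 = K b3" using nu(3) T(3) K_nu by metis
      ultimately show "K a3 \<inter> ({a3, b1} \<union> {a2, b, a1}) = {}"
        using KT[OF U(3)] T(1,2,3) U(1) by blast
      show "b2 \<notin> {a3, b1}" "b2 \<notin> {a2, b, a1}" using ab1 U bT by auto
    qed simp_all
    then have "forced_line [(a1, a3, a2)] wins {b1} {b, a1}"
      using T ab1 bT by (simp add: Ns) blast
    from forced_line_wins[OF this] show ?thesis by simp
  qed
qed

lemma triangle_closed: "triangle a b c \<Longrightarrow> triangle q r s \<Longrightarrow> q \<in> {a, b, c} \<Longrightarrow> r \<in> {a, b, c}"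
  using triangle_rotate triangle_swap triangle_unique by blast

text \<open>
  Two triangles joined by three chains are the whole graph, so one of the chains contains a diamond.
\<close>

lemma theta_wins:
  assumes t: "triangle a1 a2 a3" and u: "triangle b1 b2 b3" and nu: "nu a1 = b1" "nu a2 = b2" "nu a3 = b3"
    and ne: "tri a1 \<noteq> tri b1"
  shows "wins {} {a1}"
proof -
  note T = triangleD[OF t] and U = triangleD[OF u]
  have nub: "nu b1 = a1" "nu b2 = a2" "nu b3 = a3" using nu T by auto
  let ?C = "{a1, a2, a3, b1, b2, b3}"
  have "V = Tp \<union> (\<Union>p \<in> ?C. K p)"
  proof (rule ports_connected(2))
    show "?C \<subseteq> Tp" using T U by simp
    show "r \<in> ?C" if "triangle q r s" "q \<in> ?C" for q r s
      using triangle_closed[OF t that(1)] triangle_closed[OF u that(1)] that(2) by auto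
    show "nu q \<in> ?C" if "q \<in> ?C" for q using that nu nub by blast
  qed simp
  moreover have "K b1 = K a1" "K b2 = K a2" "K b3 = K a3" using K_nu[OF T(1)] K_nu[OF T(2)] K_nu[OF T(3)] nu by auto
  moreover have "\<not> V \<subseteq> Tp" using Dp_nonempty in_V(2) not_both by blast
  ultimately have "K a1 \<noteq> {} \<or> K b2 \<noteq> {} \<or> K b3 \<noteq> {}" by auto
  then consider "mu a1 \<in> Dp" | "mu a1 = b1" "mu b2 \<in> Dp" | "mu a1 = b1" "mu b3 \<in> Dp"
    using mu_cases[OF T(1)] mu_cases[OF U(2)] mu_cases[OF U(3)] nu(1) by metis
  then show ?thesis
  proof cases
    case 1 then show ?thesis using theta_start_diamond_at_claimed_port[OF t u nu ne] by blast
  next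
    case 2 then show ?thesis using theta_start_diamond_elsewhere[OF t u nu ne] by blast
  next
    case 3 then show ?thesis using theta_start_diamond_elsewhere[OF triangle_swap[OF t] triangle_swap[OF u] nu(1,3,2) ne] by blast
  qed
qed

subsection \<open>Two triangles with loops\<close>

lemma mu_nu_last:
  assumes "p \<in> Tp" "ch p \<noteq> []"
  shows "mu (nu p) = opp (last (ch p))"
proof -
  have "ch (nu p) = rev (map opp (ch p))" using ch_nu assms by blast
  then have "hd (ch (nu p)) = opp (last (ch p))" "ch (nu p) \<noteq> []"
    using assms(2) by (simp_all add: hd_rev last_map)
  then show ?thesis using chain_nil_iff(3)[of "nu p"] assms(1) by simp
qed

text \<open>
  A loop carries a diamond, since its ends are already adjacent within the triangle.
\<close>

lemma loop_ch:
  assumes "triangle a g h" "nu g = h"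
  shows "ch g \<noteq> []" "mu g \<in> Dp" "mu h \<in> Dp" "cell (mu g) \<subseteq> K g" "cell (mu h) \<subseteq> K g"
proof -
  note T = triangleD[OF assms(1)]
  have tg: "triangle g h a" using assms(1) triangle_rotate by blast
  have "mu g \<noteq> nu g" using triangle_mu(1)[OF tg] assms(2) by simp
  then have g: "mu g \<in> Dp" "mu g \<in> set (ch g)" using mu_cases[OF T(2)] by metis+
  then show "ch g \<noteq> []" "mu g \<in> Dp" "cell (mu g) \<subseteq> K g" using mu_cell_K T by auto
  have "K h = K g" using assms(2) T(2) K_nu by metis
  moreover have "mu h \<noteq> nu h" using triangle_mu[OF triangle_rotate[OF tg]] assms(2) T by auto
  then have "mu h \<in> Dp" using mu_cases[OF T(3)] by metis
  ultimately show "mu h \<in> Dp" "cell (mu h) \<subseteq> K g" using mu_cell_K[OF T(3)] by auto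
qed

text \<open>
  Staller takes the diamond port \<open>mu a\<close> on the bridge, to which Dominator replies in the same diamond. The neighbourhood of \<open>a\<close>
  now gives her \<open>g\<close> against \<open>h\<close>; she goes once around the loop and completes the neighbourhood of \<open>h\<close> at \<open>a\<close>.
\<close>

lemma bridge_start:
  assumes t: "triangle a g h" and loop: "nu g = h" and c: "mu a \<in> Dp"
    and d: "d \<notin> {a, g, h}" "d \<notin> K g" "d \<notin> cell (mu a)"
  shows "wins {} {d}"
proof (rule diamond_start[OF c])
  show "cell (mu a) \<inter> ({} \<union> {d}) = {}" using d by blast
  note T = triangleD[OF t]
  have th: "triangle h a g" using t triangle_rotate by blast
  fix b assume b: "b \<in> cell (mu a)" "b \<noteq> mu a"
  have Ka: "cell (mu a) \<subseteq> K a" "K a \<inter> Tp = {}" "K g \<inter> Tp = {}"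
  proof -
    show "cell (mu a) \<subseteq> K a" using mu_cell_K[OF T(1) c] .
    show "K a \<inter> Tp = {}" using K_subset[OF T(1)] by blast
    show "K g \<inter> Tp = {}" using K_subset[OF T(2)] by blast
  qed
  have Kag: "K a \<inter> K g = {}" using K_meet[OF T(2,1), unfolded loop] T(4,5) by blast
  have muK: "mu a \<in> K a" "b \<in> K a" using Ka(1) b by (auto simp: cell_def)
  have "mu a \<notin> Tp" "b \<notin> Tp" using Ka(2) muK by blast+
  then have out: "mu a \<notin> {a, g, h}" "b \<notin> {a, g, h}" using T(1,2,3) by auto
  have "wins {g, mu a} {h, b, d}"
  proof (rule walk_closes[OF th T(2) _ loop])
    show "K g \<inter> ({g, mu a} \<union> {h, b, d}) = {}" using Ka Kag muK T(2,3) d(2) by blast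
    show "a \<notin> {g, mu a}" "a \<notin> {h, b, d}" using T out d by auto
  qed simp_all
  then have "forced_line [(a, g, h)] wins {mu a} {b, d}"
    using T out d triangle_N[OF t] by auto
  from forced_line_wins[OF this] show "wins (insert (mu a) {}) (insert b {d})" by simp
qed

text \<open>
  The two ends of the loop lie in different diamonds, so Staller takes \<open>mu g\<close> and \<open>mu h\<close> with tempo. Then \<open>a\<close>
  threatens both the neighbourhood of \<open>g\<close> and that of \<open>h\<close>.
\<close>

lemma double_loop_start:
  assumes t: "triangle a g h" and loop: "nu g = h" and len: "length (ch g) \<noteq> 1"
    and d: "d \<notin> {a, g, h}" "d \<notin> K g"
  shows "wins {} {d}"
proof (rule diamond_start)
  note T = triangleD[OF t] and L = loop_ch[OF t loop]
  have tg: "triangle g h a" and th: "triangle h a g" using t triangle_rotate by blast+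
  have KT: "K g \<inter> Tp = {}" using K_subset[OF T(2)] by blast
  have disj: "cell (mu g) \<inter> cell (mu h) = {}"
  proof (rule ccontr)
    assume "\<not> ?thesis"
    then have "mu h = mu g \<or> mu h = opp (mu g)" using cells_meet[OF L(2,3)] by blast
    moreover have "mu h \<noteq> mu g" using mu_inj T by auto
    ultimately have "opp (last (ch g)) = opp (hd (ch g))"
      using mu_nu_last[OF T(2) L(1)] loop chain_nil_iff(3)[OF T(2) L(1)] by simp
    moreover have "last (ch g) \<in> Dp" "hd (ch g) \<in> Dp" using ch_Dp[OF T(2)] L(1) by auto
    ultimately have eq: "last (ch g) = hd (ch g)" using opp(3) by metis
    obtain e es where es: "ch g = e # es" using L(1) by (cases "ch g") auto
    then have "es \<noteq> []" using len by auto
    then have "last es = e" "last es \<in> set es" using eq es by auto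
    then show False using distinct_ch[OF T(2)] es by auto
  qed
  show "mu g \<in> Dp" by fact
  show "cell (mu g) \<inter> ({} \<union> {d}) = {}" using L d by blast
  fix b assume b: "b \<in> cell (mu g)" "b \<noteq> mu g"
  have mg: "mu g \<in> cell (mu g)" "mu h \<in> cell (mu h)" by (simp_all add: cell_def)
  show "wins (insert (mu g) {}) (insert b {d})"
  proof (rule diamond_start[OF L(3)])
    show "cell (mu h) \<inter> (insert (mu g) {} \<union> insert b {d}) = {}" using disj b mg d(2) L(5) by blast
    fix b' assume b': "b' \<in> cell (mu h)" "b' \<noteq> mu h"
    have out: "z \<notin> {a, g, h}" if "z \<in> K g" for z using that KT T(1,2,3) by blast
    have inK: "mu g \<in> K g" "mu h \<in> K g" "b \<in> K g" "b' \<in> K g" using mg b(1) b'(1) L(4,5) by blast+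
    have outs: "mu g \<notin> {a, g, h}" "mu h \<notin> {a, g, h}" "b \<notin> {a, g, h}" "b' \<notin> {a, g, h}"
      using inK[THEN out] .
    have "forced_line [(g, a, h)] (completes h g) {mu h, mu g} {b', b, d}"
      using T outs d(1) triangle_N[OF tg] triangle_N[OF th] by auto
    from forced_line_completes[OF this]
    show "wins (insert (mu h) (insert (mu g) {})) (insert b' (insert b {d}))" by simp
  qed
qed

text \<open>
  The dumbbells that survive: the loop at \<open>b\<close> has one diamond, and either the bridge is a single edge, which gives
  \<open>\<omega>\<^sub>k\<close> with \<open>k = length (ch g)\<close>, or the bridge and the loop at \<open>a\<close> have one diamond each, which gives \<open>\<eta>\<close>.
\<close>

definition exceptional :: "'a \<Rightarrow> 'a \<Rightarrow> 'a \<Rightarrow> 'a \<Rightarrow> 'a \<Rightarrow> 'a \<Rightarrow> bool" where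
  "exceptional a g h b x y \<longleftrightarrow> triangle a g h \<and> triangle b x y \<and> nu g = h \<and> nu x = y \<and> nu a = b \<and> tri a \<noteq> tri b \<and>
     length (ch x) = 1 \<and> (ch a = [] \<or> length (ch a) = 1 \<and> length (ch g) = 1)"

lemma dumbbell_cover:
  assumes t: "triangle a g h" and u: "triangle b x y" and loops: "nu g = h" "nu x = y" and ab: "nu a = b"
  shows "Tp = {a, g, h, b, x, y}" "V = Tp \<union> K a \<union> K g \<union> K x"
proof -
  note T = triangleD[OF t] and U = triangleD[OF u]
  have nub: "nu b = a" "nu h = g" "nu y = x" using loops ab T U by auto
  let ?C = "{a, g, h, b, x, y}"
  have C: "?C \<subseteq> Tp" "?C \<noteq> {}" using T U by simp_all
  have ct: "r \<in> ?C" if "triangle q r s" "q \<in> ?C" for q r s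
    using triangle_closed[OF t that(1)] triangle_closed[OF u that(1)] that(2) by auto
  have cn: "nu q \<in> ?C" if "q \<in> ?C" for q using that loops ab nub by blast
  show "Tp = ?C" using ports_connected(1)[OF C ct cn] by simp
  have "V = Tp \<union> (\<Union>p \<in> ?C. K p)" using ports_connected(2)[OF C ct cn] by simp
  moreover have "K b = K a" "K h = K g" "K y = K x" using K_nu[OF T(1)] K_nu[OF T(2)] K_nu[OF U(2)] loops ab by auto
  ultimately show "V = Tp \<union> K a \<union> K g \<union> K x" by auto
qed

text \<open>
  Dominator has started at the loop of \<open>a\<close>, so the loop of \<open>b\<close> and a diamond of the bridge next to \<open>b\<close> are untouched.
\<close>

lemma dumbbell_far_end:
  assumes t: "triangle a g h" and u: "triangle b x y" and loops: "nu g = h" "nu x = y" and ab: "nu a = b"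
    and ne: "tri a \<noteq> tri b" and d: "d \<in> {a, g, h} \<union> K g"
  shows "wins {} {d} \<or> exceptional a g h b x y"
proof -
  note T = triangleD[OF t] and U = triangleD[OF u]
  have sep: "d \<notin> {b, x, y}" "d \<notin> K x" "d \<notin> K b"
  proof -
    have dis: "e \<noteq> e'" if "e \<in> {a, g, h}" "e' \<in> {b, x, y}" for e e'
      using tri_mem[OF t that(1)] tri_mem[OF u] that(2) ne by metis
    have KT: "K e \<inter> Tp = {}" if "e \<in> Tp" for e using K_subset[OF that] by blast
    have gx: "x \<noteq> g" "x \<noteq> h" "b \<noteq> g" "b \<noteq> h" using dis[of g x] dis[of h x] dis[of g b] dis[of h b] by blast+
    then have "K g \<inter> K x = {}" "K g \<inter> K b = {}" using K_meet[OF T(2) U(2)] K_meet[OF T(2) U(1)] loops by blast+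
    then show "d \<notin> {b, x, y}" "d \<notin> K x" "d \<notin> K b"
      using d dis KT[OF T(2)] KT[OF U(2)] KT[OF U(1)] T U by blast+
  qed
  show ?thesis
  proof (cases "ch a = []")
    case True
    show ?thesis
    proof (cases "length (ch x) = 1")
      case False then show ?thesis using double_loop_start[OF u loops(2)] sep by blast
    qed (use assms True in \<open>simp add: exceptional_def\<close>)
  next
    case False
    then have "ch b \<noteq> []" using ch_nu[OF T(1)] ab by simp
    then have "mu b \<in> Dp" using mu_cases[OF U(1)] by metis
    then show ?thesis using bridge_start[OF u loops(2)] sep mu_cell_K[OF U(1)] by blast
  qed
qed

text \<open>
  What is left after \<open>dumbbell_far_end\<close> is a first move of Dominator on the bridge. One of the ends of the
  bridge is then untouched unless the bridge consists of one diamond, and in that case both loops are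
  untouched, so that two diamonds on either of them win.
\<close>

lemma dumbbell_wins:
  assumes t: "triangle a g h" and u: "triangle b x y" and loops: "nu g = h" "nu x = y" and ab: "nu a = b"
    and ne: "tri a \<noteq> tri b" and d: "d \<in> V"
  shows "wins {} {d} \<or> exceptional a g h b x y \<or> exceptional b x y a g h"
proof -
  note T = triangleD[OF t] and U = triangleD[OF u]
  have ba: "nu b = a" using ab T by auto
  have "d \<in> {a, g, h} \<union> K g \<or> d \<in> {b, x, y} \<union> K x \<or> d \<in> K a"
    using dumbbell_cover[OF t u loops ab] d by blast
  then consider "d \<in> {a, g, h} \<union> K g" | "d \<in> {b, x, y} \<union> K x" | "d \<in> K a" by blast
  then show ?thesis
  proof cases
    case 1 then show ?thesis using dumbbell_far_end[OF t u loops ab ne] by blast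
  next
    case 2 then show ?thesis using dumbbell_far_end[OF u t loops(2,1) ba] ne by metis
  next
    case 3
    have dis: "e \<noteq> e'" if "e \<in> {a, g, h}" "e' \<in> {b, x, y}" for e e'
      using tri_mem[OF t that(1)] tri_mem[OF u] that(2) ne by metis
    have gx: "b \<noteq> g" "b \<noteq> h" "a \<noteq> x" "a \<noteq> y" using dis[of g b] dis[of h b] dis[of a x] dis[of a y] by blast+
    have Kab: "K b = K a" using K_nu[OF T(1)] ab by simp
    have "K a \<inter> K g = {}" "K a \<inter> K x = {}"
      using K_meet[OF T(2,1)] K_meet[OF U(2) T(1)] loops gx T by blast+
    moreover have "K a \<inter> Tp = {}" using K_subset[OF T(1)] by blast
    ultimately have d': "d \<notin> {a, g, h}" "d \<notin> {b, x, y}" "d \<notin> K g" "d \<notin> K x" using 3 T U by blast+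
    have cha: "ch a \<noteq> []" "ch b \<noteq> []" using 3 Kab by (auto simp: K_def)
    then have mu: "mu a \<in> Dp" "mu b \<in> Dp" using mu_cases[OF T(1)] mu_cases[OF U(1)] by metis+
    show ?thesis
    proof (cases "d \<in> cell (mu a) \<and> d \<in> cell (mu b)")
      case False
      then show ?thesis using bridge_start[OF t loops(1) mu(1)] bridge_start[OF u loops(2) mu(2)] d' by blast
    next
      case True
      then have "mu b = mu a \<or> mu b = opp (mu a)" using cells_meet[OF mu] by blast
      moreover have "mu b \<noteq> mu a" using mu_inj T U dis[of a b] by auto
      ultimately have "opp (last (ch a)) = opp (hd (ch a))"
        using mu_nu_last[OF T(1) cha(1)] ab chain_nil_iff(3)[OF T(1) cha(1)] by simp
      moreover have "last (ch a) \<in> Dp" "hd (ch a) \<in> Dp" using ch_Dp[OF T(1)] cha by auto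
      ultimately have eq: "last (ch a) = hd (ch a)" using opp(3) by metis
      obtain e es where es: "ch a = e # es" using cha by (cases "ch a") auto
      have "es = []"
      proof (rule ccontr)
        assume "es \<noteq> []"
        then have "last es = e" "last es \<in> set es" using eq es by auto
        then show False using distinct_ch[OF T(1)] es by auto
      qed
      then have "length (ch a) = 1" using es by simp
      then show ?thesis
        using double_loop_start[OF t loops(1)] double_loop_start[OF u loops(2)] d' assms
        by (auto simp: exceptional_def)
    qed
  qed
qed

subsection \<open>Dominator starts in a triangle\<close>

lemma tri_neqI:
  assumes "y \<notin> tri x"
  shows "tri x \<noteq> tri y"
proof
  assume e: "tri x = tri y"
  have "y \<in> tri x" unfolding e by (rule tri_self)
  then show False using assms by blast
qed

lemma not_plain_iff: "x \<in> Tp \<Longrightarrow> y \<in> tri x \<Longrightarrow> plain y \<longleftrightarrow> plain x"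
  unfolding plain_def by (simp only: tri_eqI)

text \<open>
  A walk from a loop may pass the triangle of \<open>d\<close> if it enters at \<open>d\<close> itself: Staller never needs the port
  through which she enters. The entrances \<open>t2\<close> and \<open>t3\<close> are forbidden. Only a triangle both of whose exits
  lead to \<open>t2\<close> and \<open>t3\<close> could trap her; then its third port \<open>x\<close> is forbidden as an entrance too.
\<close>

lemma pass_start:
  assumes t: "triangle d t2 t3" and pl: "plain d"
    and loop: "triangle a g h" "nu g = h" "nu a \<notin> {t2, t3}"
    and X: "nu t3 \<in> tri (nu t2) \<Longrightarrow> triangle x (nu t2) (nu t3) \<and> nu a \<noteq> x \<and> nu x \<notin> tri x \<and> x \<notin> {d, t2, t3}"
  shows "wins {} {d}"
proof -
  note T = triangleD[OF t] and L = triangleD[OF loop(1)]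
  have td: "tri d = {d, t2, t3}" using triangle_tri[OF t] .
  have plx: "nu e \<notin> {d, t2, t3}" if "e \<in> {d, t2, t3}" for e using pl that unfolding plain_def td by blast
  have dK: "d \<notin> K q" if "q \<in> Tp" for q using K_subset[OF that] T(1) by blast
  have da: "d \<notin> {a, g, h}"
  proof
    assume d: "d \<in> {a, g, h}"
    then have "{a, g, h} = tri d" using tri_mem[OF loop(1) d] triangle_tri[OF loop(1)] by simp
    then have "g \<in> {d, t2, t3}" "h \<in> {d, t2, t3}" unfolding td by blast+
    then show False using plx[of g] loop(2) by simp
  qed
  have far: "r \<noteq> d" if "triangle q r s" "q \<notin> {t2, t3}" for q r s
  proof
    assume "r = d"
    then have "triangle d s q" using that(1) triangle_rotate by blast
    then show False using triangle_unique[OF t] that(2) by blast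
  qed
  define Q where "Q = Tp - {t2, t3} - (if nu t3 \<in> tri (nu t2) then {x} else {})"
  show ?thesis
  proof (rule loop_start[OF loop(1,2)])
    show "Q \<subseteq> Tp" by (auto simp: Q_def)
    show "nu a \<in> Q" using loop(3) X L by (auto simp: Q_def)
    show "d \<notin> {a, g, h}" "d \<notin> K g" using da dK L by auto
    show "r \<noteq> d" if "q \<in> Q" "triangle q r s" for q r s using far[OF that(2)] that(1) by (auto simp: Q_def)
    show "d \<notin> K q" if "q \<in> Q" for q using dK that by (auto simp: Q_def)
    fix q assume q: "q \<in> Q"
    then have qT: "q \<in> Tp" by (simp add: Q_def)
    have t': "triangle q (rot q) (rot (rot q))" using triangle_ex[OF qT] .
    show "\<exists>r s. triangle q r s \<and> nu r \<in> Q"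
    proof (rule ccontr)
      assume "\<not> ?thesis"
      then have bad: "nu r \<notin> Q" if "triangle q r s" for r s using that by blast
      define r s where "r = rot q" and "s = rot (rot q)"
      have rs: "triangle q r s" "triangle q s r" using t' triangle_swap by (auto simp: r_def s_def)
      note R = triangleD[OF rs(1)]
      have same: "tri r = tri s" using tri_same[OF rs(1)] by simp
      let ?ex = "if nu t3 \<in> tri (nu t2) then {x} else {}"
      have "nu r \<in> {t2, t3} \<union> ?ex" "nu s \<in> {t2, t3} \<union> ?ex"
        using bad[OF rs(1)] bad[OF rs(2)] R by (auto simp: Q_def)
      moreover have nn: "nu (nu r) = r" "nu (nu s) = s" using R by auto
      ultimately consider "r = nu t2" "s = nu t3" | "r = nu t3" "s = nu t2"
        | "nu t3 \<in> tri (nu t2)" "r = nu x" "s \<in> {nu t2, nu t3}" | "nu t3 \<in> tri (nu t2)" "s = nu x" "r \<in> {nu t2, nu t3}"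
        using R(6) by (cases "nu t3 \<in> tri (nu t2)") (simp, metis)+
      then show False
      proof cases
        case 1
        then have in_tri: "nu t3 \<in> tri (nu t2)" using same tri_self[of "nu t3"] by simp
        then have "triangle x (nu t2) (nu t3)" using X by blast
        then have "q = x" using 1 rs(1) triangle_rotate triangle_unique by blast
        then show False using q in_tri by (simp add: Q_def)
      next
        case 2
        then have in_tri: "nu t3 \<in> tri (nu t2)" using same tri_self[of "nu t3"] by simp
        then have "triangle x (nu t2) (nu t3)" using X by blast
        then have "q = x" using 2 rs(2) triangle_rotate triangle_unique by blast
        then show False using q in_tri by (simp add: Q_def)
      next
        case 3
        then have tx: "triangle x (nu t2) (nu t3)" "nu x \<notin> tri x" using X by blast+
        have "tri s = tri x" using tri_mem[OF tx(1)] 3(3) by blast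
        then show False using tx(2) 3(2) same tri_self[of r] by simp
      next
        case 4
        then have tx: "triangle x (nu t2) (nu t3)" "nu x \<notin> tri x" using X by blast+
        have "tri r = tri x" using tri_mem[OF tx(1)] 4(3) by blast
        then show False using tx(2) 4(2) same tri_self[of s] by simp
      qed
    qed
  qed
qed

text \<open>
  Two triangles joined by two chains form a block with the two exits \<open>k\<close> and \<open>x\<close>. If these lead to different
  triangles, one of which has no loop, Staller starts there; otherwise both have loops, and she can
  start at either. If they lead to the same triangle, it is added to the block, which then has the single exit
  \<open>v\<close>, and the triangle behind it is a starting point. The alternatives with a loop are left for \<open>pass_start\<close>.
\<close>

lemma double_chain:
  assumes t: "triangle k i j" and pl: "plain k" and d: "d \<in> {k, i, j}"
    and u: "triangle x (nu i) (nu j)" and k: "nu k \<notin> {x, nu i, nu j}"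
  shows "wins {} {d} \<or>
    ((\<exists>g h. triangle (nu k) g h \<and> nu g = h) \<and> (\<exists>g h. triangle (nu x) g h \<and> nu g = h)) \<or>
    (\<exists>a g h. triangle a g h \<and> nu g = h \<and> nu a \<notin> {k, i, j, x})"
    and "nu x \<notin> {x, nu i, nu j}" "nu x \<notin> {k, i, j}" "x \<notin> {k, i, j}"
proof -
  note T = triangleD[OF t] and U = triangleD[OF u]
  have tk: "tri k = {k, i, j}" and tx: "tri x = {x, nu i, nu j}" using triangle_tri[OF t] triangle_tri[OF u] .
  have plx: "nu e \<notin> {k, i, j}" if "e \<in> {k, i, j}" for e using pl that unfolding plain_def tk by blast
  have nn: "nu (nu i) = i" "nu (nu j) = j" "nu (nu k) = k" "nu (nu x) = x" using T U by auto
  have xT: "x \<notin> {k, i, j}"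
  proof
    assume "x \<in> {k, i, j}"
    then have "{k, i, j} = {x, nu i, nu j}" using tri_mem[OF t] tk tx by metis
    then show False using plx[of i] by blast
  qed
  show "x \<notin> {k, i, j}" by fact
  have "nu x \<noteq> k" "nu x \<noteq> i" "nu x \<noteq> j" using nn(4) k U(4,5) by auto
  then have wT: "nu x \<notin> {k, i, j}" by simp
  show "nu x \<notin> {k, i, j}" by fact
  have wX: "nu x \<notin> {x, nu i, nu j}"
  proof -
    have "nu x \<noteq> nu i" "nu x \<noteq> nu j" using xT nn by (metis insertCI)+
    then show ?thesis using U by auto
  qed
  show "nu x \<notin> {x, nu i, nu j}" by fact
  define y w where "y = nu k" and "w = nu x"
  have yw: "y \<in> Tp" "w \<in> Tp" "nu y = k" "nu w = x" using T U by (auto simp: y_def w_def)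
  have yT: "y \<notin> {k, i, j}" "y \<notin> {x, nu i, nu j}" and wF: "w \<notin> {k, i, j}" "w \<notin> {x, nu i, nu j}"
    using plx k wT wX by (auto simp: y_def w_def)
  let ?F = "{k, i, j} \<union> {x, nu i, nu j}"
  have nuF: "p = y \<or> p = w" if "p \<in> Tp" "p \<notin> ?F" "nu p \<in> ?F" for p
  proof -
    have np: "nu (nu p) = p" using that by simp
    have "p \<noteq> i" "p \<noteq> j" using that(2) by auto
    then have "nu p \<noteq> nu i" "nu p \<noteq> nu j" using np nn(1,2) by metis+
    then have "nu p = k \<or> nu p = i \<or> nu p = j \<or> nu p = x" using that(3) by blast
    then show ?thesis using np that(2) by (auto simp: y_def w_def)
  qed
  have F: "?F \<subseteq> Tp" using T U by auto
  have cl: "r \<in> ?F" if "triangle q r s" "q \<in> ?F" for q r s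
    using triangle_closed[OF t that(1)] triangle_closed[OF u that(1)] that(2) by blast
  have yw_ne: "y \<noteq> w" using yw xT by auto
  show "wins {} {d} \<or>
    ((\<exists>g h. triangle (nu k) g h \<and> nu g = h) \<and> (\<exists>g h. triangle (nu x) g h \<and> nu g = h)) \<or>
    (\<exists>a g h. triangle a g h \<and> nu g = h \<and> nu a \<notin> {k, i, j, x})"
  proof (cases "w \<in> tri y")
    case False
    have one: "nu r \<notin> ?F" if q: "triangle q r s" "q \<notin> ?F" "nu q \<in> ?F" for q r s
    proof
      assume nr: "nu r \<in> ?F"
      note Q = triangleD[OF q(1)]
      have "r \<notin> ?F" using cl q(1,2) triangle_rotate triangle_swap by blast
      then have "r = y \<or> r = w" "q = y \<or> q = w" using nuF nr Q q by blast+
      then have "tri y = tri w" using tri_same(1)[OF q(1)] Q by auto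
      then show False using False tri_self[of w] by simp
    qed
    have win: "wins {} {d}" if "z \<in> Tp" "z \<notin> ?F" "plain z" for z
      by (rule outside_wins[OF F cl _ one that]) (use d in auto)
    have loop_at: "\<exists>g h. triangle z g h \<and> nu g = h" if "z \<in> {y, w}" "\<not> plain z" for z
    proof (rule loop_form_at)
      show "z \<in> Tp" "\<not> plain z" using that yw by auto
      have "nu z \<in> ?F" using that yw by auto
      moreover have "tri z \<inter> ?F = {}"
      proof -
        have zF: "z \<notin> ?F" "z \<in> Tp" using that yT wF yw by auto
        show ?thesis using cl[OF triangle_rotate[OF triangle_rotate[OF triangle_ex[OF zF(2)]]]]
          cl[OF triangle_rotate[OF triangle_swap[OF triangle_ex[OF zF(2)]]]]
          cl[OF triangle_swap[OF triangle_rotate[OF triangle_ex[OF zF(2)]]]] zF(1) by blast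
      qed
      ultimately show "nu z \<notin> tri z" by blast
    qed
    show ?thesis
    proof (cases "plain y \<or> plain w")
      case True then show ?thesis using win yw yT wF by blast
    next
      case False then show ?thesis using loop_at[of y] loop_at[of w] by (auto simp: y_def w_def)
    qed
  next
    case True
    obtain v where v: "triangle y w v" using triangle_complete[OF yw(1) True] yw_ne by blast
    note Y = triangleD[OF v]
    have F2: "y \<notin> ?F" using yT by blast
    have nv: "nu (nu v) = v" using Y by simp
    have vF: "v \<notin> ?F" "v \<noteq> y" "v \<noteq> w"
      using cl[OF triangle_rotate[OF triangle_rotate[OF v]]] F2 Y by auto
    let ?G = "?F \<union> {y, w, v}"
    have vG: "nu v \<notin> ?G"
    proof
      assume "nu v \<in> ?G"
      then consider "nu v \<in> ?F" | "nu v = y" | "nu v = w" | "nu v = v" by blast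
      then show False
      proof cases
        case 1 then show ?thesis using nuF[of v] vF Y by auto
      next
        case 2 then show ?thesis using nv yw vF(1) by auto
      next
        case 3 then show ?thesis using nv yw vF(1) by auto
      next
        case 4 then show ?thesis using Y by simp
      qed
    qed
    have G: "?G \<subseteq> Tp" using F Y by blast
    have clG: "r \<in> ?G" if "triangle q r s" "q \<in> ?G" for q r s
      using cl[OF that(1)] triangle_closed[OF v that(1)] that(2) by blast
    have nuG: "p = nu v" if "p \<in> Tp" "p \<notin> ?G" "nu p \<in> ?G" for p
    proof -
      have p: "nu (nu p) = p" using that by simp
      from that(3) consider "nu p \<in> ?F" | "nu p = y" | "nu p = w" | "nu p = v" by blast
      then show ?thesis
      proof cases
        case 1 then show ?thesis using nuF[of p] that by blast
      next
        case 2 then show ?thesis using p yw that(2) by auto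
      next
        case 3 then show ?thesis using p yw that(2) by auto
      next
        case 4 then show ?thesis using p by simp
      qed
    qed
    have one: "nu r \<notin> ?G" if q: "triangle q r s" "q \<notin> ?G" "nu q \<in> ?G" for q r s
    proof
      assume nr: "nu r \<in> ?G"
      note Q = triangleD[OF q(1)]
      have "r \<notin> ?G" using clG q(1,2) triangle_rotate triangle_swap by blast
      then have "r = nu v" "q = nu v" using nuG nr Q q by blast+
      then show False using Q by simp
    qed
    show ?thesis
    proof (cases "plain (nu v)")
      case True
      have "wins {} {d}"
        by (rule outside_wins[OF G clG _ one _ vG True]) (use d Y in auto)
      then show ?thesis by blast
    next
      case False
      have vT: "nu v \<in> Tp" using Y by simp
      have "nu (nu v) \<notin> tri (nu v)"
      proof
        assume "nu (nu v) \<in> tri (nu v)"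
        then have "v \<in> tri (nu v)" using nv by simp
        then have "tri v = tri (nu v)" using tri_eqI[OF vT] by blast
        then have "nu v \<in> tri v" using tri_self[of "nu v"] by simp
        then have "nu v \<in> {y, w, v}" using tri_mem[OF v, of v] triangle_tri[OF v] by simp
        then show False using vG by blast
      qed
      then obtain g h where "triangle (nu v) g h" "nu g = h" using loop_form_at[OF vT False] by blast
      moreover have "nu (nu v) \<notin> {k, i, j, x}" using nv vF by auto
      ultimately show ?thesis by blast
    qed
  qed
qed

text \<open>
  If the triangle of \<open>d\<close> has a loop, the neighbouring triangle has none, and Staller starts there, or it has one,
  and the graph is a dumbbell. Otherwise the three chains at the triangle of \<open>d\<close> lead to three different triangles,
  to a single one (\<open>theta_wins\<close>), or exactly two of them lead to the same triangle (\<open>double_chain\<close>).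
\<close>

lemma dominator_in_triangle:
  assumes d: "d \<in> Tp"
  shows "wins {} {d} \<or> (\<exists>a g h b x y. triangle a g h \<and> triangle b x y \<and> nu g = h \<and> nu x = y \<and> nu a = b \<and> tri a \<noteq> tri b)"
proof (cases "plain d")
  case False
  obtain a g h where t: "triangle a g h" "tri a = tri d" "nu g = h" using loop_form[OF d False] by blast
  note T = triangleD[OF t(1)]
  have ta: "tri a = {a, g, h}" using triangle_tri[OF t(1)] .
  have nh: "nu h = g" using t(3) T by auto
  have y: "nu a \<notin> {a, g, h}"
  proof -
    have "nu a \<noteq> g" "nu a \<noteq> h" using T(4,5) t(3) nh nu_nu[OF T(1)] by metis+
    then show ?thesis using T by simp
  qed
  have yT: "nu a \<in> Tp" "nu (nu a) = a" using T by auto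
  let ?F = "{a, g, h}"
  have nuF: "p = nu a" if "p \<in> Tp" "p \<notin> ?F" "nu p \<in> ?F" for p
  proof -
    have np: "nu (nu p) = p" "p \<noteq> g" "p \<noteq> h" using that by auto
    then have "nu p \<noteq> g" "nu p \<noteq> h" using t(3) nh by metis+
    then show ?thesis using that(3) np(1) by auto
  qed
  have dF: "d \<in> ?F" using t(2) ta tri_self[of d] by simp
  have cl: "r \<in> ?F" if "triangle q r s" "q \<in> ?F" for q r s using triangle_closed[OF t(1) that] .
  have one: "nu r \<notin> ?F" if q: "triangle q r s" "q \<notin> ?F" "nu q \<in> ?F" for q r s
  proof
    assume nr: "nu r \<in> ?F"
    note Q = triangleD[OF q(1)]
    have "r \<notin> ?F" using cl q(1,2) triangle_rotate triangle_swap by blast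
    then have "r = nu a" "q = nu a" using nuF nr Q q by blast+
    then show False using Q by simp
  qed
  have F: "?F \<subseteq> Tp" using T by simp
  show ?thesis
  proof (cases "plain (nu a)")
    case True
    have "wins {} {d}" by (rule outside_wins[OF F cl _ one yT(1) y True]) (use dF in auto)
    then show ?thesis by blast
  next
    case False
    have "nu a \<notin> tri a" unfolding ta using y .
    then have ne: "tri a \<noteq> tri (nu a)" by (rule tri_neqI)
    have "a \<notin> tri (nu a)" using tri_eqI[OF yT(1), of a] ne by metis
    then have "nu (nu a) \<notin> tri (nu a)" using yT by simp
    then show ?thesis using loop_form_at[OF yT(1) False] t(1,3) ne by blast
  qed
next
  case True
  define t2 t3 where "t2 = rot d" and "t3 = rot (rot d)"
  have t: "triangle d t2 t3" using triangle_ex[OF d] by (simp add: t2_def t3_def)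
  note T = triangleD[OF t]
  have td: "tri d = {d, t2, t3}" using triangle_tri[OF t] .
  have plx: "nu e \<notin> {d, t2, t3}" if "e \<in> {d, t2, t3}" for e using True that unfolding plain_def td by blast
  have nn: "nu (nu d) = d" "nu (nu t2) = t2" "nu (nu t3) = t3" using T by auto
  have yT: "nu d \<in> Tp" "nu t2 \<in> Tp" "nu t3 \<in> Tp" using T by auto
  have yne: "nu d \<noteq> nu t2" "nu d \<noteq> nu t3" "nu t2 \<noteq> nu t3" using nn T by metis+
  have third: "\<exists>x. triangle x p q" if "p \<in> Tp" "q \<in> tri p" "p \<noteq> q" for p q
    using triangle_complete[OF that(1,2)] that(3) triangle_rotate by metis
  \<comment> \<open>the case in which \<open>d\<close> is an end of one of the chains of a double chain\<close>
  have end_case: "wins {} {d}" if s: "triangle d i k" "nu i \<in> tri (nu d)" "nu k \<notin> tri (nu d)" for i k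
  proof -
    have ik: "{i, k} = {t2, t3}" using triangle_unique[OF t s(1)] by blast
    have Ti: "i \<in> Tp" "k \<in> Tp" "d \<noteq> i" using triangleD[OF s(1)] by auto
    have "nu d \<noteq> nu i" using Ti d nu_eq_iff by metis
    then obtain x where x: "triangle x (nu d) (nu i)" using third[OF yT(1) s(2)] by blast
    have tx: "tri (nu d) = tri x" "tri x = {x, nu d, nu i}" using tri_same[OF x] triangle_tri[OF x] by auto
    have kd: "triangle k d i" using s(1) triangle_rotate by blast
    have plk: "plain k" using True not_plain_iff[OF d, of k] td ik by blast
    have nk: "nu k \<notin> {x, nu d, nu i}" using s(3) tx by simp
    have dm: "d \<in> {k, d, i}" by simp
    note D = double_chain[OF kd plk dm x nk]
    have nin: "\<not> nu t3 \<in> tri (nu t2)"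
    proof
      assume "nu t3 \<in> tri (nu t2)"
      then have "tri (nu t3) = tri (nu t2)" by (rule tri_eqI[OF yT(2)])
      then have "tri (nu k) = tri (nu i)" using ik by (auto simp: doubleton_eq_iff)
      moreover have "tri (nu i) = tri (nu d)" using tri_eqI[OF yT(1) s(2)] .
      ultimately have "tri (nu k) = tri (nu d)" by (rule trans)
      then show False using tri_neqI[OF s(3)] by metis
    qed
    have fin: "wins {} {d}" if "triangle a g h" "nu g = h" "nu a \<notin> {t2, t3}" for a g h
      by (rule pass_start[OF t True that]) (use nin in blast)
    have xx: "nu (nu x) = x" using triangleD[OF x] by simp
    have sub: "{t2, t3} \<subseteq> {k, d, i}" using ik by blast
    consider "wins {} {d}" | g h where "triangle (nu x) g h" "nu g = h"
      | a g h where "triangle a g h" "nu g = h" "nu a \<notin> {k, d, i, x}" using D(1) by blast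
    then show ?thesis
    proof cases
      case 2
      have "nu (nu x) \<notin> {t2, t3}" unfolding xx using D(4) sub by blast
      then show ?thesis using fin[OF 2] by blast
    next
      case 3
      then have "nu a \<notin> {t2, t3}" using sub by blast
      then show ?thesis using fin[OF 3(1,2)] by blast
    qed
  qed
  show ?thesis
  proof (cases "nu t2 \<in> tri (nu d) \<or> nu t3 \<in> tri (nu d)")
    case near: True
    show ?thesis
    proof (cases "nu t2 \<in> tri (nu d) \<and> nu t3 \<in> tri (nu d)")
      case both: True
      then have "triangle (nu d) (nu t2) (nu t3)"
        using triangle_complete[OF yT(1), of "nu t2"] yne triangle_in_tri by metis
      moreover have "nu d \<notin> tri d" unfolding td using plx[of d] by blast
      then have "tri d \<noteq> tri (nu d)" by (rule tri_neqI)
      ultimately show ?thesis using theta_wins[OF t] by blast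
    next
      case False
      then show ?thesis using near end_case[OF t] end_case[OF triangle_swap[OF t]] by blast
    qed
  next
    case far: False
    show ?thesis
    proof (cases "nu t3 \<in> tri (nu t2)")
      case True': True
      obtain x where x: "triangle x (nu t2) (nu t3)" using third[OF yT(2) True'] yne by blast
      have tx: "tri (nu t2) = tri x" "tri x = {x, nu t2, nu t3}" using tri_same[OF x] triangle_tri[OF x] by auto
      have nd: "nu d \<notin> {x, nu t2, nu t3}"
      proof
        assume "nu d \<in> {x, nu t2, nu t3}"
        then have e: "tri (nu d) = tri x" using tri_mem[OF x] by blast
        have "nu t2 \<in> tri (nu d)" unfolding e tx(2) by blast
        then show False using far by blast
      qed
      have dm: "d \<in> {d, t2, t3}" by simp
      note D = double_chain[OF t True dm x nd]
      have fin: "wins {} {d}" if "triangle a g h" "nu g = h" "nu a \<notin> {t2, t3}" "nu a \<noteq> x" for a g h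
      proof (rule pass_start[OF t True that(1-3)])
        show "triangle x (nu t2) (nu t3) \<and> nu a \<noteq> x \<and> nu x \<notin> tri x \<and> x \<notin> {d, t2, t3}"
          unfolding tx(2) using x that(4) D(2,4) by blast
      qed
      consider "wins {} {d}" | g h where "triangle (nu d) g h" "nu g = h"
        | a g h where "triangle a g h" "nu g = h" "nu a \<notin> {d, t2, t3, x}" using D(1) by blast
      then show ?thesis
      proof cases
        case 1 then show ?thesis by (rule disjI1)
      next
        case 2
        have "nu (nu d) \<notin> {t2, t3}" "nu (nu d) \<noteq> x" unfolding nn(1) using D(4) T(4,5) by blast+
        then show ?thesis using fin[OF 2] by blast
      next
        case 3
        then have "nu a \<notin> {t2, t3}" "nu a \<noteq> x" by blast+
        then show ?thesis using fin[OF 3(1,2)] by blast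
      qed
    next
      case False
      let ?F = "{d, t2, t3}"
      have F: "?F \<subseteq> Tp" using T by simp
      have cl: "r \<in> ?F" if "triangle q r s" "q \<in> ?F" for q r s using triangle_closed[OF t that] .
      have nuF: "p \<in> {nu d, nu t2, nu t3}" if "p \<in> Tp" "nu p \<in> ?F" for p
        using that nu_nu[OF that(1)] by auto
      have ap: "tri (nu d) \<noteq> tri (nu t2)" "tri (nu d) \<noteq> tri (nu t3)" "tri (nu t2) \<noteq> tri (nu t3)"
        using far False by (intro tri_neqI; blast)+
      have apart: "tri p \<noteq> tri q" if "p \<in> {nu d, nu t2, nu t3}" "q \<in> {nu d, nu t2, nu t3}" "p \<noteq> q" for p q
        using that ap ap[symmetric] by (elim insertE emptyE) (simp_all only: simp_thms not_False_eq_True)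
      have one: "nu r \<notin> ?F" if q: "triangle q r s" "q \<notin> ?F" "nu q \<in> ?F" for q r s
      proof
        assume nr: "nu r \<in> ?F"
        note Q = triangleD[OF q(1)]
        have "r \<in> {nu d, nu t2, nu t3}" "q \<in> {nu d, nu t2, nu t3}" using nuF nr Q q by blast+
        then show False using apart[of q r] tri_same(1)[OF q(1)] Q(4) by metis
      qed
      show ?thesis
      proof (cases "plain (nu d)")
        case True
        have "wins {} {d}" by (rule outside_wins[OF F cl _ one yT(1) _ True]) (use plx in auto)
        then show ?thesis by blast
      next
        case loopy: False
        have "nu (nu d) \<notin> tri (nu d)"
        proof
          assume "nu (nu d) \<in> tri (nu d)"
          then have "d \<in> tri (nu d)" unfolding nn(1) .
          then have "tri d = tri (nu d)" by (rule tri_eqI[OF yT(1)])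
          moreover have "nu d \<notin> tri d" unfolding td using plx[of d] by blast
          ultimately show False using tri_neqI by metis
        qed
        then obtain g h where l: "triangle (nu d) g h" "nu g = h" using loop_form_at[OF yT(1) loopy] by blast
        have "nu (nu d) \<notin> {t2, t3}" unfolding nn(1) using T(4,5) by blast
        then have "wins {} {d}" by (rule pass_start[OF t \<open>plain d\<close> l]) (use False in blast)
        then show ?thesis by blast
      qed
    qed
  qed
qed

subsection \<open>Dominator starts in a diamond\<close>

text \<open>
  A first move on a chain destroys just one edge of the multigraph. If this is a loop, Staller starts at the
  neighbouring triangle; otherwise all ports but the ends of that chain are walkable, and she starts at
  one of its two end triangles, unless both have loops.
\<close>

lemma dominator_in_diamond:
  assumes p: "p \<in> Tp" and d: "d \<in> K p"
  shows "wins {} {d} \<or> (\<exists>a g h b x y. triangle a g h \<and> triangle b x y \<and> nu g = h \<and> nu x = y \<and> nu a = b \<and> tri a \<noteq> tri b)"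
proof (cases "nu p \<in> tri p")
  case True
  have "nu p \<noteq> p" using p by simp
  then obtain a where t: "triangle a p (nu p)" using triangle_complete[OF p True] triangle_rotate by blast
  note T = triangleD[OF t]
  have nn: "nu (nu p) = p" "nu (nu a) = a" using T by auto
  have ta: "tri a = {a, p, nu p}" using triangle_tri[OF t] .
  let ?F = "{a, p, nu p}"
  have y: "nu a \<notin> ?F"
  proof -
    have "nu a \<noteq> p" "nu a \<noteq> nu p" using T(4,5) nn by metis+
    then show ?thesis using T by simp
  qed
  have yT: "nu a \<in> Tp" using T by simp
  have nuF: "q = nu a" if "q \<in> Tp" "q \<notin> ?F" "nu q \<in> ?F" for q
  proof -
    have nq: "nu (nu q) = q" "q \<noteq> p" "q \<noteq> nu p" using that by auto
    then have "nu q \<noteq> p" "nu q \<noteq> nu p" using nn(1) by metis+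
    then show ?thesis using that(3) nq(1) by auto
  qed
  have cl: "r \<in> ?F" if "triangle q r s" "q \<in> ?F" for q r s using triangle_closed[OF t that] .
  have one: "nu r \<notin> ?F" if q: "triangle q r s" "q \<notin> ?F" "nu q \<in> ?F" for q r s
  proof
    assume nr: "nu r \<in> ?F"
    note Q = triangleD[OF q(1)]
    have "r \<notin> ?F" using cl q(1,2) triangle_rotate triangle_swap by blast
    then have "r = nu a" "q = nu a" using nuF nr Q q by blast+
    then show False using Q by simp
  qed
  have F: "?F \<subseteq> Tp" using T by simp
  show ?thesis
  proof (cases "plain (nu a)")
    case True
    have "wins {} {d}" by (rule outside_wins[OF F cl _ one yT y True]) (use d in auto)
    then show ?thesis by blast
  next
    case False
    have "nu a \<notin> tri a" unfolding ta using y .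
    then have ne: "tri a \<noteq> tri (nu a)" by (rule tri_neqI)
    have "a \<notin> tri (nu a)" using tri_eqI[OF yT, of a] ne by metis
    then have "nu (nu a) \<notin> tri (nu a)" using nn by simp
    then show ?thesis using loop_form_at[OF yT False] t ne by blast
  qed
next
  case False
  define q where "q = nu p"
  have q: "q \<in> Tp" "nu q = p" "q \<noteq> p" "K q = K p" using p by (auto simp: q_def)
  have far: "tri p \<noteq> tri q" using False unfolding q_def by (rule tri_neqI)
  let ?W = "Tp - {p, q}"
  have nuW: "nu e \<in> ?W" if "e \<in> ?W" for e
  proof -
    have ne: "nu (nu e) = e" "e \<noteq> p" "e \<noteq> q" using that by auto
    then have "nu e \<noteq> p" "nu e \<noteq> q" using q(2) unfolding q_def by metis+
    then show ?thesis using that by auto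
  qed
  have dK: "d \<notin> Tp" using K_subset[OF p] d by blast
  have W: "walkable d ?W" unfolding walkable_def
  proof (intro conjI ballI allI impI)
    fix e assume e: "e \<in> ?W"
    then have eT: "e \<in> Tp" by blast
    show "nu e \<in> ?W" using nuW e by blast
    show "\<exists>r s. triangle e r s \<and> r \<in> ?W"
    proof -
      note t = triangle_ex[OF eT]
      note R = triangleD[OF t]
      have "tri (rot e) = tri (rot (rot e))" using tri_same[OF t] by simp
      then have "\<not> (rot e \<in> {p, q} \<and> rot (rot e) \<in> {p, q})" using far R(6) by auto
      then show ?thesis using t triangle_swap[OF t] R by blast
    qed
    show "d \<notin> tri e" using dK tri_in_Tp[OF eT] by blast
    show "d \<notin> K e" using K_meet[OF p eT d] e q_def by blast
  next
    fix e r s w assume e: "e \<in> ?W" "triangle e r s" "w \<in> ?W" "mu r \<in> tri w"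
    have r: "r \<in> Tp" "mu r \<in> Tp" using triangleD[OF e(2)] tri_in_Tp[OF _ e(4)] e(3) by auto
    then have "ch r = []" using chain_nil_iff(1) by blast
    then have "K r = {}" by (simp add: K_def)
    then have "r \<noteq> p" "r \<noteq> q" using d q by auto
    then show "r \<in> ?W" using r by blast
  qed blast
  have win: "wins {} {d}" if z: "z \<in> {p, q}" "plain z" for z
  proof -
    have zT: "z \<in> Tp" using z p q by blast
    note t = triangle_ex[OF zT]
    note R = triangleD[OF t]
    have "tri (rot z) = tri z" using tri_same[OF t] by simp
    then have "rot z \<noteq> p \<and> rot z \<noteq> q" using z(1) far R(4) by (metis insertE singletonD)
    moreover have "plain (rot z)" using not_plain_iff[OF zT, of "rot z"] z by simp
    ultimately show ?thesis using plain_wins[OF W, where a = "rot z"] R by blast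
  qed
  show ?thesis
  proof (cases "plain p \<or> plain q")
    case True then show ?thesis using win by blast
  next
    case np: False
    have "nu q \<notin> tri q" using far tri_eqI[OF q(1), of p] q(2) by metis
    then obtain g h x y where "triangle p g h" "nu g = h" "triangle q x y" "nu x = y"
      using loop_form_at[OF p _ False] loop_form_at[OF q(1)] np by blast
    then show ?thesis using far q_def by blast
  qed
qed

text \<open>
  Every vertex lies in a triangle or on a chain, so the two preceding lemmas leave the dumbbells only.
\<close>

lemma staller_wins_or_exceptional:
  "(\<forall>d \<in> V. wins {} {d}) \<or> (\<exists>a g h b x y. exceptional a g h b x y)"
proof (cases "\<exists>a g h b x y. triangle a g h \<and> triangle b x y \<and> nu g = h \<and> nu x = y \<and> nu a = b \<and> tri a \<noteq> tri b")
  case True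
  then show ?thesis using dumbbell_wins by metis
next
  case False
  have "wins {} {d}" if d: "d \<in> V" for d
  proof -
    have "V = Tp \<union> (\<Union>p \<in> Tp. K p)"
      by (rule ports_connected) (use Tp_nonempty triangleD nu_Tp in auto)
    then consider "d \<in> Tp" | p where "p \<in> Tp" "d \<in> K p" using d by blast
    then show ?thesis
    proof cases
      case 1 then show ?thesis using dominator_in_triangle False by blast
    next
      case 2 then show ?thesis using dominator_in_diamond False by blast
    qed
  qed
  then show ?thesis by blast
qed

end

section \<open>Dominator's wins on the exceptional graphs\<close>

text \<open>
  Breaker's pairing strategy: every pair \<open>P\<close> is a lost game of its own.
\<close>

lemma maker_loses_pairing:
  assumes P: "\<And>P. P \<in> Ps \<Longrightarrow> \<exists>a b. P = {a, b} \<and> a \<noteq> b" "disjoint Ps" "\<Union>Ps \<subseteq> V" "\<Union>Ps \<inter> (A \<union> B) = {}"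
    and H: "\<And>e. e \<in> H \<Longrightarrow> e \<inter> B - A \<noteq> {} \<or> (\<exists>P \<in> Ps. P \<subseteq> e)"
  shows "\<not> maker_wins V H A B"
proof (rule maker_loses_sum[where I = Ps and X = "\<lambda>P. P" and E = "\<lambda>P. {P}"])
  fix P assume p: "P \<in> Ps"
  then obtain a b where ab: "P = {a, b}" "a \<noteq> b" using P(1) by blast
  have "A \<inter> P = {}" "B \<inter> P = {}" using P(4) p by blast+
  moreover have "\<not> maker_wins P {P} {} {}"
  proof
    assume "maker_wins P {P} {} {}"
    then show False
    proof (cases rule: maker_wins.cases)
      case (move x)
      define y where "y = (if x = a then b else a)"
      have y: "y \<in> P" "y \<noteq> x" "P = {x, y}" using move(1) ab by (auto simp: y_def)
      then have "maker_wins P {P} {x} {y}" using move(3)[of y] by auto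
      then show False using y by (cases rule: maker_wins.cases) auto
    qed (use ab in auto)
  qed
  ultimately show "\<not> maker_wins P {P} (A \<inter> P) (B \<inter> P)" by simp
qed (use P(2,3) H in \<open>auto simp: disjoint_family_on_def disjoint_def\<close>)

text \<open>
  In a game without small edges Breaker may begin by naming a reply to every first move.
\<close>

lemma maker_loses_reply:
  assumes e: "\<And>e. e \<in> H \<Longrightarrow> 2 \<le> card e"
    and reply: "\<And>a. a \<in> V \<Longrightarrow> \<exists>b \<in> V - {a}. \<not> maker_wins V H {a} {b}"
  shows "\<not> maker_wins V H {} {}"
proof
  have small: "\<not> e \<subseteq> {a}" if "e \<in> H" for e a
    using e[OF that] card_mono[of "{a}" e] by auto
  assume "maker_wins V H {} {}"
  then show False
  proof (cases rule: maker_wins.cases)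
    case (won e) then show ?thesis using small[of e undefined] by blast
  next
    case (finish e x) then show ?thesis using small by blast
  next
    case (move a) then show ?thesis using reply[of a] by auto
  qed
qed

text \<open>
  What remains of a triangle whose loop has one diamond with ports \<open>h1\<close>, \<open>h3\<close>: the pair \<open>{h1, h3}\<close> lies in the
  neighbourhoods of the middle vertices, and the neighbourhood of the third triangle vertex is already hit. After each
  first move of Maker, Breaker's reply leaves edges that contain one and the same pair.
\<close>

lemma loop_game_lost:
  assumes "distinct [b1, b2, b3, h1, h3]"
  shows "\<not> maker_wins {b1, b2, b3, h1, h3} {{h1, h3}, {b1, b3, h1}, {b1, b2, h3}} {} {}" (is "\<not> maker_wins ?V ?H {} {}")
proof (rule maker_loses_reply)
  note d = assms[simplified]
  show "2 \<le> card e" if "e \<in> ?H" for e using that d by auto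
  have r: "\<not> maker_wins ?V ?H {a} {b}" if "{a, b, x, y} \<subseteq> ?V" "distinct [a, b, x, y]"
    "\<And>e. e \<in> ?H \<Longrightarrow> b \<in> e \<or> {x, y} \<subseteq> e" for a b x y
    by (rule maker_loses_pairing[where Ps = "{{x, y}}"]) (use that in auto)
  have "\<not> maker_wins ?V ?H {b1} {h1}" by (rule r[where x = b2 and y = h3]) (use d in auto)
  moreover have "\<not> maker_wins ?V ?H {b2} {b1}" by (rule r[where x = h1 and y = h3]) (use d in auto)
  moreover have "\<not> maker_wins ?V ?H {b3} {b1}" by (rule r[where x = h1 and y = h3]) (use d in auto)
  moreover have "\<not> maker_wins ?V ?H {h1} {h3}" by (rule r[where x = b1 and y = b3]) (use d in auto)
  moreover have "\<not> maker_wins ?V ?H {h3} {h1}" by (rule r[where x = b1 and y = b2]) (use d in auto)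
  ultimately show "\<exists>b \<in> ?V - {a}. \<not> maker_wins ?V ?H {a} {b}" if "a \<in> ?V" for a using that d by auto
qed

text \<open>
  As before, but at the end of a bridge whose diamond has been hit only at its far port, so that the third
  triangle vertex still has a live neighbourhood. After Breaker's reply every edge that he has not hit contains one of
  two disjoint pairs.
\<close>

lemma bridge_loop_game_lost:
  assumes "distinct [w1, w2, w3, h3, m1, m3]"
  shows "\<not> maker_wins {w1, w2, w3, h3, m1, m3} {{w2, w3, h3}, {w1, w3, m1}, {w1, w2, m3}, {m1, m3}} {} {}"
    (is "\<not> maker_wins ?V ?H {} {}")
proof (rule maker_loses_reply)
  note d = assms[simplified]
  show "2 \<le> card e" if "e \<in> ?H" for e using that d by auto
  have r: "\<not> maker_wins ?V ?H {a} {b}" if "{a, b, x, y, z, w} \<subseteq> ?V" "distinct [a, b, x, y, z, w]"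
    and hit: "\<And>e. e \<in> ?H \<Longrightarrow> b \<in> e \<or> {x, y} \<subseteq> e \<or> {z, w} \<subseteq> e" for a b x y z w
  proof (rule maker_loses_pairing[where Ps = "{{x, y}, {z, w}}"])
    have dd: "x \<noteq> y" "z \<noteq> w" "{x, y} \<inter> {z, w} = {}" "b \<noteq> a" "{x, y, z, w} \<inter> {a, b} = {}" using that(2) by auto
    show "\<exists>u v. P = {u, v} \<and> u \<noteq> v" if "P \<in> {{x, y}, {z, w}}" for P using that dd(1,2) by blast
    show "disjoint {{x, y}, {z, w}}" unfolding disjoint_def using dd(3) by blast
    show "\<Union>{{x, y}, {z, w}} \<subseteq> ?V" using that(1) by blast
    show "\<Union>{{x, y}, {z, w}} \<inter> ({a} \<union> {b}) = {}" using dd(5) by blast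
    show "e \<inter> {b} - {a} \<noteq> {} \<or> (\<exists>P \<in> {{x, y}, {z, w}}. P \<subseteq> e)" if "e \<in> ?H" for e
      using hit[OF that] dd(4) by blast
  qed
  have "\<not> maker_wins ?V ?H {w1} {m1}" by (rule r[where x = w2 and y = m3 and z = w3 and w = h3]) (use d in auto)
  moreover have "\<not> maker_wins ?V ?H {w2} {m3}" by (rule r[where x = w3 and y = h3 and z = w1 and w = m1]) (use d in auto)
  moreover have "\<not> maker_wins ?V ?H {w3} {m1}" by (rule r[where x = w2 and y = h3 and z = w1 and w = m3]) (use d in auto)
  moreover have "\<not> maker_wins ?V ?H {h3} {w2}" by (rule r[where x = w1 and y = w3 and z = m1 and w = m3]) (use d in auto)
  moreover have "\<not> maker_wins ?V ?H {m1} {m3}" by (rule r[where x = w1 and y = w3 and z = w2 and w = h3]) (use d in auto)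
  moreover have "\<not> maker_wins ?V ?H {m3} {m1}" by (rule r[where x = w1 and y = w2 and z = w3 and w = h3]) (use d in auto)
  ultimately show "\<exists>b \<in> ?V - {a}. \<not> maker_wins ?V ?H {a} {b}" if "a \<in> ?V" for a using that d by auto
qed

lemma pair_game_lost: "a \<noteq> b \<Longrightarrow> \<not> maker_wins {a, b} {{a, b}} {} {}"
  by (rule maker_loses_pairing[where Ps = "{{a, b}}"]) auto

lemma maker_loses_after:
  assumes "d \<in> V" "\<not> maker_wins V H {} {d}" "{} \<notin> H"
  shows "\<not> maker_wins_after V H {} {}"
  using assms by (auto simp: maker_wins_after_def)

context
  notes One_nat_def [simp del]
begin

lemma nat_ranges: "{1..3} = {1, 2, 3::nat}" "{1..4} = {1, 2, 3, 4::nat}"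
  by auto

lemma eta_verts: "pverts eta =
    {eY 1, eY 2, eY 3, eW 1, eW 2, eW 3, eH 1, eH 2, eH 3, eH 4, eK 1, eK 2, eK 3, eK 4, eM 1, eM 2, eM 3, eM 4}"
  unfolding eta_def undirected_graph_def nat_ranges by simp blast

lemma eta_nbhd:
  "open_nbhd eta (eY 1) = {eY 2, eY 3, eH 1}" "open_nbhd eta (eY 2) = {eY 1, eY 3, eK 1}" "open_nbhd eta (eY 3) = {eY 1, eY 2, eK 3}"
  "open_nbhd eta (eW 1) = {eW 2, eW 3, eH 3}" "open_nbhd eta (eW 2) = {eW 1, eW 3, eM 1}" "open_nbhd eta (eW 3) = {eW 1, eW 2, eM 3}"
  "open_nbhd eta (eH 1) = {eH 2, eH 4, eY 1}" "open_nbhd eta (eH 2) = {eH 1, eH 3, eH 4}"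
  "open_nbhd eta (eH 3) = {eH 2, eH 4, eW 1}" "open_nbhd eta (eH 4) = {eH 1, eH 3, eH 2}"
  "open_nbhd eta (eK 1) = {eK 2, eK 4, eY 2}" "open_nbhd eta (eK 2) = {eK 1, eK 3, eK 4}"
  "open_nbhd eta (eK 3) = {eK 2, eK 4, eY 3}" "open_nbhd eta (eK 4) = {eK 1, eK 3, eK 2}"
  "open_nbhd eta (eM 1) = {eM 2, eM 4, eW 2}" "open_nbhd eta (eM 2) = {eM 1, eM 3, eM 4}"
  "open_nbhd eta (eM 3) = {eM 2, eM 4, eW 3}" "open_nbhd eta (eM 4) = {eM 1, eM 3, eM 2}"
  unfolding open_nbhd_def eta_def undirected_graph_def triangle_edges_def diamond_edges_def by auto

text \<open>
  Dominator starts at \<open>h\<^sub>1\<close>. This hits the neighbourhoods of \<open>y\<^sub>1\<close>, \<open>h\<^sub>2\<close>, \<open>h\<^sub>4\<close>; the others contain edges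
  of the two loop games at the triangles \<open>Y\<close> and \<open>W\<close> and of three pairs of middle vertices.
\<close>

lemma eta_breaker_wins: "\<not> maker_wins_after (pverts eta) (winning_sets eta) {} {}"
proof (rule maker_loses_after[of "eH 1"])
  let ?Y = "({eY 1, eY 2, eY 3, eK 1, eK 3}, {{eK 1, eK 3}, {eY 1, eY 3, eK 1}, {eY 1, eY 2, eK 3}})"
  let ?W = "({eW 1, eW 2, eW 3, eH 3, eM 1, eM 3}, {{eW 2, eW 3, eH 3}, {eW 1, eW 3, eM 1}, {eW 1, eW 2, eM 3}, {eM 1, eM 3}})"
  let ?I = "{({eH 2, eH 4}, {{eH 2, eH 4}}), ({eK 2, eK 4}, {{eK 2, eK 4}}), ({eM 2, eM 4}, {{eM 2, eM 4}}), ?Y, ?W}"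
  show "\<not> maker_wins (pverts eta) (winning_sets eta) {} {eH 1}"
  proof (rule maker_loses_sum[where I = ?I and X = fst and E = snd])
    fix i assume i: "i \<in> ?I"
    have "\<not> maker_wins (fst i) (snd i) {} {}"
      using i loop_game_lost[of "eY 1" "eY 2" "eY 3" "eK 1" "eK 3"]
        bridge_loop_game_lost[of "eW 1" "eW 2" "eW 3" "eH 3" "eM 1" "eM 3"]
        pair_game_lost[of "eH 2" "eH 4"] pair_game_lost[of "eK 2" "eK 4"] pair_game_lost[of "eM 2" "eM 4"] by auto
    moreover have "{eH 1} \<inter> fst i = {}" using i by auto
    ultimately show "\<not> maker_wins (fst i) (snd i) ({} \<inter> fst i) ({eH 1} \<inter> fst i)" by simp
  next
    show "fst i \<subseteq> pverts eta" if "i \<in> ?I" for i using that by (auto simp: eta_verts)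
    show "disjoint_family_on fst ?I" by (auto simp: disjoint_family_on_def)
    show "e \<subseteq> fst i" if "i \<in> ?I" "e \<in> snd i" for i e using that by auto
    fix e assume "e \<in> winning_sets eta"
    then obtain v where "v \<in> pverts eta" "e = open_nbhd eta v" by blast
    then show "e \<inter> {eH 1} - {} \<noteq> {} \<or> (\<exists>i \<in> ?I. \<exists>f \<in> snd i. f \<subseteq> e)"
      unfolding eta_verts by (elim insertE) (simp_all add: eta_nbhd)
  qed
  show "eH 1 \<in> pverts eta" by (simp add: eta_verts)
  have "open_nbhd eta v \<noteq> {}" if "v \<in> pverts eta" for v
    using that unfolding eta_verts by (elim insertE) (simp_all add: eta_nbhd)
  then show "{} \<notin> winning_sets eta" by auto
qed

lemma omega_verts: "pverts (omega k) =
    {oA 1, oA 2, oA 3, oB 1, oB 2, oB 3, oH 1, oH 2, oH 3, oH 4} \<union>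
    (\<Union>i \<in> {1..k}. {oZ i 1, oZ i 2, oZ i 3, oZ i 4})"
  unfolding omega_def undirected_graph_def nat_ranges by simp blast

lemma omega_nbhd:
  assumes "k \<ge> 1"
  shows "open_nbhd (omega k) (oA 1) = {oA 2, oA 3, oB 1}" "open_nbhd (omega k) (oA 2) = {oA 1, oA 3, oZ 1 1}"
    "open_nbhd (omega k) (oA 3) = {oA 1, oA 2, oZ k 3}"
    "open_nbhd (omega k) (oB 1) = {oB 2, oB 3, oA 1}" "open_nbhd (omega k) (oB 2) = {oB 1, oB 3, oH 1}"
    "open_nbhd (omega k) (oB 3) = {oB 1, oB 2, oH 3}"
    "open_nbhd (omega k) (oH 1) = {oH 2, oH 4, oB 2}" "open_nbhd (omega k) (oH 2) = {oH 1, oH 3, oH 4}"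
    "open_nbhd (omega k) (oH 3) = {oH 2, oH 4, oB 3}" "open_nbhd (omega k) (oH 4) = {oH 1, oH 3, oH 2}"
    "i \<in> {1..k} \<Longrightarrow> open_nbhd (omega k) (oZ i 1) = {oZ i 2, oZ i 4, if i = 1 then oA 2 else oZ (i - 1) 3}"
    "i \<in> {1..k} \<Longrightarrow> open_nbhd (omega k) (oZ i 2) = {oZ i 1, oZ i 3, oZ i 4}"
    "i \<in> {1..k} \<Longrightarrow> open_nbhd (omega k) (oZ i 3) = {oZ i 2, oZ i 4, if i = k then oA 3 else oZ (i + 1) 1}"
    "i \<in> {1..k} \<Longrightarrow> open_nbhd (omega k) (oZ i 4) = {oZ i 1, oZ i 3, oZ i 2}"
  using assms unfolding open_nbhd_def omega_def undirected_graph_def triangle_edges_def diamond_edges_def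
  by (auto simp: le_Suc_eq)

text \<open>
  Dominator starts at \<open>a\<^sub>1\<close>. The other neighbourhoods contain edges of the loop game at the triangle \<open>B\<close>, or
  one of the pairs \<open>{a\<^sub>2, a\<^sub>3}\<close>, \<open>{h\<^sub>2, h\<^sub>4}\<close>, and in each diamond of the long chain the two pairs of
  opposite vertices.
\<close>

lemma omega_breaker_wins:
  assumes k: "k \<ge> 1"
  shows "\<not> maker_wins_after (pverts (omega k)) (winning_sets (omega k)) {} {}"
proof (rule maker_loses_after[of "oA 1"])
  let ?B = "({oB 1, oB 2, oB 3, oH 1, oH 3}, {{oH 1, oH 3}, {oB 1, oB 3, oH 1}, {oB 1, oB 2, oH 3}})"
  let ?Z = "\<lambda>i. {({oZ i 1, oZ i 3}, {{oZ i 1, oZ i 3}}), ({oZ i 2, oZ i 4}, {{oZ i 2, oZ i 4}})}"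
  let ?I = "{?B, ({oA 2, oA 3}, {{oA 2, oA 3}}), ({oH 2, oH 4}, {{oH 2, oH 4}})} \<union> (\<Union>i \<in> {1..k}. ?Z i)"
  show "\<not> maker_wins (pverts (omega k)) (winning_sets (omega k)) {} {oA 1}"
  proof (rule maker_loses_sum[where I = ?I and X = fst and E = snd])
    have zgame: "\<not> maker_wins {oZ j 1, oZ j 3} {{oZ j 1, oZ j 3}} {} {}" "\<not> maker_wins {oZ j 2, oZ j 4} {{oZ j 2, oZ j 4}} {} {}" for j
      by (rule pair_game_lost; simp)+
    fix i assume i: "i \<in> ?I"
    have "\<not> maker_wins (fst i) (snd i) {} {}"
      using i loop_game_lost[of "oB 1" "oB 2" "oB 3" "oH 1" "oH 3"] pair_game_lost[of "oA 2" "oA 3"] pair_game_lost[of "oH 2" "oH 4"]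
        zgame by auto
    moreover have "{oA 1} \<inter> fst i = {}" using i by auto
    ultimately show "\<not> maker_wins (fst i) (snd i) ({} \<inter> fst i) ({oA 1} \<inter> fst i)" by simp
  next
    show "fst i \<subseteq> pverts (omega k)" if "i \<in> ?I" for i using that by (auto simp: omega_verts)
    show "disjoint_family_on fst ?I" by (auto simp: disjoint_family_on_def)
    show "e \<subseteq> fst i" if "i \<in> ?I" "e \<in> snd i" for i e using that by auto
    fix e assume "e \<in> winning_sets (omega k)"
    then obtain v where v: "v \<in> pverts (omega k)" "e = open_nbhd (omega k) v" by blast
    then consider "v \<in> {oA 1, oA 2, oA 3, oB 1, oB 2, oB 3, oH 1, oH 2, oH 3, oH 4}"
      | i where "i \<in> {1..k}" "v \<in> {oZ i 1, oZ i 3}" | i where "i \<in> {1..k}" "v \<in> {oZ i 2, oZ i 4}"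
      unfolding omega_verts by blast
    then show "e \<inter> {oA 1} - {} \<noteq> {} \<or> (\<exists>i \<in> ?I. \<exists>f \<in> snd i. f \<subseteq> e)"
    proof cases
      case 1 then show ?thesis unfolding v(2) by (elim insertE) (simp_all add: omega_nbhd[OF k])
    next
      case (2 i)
      then have "{oZ i 2, oZ i 4} \<subseteq> e" using v(2) by (auto simp: omega_nbhd[OF k])
      moreover have "({oZ i 2, oZ i 4}, {{oZ i 2, oZ i 4}}) \<in> ?I" by (rule UnI2, rule UN_I[OF 2(1)]) simp
      ultimately show ?thesis by (metis (no_types, lifting) insertI1 snd_conv)
    next
      case (3 i)
      then have "{oZ i 1, oZ i 3} \<subseteq> e" using v(2) by (auto simp: omega_nbhd[OF k])
      moreover have "({oZ i 1, oZ i 3}, {{oZ i 1, oZ i 3}}) \<in> ?I" by (rule UnI2, rule UN_I[OF 3(1)]) simp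
      ultimately show ?thesis by (metis (no_types, lifting) insertI1 snd_conv)
    qed
  qed
  show "oA 1 \<in> pverts (omega k)" by (simp add: omega_verts)
  have "open_nbhd (omega k) v \<noteq> {}" if "v \<in> pverts (omega k)" for v
    using that unfolding omega_verts by (auto simp: omega_nbhd[OF k])
  then show "{} \<notin> winning_sets (omega k)" by auto
qed

end

subsection \<open>Isomorphic graphs\<close>

lemma maker_wins_image:
  assumes "maker_wins V H A B" "inj_on f V" "H \<subseteq> Pow V" "A \<subseteq> V" "B \<subseteq> V"
  shows "maker_wins (f ` V) ((`) f ` H) (f ` A) (f ` B)"
  using assms
proof (induction rule: maker_wins.induct)
  case (won e A B)
  then show ?case by (intro maker_wins.won[of "f ` e"]) auto
next
  case (finish e x A B)
  have "f x \<in> f ` V - (f ` A \<union> f ` B)"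
    using finish.hyps(3) finish.prems by (auto dest: inj_onD)
  moreover have "f ` e \<subseteq> insert (f x) (f ` A)" using finish.hyps(2) by auto
  ultimately show ?case using finish.hyps(1) by (intro maker_wins.finish[of "f ` e" _ "f x"]) auto
next
  case (move a A B)
  have a: "f a \<in> f ` V - (f ` A \<union> f ` B)" using move.hyps(1) move.prems by (auto dest: inj_onD)
  have out: "b \<in> V - (insert a A \<union> B)" if "b \<in> V" "f b \<notin> insert (f a) (f ` A) \<union> f ` B" for b
    using that by auto
  obtain c where c: "c \<in> V - (insert a A \<union> B)" using move.hyps(2) by blast
  then have "f c \<in> f ` V - (insert (f a) (f ` A) \<union> f ` B)"
    using move.hyps(1) move.prems by (auto dest: inj_onD)
  then show ?case
  proof (intro maker_wins.move[OF a])
    fix b' assume "b' \<in> f ` V - (insert (f a) (f ` A) \<union> f ` B)"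
    then obtain b where b: "b' = f b" "b \<in> V - (insert a A \<union> B)" using out by blast
    have "maker_wins (f ` V) ((`) f ` H) (f ` insert a A) (f ` insert b B)"
      using move.IH[OF b(2)] move.prems move.hyps(1) b by auto
    then show "maker_wins (f ` V) ((`) f ` H) (insert (f a) (f ` A)) (insert b' (f ` B))" using b by simp
  qed auto
qed

lemma iso_nbhd:
  assumes "digraph_iso (with_proj G) (with_proj E)" and wf: "pair_wf_digraph G"
  obtains f where "inj_on f (pverts G)" "pverts E = f ` pverts G"
    "\<And>v. v \<in> pverts G \<Longrightarrow> open_nbhd E (f v) = f ` open_nbhd G v"
proof -
  obtain I where I: "pre_digraph.digraph_isomorphism (with_proj G) I" "with_proj E = app_iso I (with_proj G)"
    using assms(1) by (auto simp: digraph_iso_def)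
  let ?f = "iso_verts I"
  have V: "pverts E = ?f ` pverts G" and A: "parcs E = iso_arcs I ` parcs G" and "iso_tail I = fst" "iso_head I = snd"
    using arg_cong[OF I(2), of verts] arg_cong[OF I(2), of arcs] arg_cong[OF I(2), of tail] arg_cong[OF I(2), of head]
    by (auto simp: app_iso_def with_proj_def)
  then have arc: "iso_arcs I (u, v) = (?f u, ?f v)" if "(u, v) \<in> parcs G" for u v
    using I(1) that by (auto simp: pre_digraph.digraph_isomorphism_def with_proj_def prod_eq_iff)
  have inj: "inj_on ?f (pverts G)" using I(1) by (auto simp: pre_digraph.digraph_isomorphism_def with_proj_def)
  interpret pair_wf_digraph G by fact
  have "open_nbhd E (?f v) = ?f ` open_nbhd G v" if v: "v \<in> pverts G" for v
  proof
    show "?f ` open_nbhd G v \<subseteq> open_nbhd E (?f v)" using A arc by (force simp: open_nbhd_def)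
    show "open_nbhd E (?f v) \<subseteq> ?f ` open_nbhd G v"
    proof
      fix w assume "w \<in> open_nbhd E (?f v)"
      then have "(?f v, w) \<in> iso_arcs I ` parcs G" using A by (simp add: open_nbhd_def)
      then obtain a b where ab: "(a, b) \<in> parcs G" "(?f v, w) = iso_arcs I (a, b)" by auto
      then have "?f v = ?f a" "w = ?f b" using arc by auto
      then show "w \<in> ?f ` open_nbhd G v"
        using inj_onD[OF inj, of v a] v ab(1) in_arcsD1 by (auto simp: open_nbhd_def)
    qed
  qed
  then show ?thesis using that inj V by blast
qed

text \<open>
  An injective image of a won position is won, so a win of Staller on \<open>G\<close> would be one on \<open>E\<close>.
\<close>

lemma dominator_wins_if_iso:
  assumes iso: "digraph_iso (with_proj G) (with_proj E)" and wf: "pair_wf_digraph G"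
    and E: "\<not> maker_wins_after (pverts E) (winning_sets E) {} {}"
  shows "wins_MBTD G Dominator Dominator"
proof (rule dominator_strategy)
  obtain f where f: "inj_on f (pverts G)" "pverts E = f ` pverts G"
    "\<And>v. v \<in> pverts G \<Longrightarrow> open_nbhd E (f v) = f ` open_nbhd G v"
    using iso_nbhd[OF iso wf] by blast
  have H: "winning_sets E = (`) f ` winning_sets G" unfolding f(2) image_image using f(3) by (intro image_cong) auto
  have sub: "winning_sets G \<subseteq> Pow (pverts G)"
    using pair_wf_digraph.arc_snd_in_verts[OF wf] by (fastforce simp: open_nbhd_def)
  show "\<not> maker_wins_after (pverts G) (winning_sets G) {} {}"
  proof
    assume "maker_wins_after (pverts G) (winning_sets G) {} {}"
    then consider "{} \<in> winning_sets G"
      | "pverts G \<noteq> {}" "\<And>b. b \<in> pverts G \<Longrightarrow> maker_wins (pverts G) (winning_sets G) {} {b}"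
      by (auto simp: maker_wins_after_def)
    then have "maker_wins_after (pverts E) (winning_sets E) {} {}"
    proof cases
      case 1
      then have "{} \<in> winning_sets E" unfolding H by (metis image_empty image_eqI)
      then show ?thesis unfolding maker_wins_after_def by blast
    next
      case 2
      have "maker_wins (pverts E) (winning_sets E) {} {b}" if "b \<in> pverts E" for b
      proof -
        obtain c where c: "c \<in> pverts G" "b = f c" using \<open>b \<in> pverts E\<close> f(2) by blast
        have "maker_wins (f ` pverts G) ((`) f ` winning_sets G) {} {f c}"
          using maker_wins_image[OF 2(2)[OF c(1)] f(1) sub] c(1) by simp
        then show ?thesis unfolding f(2)[symmetric] H c(2) .
      qed
      then show ?thesis using 2(1) f(2) by (auto simp: maker_wins_after_def)
    qed
    then show False using E by blast
  qed
qed

text \<open>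
  For simple graphs a bijection of vertices that respects open neighbourhoods is an isomorphism, the arcs being
  mapped componentwise.
\<close>

lemma iso_if_nbhd:
  assumes G: "pair_wf_digraph G" and E: "pair_wf_digraph E"
    and f: "inj_on f (pverts E)" "f ` pverts E = pverts G"
    and N: "\<And>v. v \<in> pverts E \<Longrightarrow> open_nbhd G (f v) = f ` open_nbhd E v"
  shows "digraph_iso (with_proj G) (with_proj E)"
proof (rule digraph_iso_swap)
  interpret E: pair_wf_digraph E by fact
  interpret G: pair_wf_digraph G by fact
  show "wf_digraph (with_proj E)" using E wf_digraph_wp_iff by blast
  let ?I = "\<lparr>iso_verts = f, iso_arcs = map_prod f f, iso_head = snd, iso_tail = fst\<rparr>"
  have arcs: "parcs G = map_prod f f ` parcs E"
  proof
    show "map_prod f f ` parcs E \<subseteq> parcs G"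
      using N E.in_arcsD1 by (force simp: open_nbhd_def)
    show "parcs G \<subseteq> map_prod f f ` parcs E"
    proof
      fix e assume e: "e \<in> parcs G"
      then obtain u v where uv: "e = (f u, v)" "u \<in> pverts E" using G.in_arcsD1 f(2) by (cases e) blast
      then have "v \<in> f ` open_nbhd E u" using N[OF uv(2)] e by (auto simp: open_nbhd_def)
      then show "e \<in> map_prod f f ` parcs E" using uv by (force simp: open_nbhd_def)
    qed
  qed
  have "inj_on (map_prod f f) (parcs E)"
    by (rule inj_on_subset[OF map_prod_inj_on[OF f(1) f(1)]]) (auto dest: E.in_arcsD1 E.in_arcsD2)
  then have "pre_digraph.digraph_isomorphism (with_proj E) ?I"
    using f(1) \<open>wf_digraph (with_proj E)\<close> by (auto simp: pre_digraph.digraph_isomorphism_def with_proj_def)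
  moreover have "with_proj G = app_iso ?I (with_proj E)"
    using arcs f(2) by (simp add: app_iso_def with_proj_def)
  ultimately show "digraph_iso (with_proj E) (with_proj G)" by (auto simp: digraph_iso_def)
qed

lemma undirected_wf: "E \<subseteq> W \<times> W \<Longrightarrow> pair_wf_digraph (undirected_graph W E)"
  by unfold_locales (auto simp: undirected_graph_def)

lemma eta_wf: "pair_wf_digraph eta"
  unfolding eta_def triangle_edges_def diamond_edges_def
  by (rule undirected_wf) (simp add: image_iff)

lemma omega_wf: "k \<ge> 1 \<Longrightarrow> pair_wf_digraph (omega k)"
  unfolding omega_def triangle_edges_def diamond_edges_def
  by (rule undirected_wf, intro Un_least) (auto simp: image_iff)

section \<open>The triangles and diamonds of a partitioned cubic graph\<close>

definition triangle_labelling :: "'a pair_pre_digraph \<Rightarrow> 'a set \<Rightarrow> 'a \<Rightarrow> 'a \<Rightarrow> 'a \<Rightarrow> bool" where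
  "triangle_labelling G X t1 t2 t3 \<longleftrightarrow> distinct [t1, t2, t3] \<and> X = {t1, t2, t3} \<and>
     (\<forall>u \<in> X. \<forall>v \<in> X. u \<noteq> v \<longrightarrow> (u, v) \<in> parcs G)"

definition diamond_labelling :: "'a pair_pre_digraph \<Rightarrow> 'a set \<Rightarrow> 'a \<Rightarrow> 'a \<Rightarrow> 'a \<Rightarrow> 'a \<Rightarrow> bool" where
  "diamond_labelling G X z1 z2 z3 z4 \<longleftrightarrow> distinct [z1, z2, z3, z4] \<and> X = {z1, z2, z3, z4} \<and>
     (\<forall>u \<in> X. \<forall>v \<in> X. (u, v) \<in> parcs G \<longleftrightarrow> u \<noteq> v \<and> {u, v} \<noteq> {z1, z3})"

lemma triangle_labelling_exists:
  assumes "is_triangle G X"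
  shows "\<exists>t1 t2 t3. triangle_labelling G X t1 t2 t3"
proof -
  let ?X = "\<lparr>pverts = X, parcs = {e \<in> parcs G. fst e \<in> X \<and> snd e \<in> X}\<rparr>"
  have eq: "with_proj G \<restriction> X = with_proj ?X" by (simp add: induce_subgraph_def with_proj_def)
  have "complete_digraph 3 (with_proj ?X)" using assms unfolding is_triangle_def eq by (elim conjE)
  then have c: "card X = 3" and a: "{e \<in> parcs G. fst e \<in> X \<and> snd e \<in> X} = {(u, v). (u, v) \<in> X \<times> X \<and> u \<noteq> v}"
    unfolding complete_digraph_pair_def by simp_all
  from a have "(u, v) \<in> parcs G" if "u \<in> X" "v \<in> X" "u \<noteq> v" for u v
    using that by blast
  moreover obtain t1 t2 t3 where "X = {t1, t2, t3}" "t1 \<noteq> t2" "t1 \<noteq> t3" "t2 \<noteq> t3"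
    using c by (auto simp: card_3_iff)
  ultimately have "triangle_labelling G X t1 t2 t3" by (simp add: triangle_labelling_def)
  then show ?thesis by blast
qed

text \<open>
  The labels are the preimages of \<open>1, \<dots>, 4\<close> under an isomorphism onto the standard diamond; only \<open>z1\<close> and \<open>z3\<close> are not
  adjacent.
\<close>

lemma diamond_labelling_exists:
  assumes "is_diamond G X"
  shows "\<exists>z1 z2 z3 z4. diamond_labelling G X z1 z2 z3 z4"
proof -
  let ?X = "with_proj G \<restriction> X"
  obtain I where I: "pre_digraph.digraph_isomorphism ?X I" "with_proj diamond_graph = app_iso I ?X"
    using assms by (auto simp: is_diamond_def digraph_iso_def)
  let ?f = "iso_verts I"
  have fX: "?f ` X = {1..4}" and arcs: "iso_arcs I ` {e \<in> parcs G. fst e \<in> X \<and> snd e \<in> X} = parcs diamond_graph"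
    and "iso_tail I = fst" "iso_head I = snd"
    using arg_cong[OF I(2), of verts] arg_cong[OF I(2), of arcs] arg_cong[OF I(2), of tail] arg_cong[OF I(2), of head]
    by (simp_all add: app_iso_def with_proj_def diamond_graph_def undirected_graph_def induce_subgraph_def)
  then have arc: "iso_arcs I (u, v) = (?f u, ?f v)" if "(u, v) \<in> parcs G" "u \<in> X" "v \<in> X" for u v
    using I(1) that by (auto simp: pre_digraph.digraph_isomorphism_def with_proj_def induce_subgraph_def prod_eq_iff)
  have inj: "inj_on ?f X" using I(1) by (auto simp: pre_digraph.digraph_isomorphism_def)
  have adj: "(u, v) \<in> parcs G \<longleftrightarrow> (?f u, ?f v) \<in> parcs diamond_graph" if uv: "u \<in> X" "v \<in> X" for u v
  proof
    assume "(u, v) \<in> parcs G"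
    then have "iso_arcs I (u, v) \<in> parcs diamond_graph" using arcs uv by force
    then show "(?f u, ?f v) \<in> parcs diamond_graph" using arc uv \<open>(u, v) \<in> parcs G\<close> by simp
  next
    assume "(?f u, ?f v) \<in> parcs diamond_graph"
    then have "(?f u, ?f v) \<in> iso_arcs I ` {e \<in> parcs G. fst e \<in> X \<and> snd e \<in> X}" unfolding arcs .
    then obtain e where e: "e \<in> parcs G" "fst e \<in> X" "snd e \<in> X" "iso_arcs I e = (?f u, ?f v)" by fastforce
    then have "?f (fst e) = ?f u" "?f (snd e) = ?f v" using arc[of "fst e" "snd e"] by auto
    then have "fst e = u" "snd e = v" using inj_onD[OF inj] e uv by metis+
    then show "(u, v) \<in> parcs G" using e by (cases e) simp
  qed
  have ex: "\<exists>z \<in> X. ?f z = i" if "i \<in> {1..4}" for i using that unfolding fX[symmetric] by blast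
  obtain z1 where z1: "z1 \<in> X" "?f z1 = 1" using ex[of 1] by auto
  obtain z2 where z2: "z2 \<in> X" "?f z2 = 2" using ex[of 2] by auto
  obtain z3 where z3: "z3 \<in> X" "?f z3 = 3" using ex[of 3] by auto
  obtain z4 where z4: "z4 \<in> X" "?f z4 = 4" using ex[of 4] by auto
  note z = z1 z2 z3 z4
  have d: "distinct [z1, z2, z3, z4]" using z by auto
  have X: "X = {z1, z2, z3, z4}"
  proof
    show "X \<subseteq> {z1, z2, z3, z4}"
    proof
      fix x assume x: "x \<in> X"
      then have "?f x \<in> {1..4}" using fX by blast
      then have "?f x = 1 \<or> ?f x = 2 \<or> ?f x = 3 \<or> ?f x = 4" by auto
      then show "x \<in> {z1, z2, z3, z4}" using inj_onD[OF inj _ x] z by (metis insertCI)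
    qed
  qed (use z in blast)
  have dg: "parcs diamond_graph = {(1,2),(2,3),(3,4),(4,1),(2,4),(2,1),(3,2),(4,3),(1,4),(4,2)}"
    unfolding diamond_graph_def undirected_graph_def diamond_edges_def by auto
  have "(u, v) \<in> parcs G \<longleftrightarrow> u \<noteq> v \<and> {u, v} \<noteq> {z1, z3}" if "u \<in> X" "v \<in> X" for u v
  proof -
    have "u = z1 \<or> u = z2 \<or> u = z3 \<or> u = z4" "v = z1 \<or> v = z2 \<or> v = z3 \<or> v = z4" using that X by auto
    then show ?thesis unfolding adj[OF that] dg using d z by (elim disjE) (auto simp: doubleton_eq_iff)
  qed
  then have "diamond_labelling G X z1 z2 z3 z4" using d X by (simp only: diamond_labelling_def simp_thms) blast
  then show ?thesis by blast
qed

text \<open>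
  A set closed under neighbours contains everything reachable from it.
\<close>

lemma connected_closed:
  assumes "pair_graph G" "connected (with_proj G)"
    and S: "S \<subseteq> pverts G" "S \<noteq> {}" "\<And>v. v \<in> S \<Longrightarrow> open_nbhd G v \<subseteq> S"
  shows "S = pverts G"
proof
  interpret pair_graph G by fact
  obtain s where s: "s \<in> S" using S by blast
  show "pverts G \<subseteq> S"
  proof
    fix v assume v: "v \<in> pverts G"
    have "s \<rightarrow>\<^sup>*\<^bsub>with_proj (mk_symmetric (with_proj G))\<^esub> v"
      using assms(2) s S v unfolding connected_def strongly_connected_def by auto
    then have "(s, v) \<in> rtrancl_on (pverts G) (parcs (mk_symmetric (with_proj G)))"
      by (simp add: reachable_def)
    then show "v \<in> S"
    proof (induction rule: rtrancl_on_induct)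
      case (step y z)
      then have "(y, z) \<in> parcs G \<or> (z, y) \<in> parcs G"
        by (auto simp: parcs_mk_symmetric with_proj_def)
      moreover have "sym (parcs G)" using pair_sym_arcs unfolding symmetric_def by simp
      ultimately have "(y, z) \<in> parcs G" by (auto dest: symD)
      then show ?case using S(3)[OF step.IH] by (auto simp: open_nbhd_def)
    qed (use s in simp)
  qed
qed (use S in blast)

text \<open>
  With labels fixed in every block of the partition, a vertex of a triangle and a vertex of degree two in a diamond
  have two neighbours in their block, hence exactly one outside, which defines \<open>mu\<close>. The middle vertices of a
  diamond have all their neighbours inside, so the outer neighbour of a port is again a port.
\<close>

lemma triangle_diamond_structure:
  assumes G: "pair_graph G" "connected (with_proj G)" "cubic G" and part: "triangle_diamond_partition G P"
  shows "\<exists>Tp Dp rot mu opp m1 m2. triangle_diamond_graph (pverts G) (open_nbhd G) Tp Dp rot mu opp m1 m2"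
proof -
  interpret pair_graph G by fact
  let ?V = "pverts G" and ?N = "open_nbhd G"
  have sym: "sym (parcs G)" using pair_sym_arcs unfolding symmetric_def by simp
  have N_sym: "u \<in> ?N v \<longleftrightarrow> v \<in> ?N u" for u v using sym by (auto simp: open_nbhd_def dest: symD)
  have N_irr: "v \<notin> ?N v" for v using pair_no_loops by (force simp: open_nbhd_def)
  have N_V: "?N v \<subseteq> ?V" for v using in_arcsD2 by (auto simp: open_nbhd_def)
  have N_card: "card (?N v) = 3" if "v \<in> ?V" for v using G(3) that by (simp add: cubic_def)
  have N_fin: "finite (?N v)" for v using N_V finite_subset pair_finite_verts by metis
  have P: "partition_on ?V P" "\<And>X. X \<in> P \<Longrightarrow> is_triangle G X \<or> is_diamond G X"
    "\<exists>X \<in> P. is_triangle G X" "\<exists>X \<in> P. is_diamond G X"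
    using part by (auto simp: triangle_diamond_partition_def)
  have PV: "\<Union>P = ?V" and Pd: "disjoint P" using P(1) by (auto simp: partition_on_def)
  define TT where "TT = {X \<in> P. is_triangle G X}"
  define DD where "DD = {X \<in> P. is_diamond G X}"
  have "\<forall>X \<in> TT. \<exists>t1 t2 t3. triangle_labelling G X t1 t2 t3" using triangle_labelling_exists by (auto simp: TT_def)
  then obtain t1 t2 t3 where T': "\<And>X. X \<in> TT \<Longrightarrow> triangle_labelling G X (t1 X) (t2 X) (t3 X)" by metis
  have "\<forall>X \<in> DD. \<exists>z1 z2 z3 z4. diamond_labelling G X z1 z2 z3 z4" using diamond_labelling_exists by (auto simp: DD_def)
  then obtain z1 z2 z3 z4 where D': "\<And>X. X \<in> DD \<Longrightarrow> diamond_labelling G X (z1 X) (z2 X) (z3 X) (z4 X)" by metis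
  note T = T'[unfolded triangle_labelling_def] and D = D'[unfolded diamond_labelling_def]
  have TDP: "TT \<subseteq> P" "DD \<subseteq> P" "P = TT \<union> DD" using P(2) by (auto simp: TT_def DD_def)
  define cl where "cl v = (THE X. X \<in> P \<and> v \<in> X)" for v
  have cl: "cl v = X" if "X \<in> P" "v \<in> X" for v X
    unfolding cl_def
  proof (rule the_equality)
    show "Y = X" if "Y \<in> P \<and> v \<in> Y" for Y
      using that \<open>X \<in> P\<close> \<open>v \<in> X\<close> Pd unfolding disjoint_def by blast
  qed (use that in blast)
  have T3: "card X = 3" if "X \<in> TT" for X using T[OF that] by (metis card_3_iff distinct_length_2_or_more)
  have D4: "card X = 4" if "X \<in> DD" for X
  proof -
    have "card (set [z1 X, z2 X, z3 X, z4 X]) = 4" using D[OF that] distinct_card[of "[z1 X, z2 X, z3 X, z4 X]"] by simp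
    then show ?thesis using D[OF that] by simp
  qed
  have TD: "X \<notin> DD" if "X \<in> TT" for X using T3[OF that] D4 by fastforce
  define Tp where "Tp = \<Union>TT"
  define Dp where "Dp = (\<Union>X \<in> DD. {z1 X, z3 X})"
  define rot where "rot v = (let X = cl v in if v = t1 X then t2 X else if v = t2 X then t3 X else t1 X)" for v
  define mu where "mu v = (THE u. u \<in> ?N v - cl v)" for v
  define opp where "opp v = (if v = z1 (cl v) then z3 (cl v) else z1 (cl v))" for v
  define m1 where "m1 v = z2 (cl v)" for v
  define m2 where "m2 v = z4 (cl v)" for v
  have clT: "cl v = X" if "X \<in> TT" "v \<in> X" for v X using cl that TDP by blast
  have clD: "cl v = X" if "X \<in> DD" "v \<in> X" for v X using cl that TDP by blast
  have inD: "z1 X \<in> X" "z2 X \<in> X" "z3 X \<in> X" "z4 X \<in> X" if "X \<in> DD" for X using D[OF that] by auto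
  have sepTD: "v \<notin> X" if "v \<in> Y" "Y \<in> TT" "X \<in> DD" for v X Y
    using that clT clD TD by metis
  have Tp_cl: "v \<in> Tp \<longleftrightarrow> v \<in> ?V \<and> cl v \<in> TT" for v
    using clT cl TDP PV unfolding Tp_def by (metis UnionE UnionI subsetD)
  have V_cl: "cl v \<in> P \<and> v \<in> cl v" if "v \<in> ?V" for v using that PV cl by (metis UnionE)
  have insideT: "?N v \<inter> cl v = {rot v, rot (rot v)}" "rot v \<noteq> v" "rot (rot v) \<noteq> v" "rot v \<noteq> rot (rot v)"
    "rot (rot (rot v)) = v" "rot v \<in> cl v" "rot (rot v) \<in> cl v" if v: "v \<in> Tp" for v
  proof -
    define X where "X = cl v"
    have X: "X \<in> TT" "v \<in> X" using v Tp_cl V_cl by (auto simp: X_def)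
    have d: "t1 X \<noteq> t2 X" "t1 X \<noteq> t3 X" "t2 X \<noteq> t3 X" "X = {t1 X, t2 X, t3 X}"
      and ad: "\<And>u w. u \<in> X \<Longrightarrow> w \<in> X \<Longrightarrow> u \<noteq> w \<Longrightarrow> (u, w) \<in> parcs G" using T[OF X(1)] by auto
    have m: "t1 X \<in> X" "t2 X \<in> X" "t3 X \<in> X" using d(4) by blast+
    have r: "rot (t1 X) = t2 X" "rot (t2 X) = t3 X" "rot (t3 X) = t1 X"
      using clT[OF X(1)] m d(1,2,3) by (simp_all add: rot_def)
    have N: "?N v \<inter> X = X - {v}" using ad N_irr X(2) by (auto simp: open_nbhd_def)
    obtain p q w where pqw: "t1 X = p" "t2 X = q" "t3 X = w" by blast
    have X3: "X = {p, q, w}" and dd: "p \<noteq> q" "p \<noteq> w" "q \<noteq> w" and rr: "rot p = q" "rot q = w" "rot w = p"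
      using d r unfolding pqw by blast+
    have "v = p \<or> v = q \<or> v = w" using X(2) X3 by blast
    then have "X - {v} = {rot v, rot (rot v)} \<and> rot v \<noteq> v \<and> rot (rot v) \<noteq> v \<and> rot v \<noteq> rot (rot v) \<and>
      rot (rot (rot v)) = v \<and> rot v \<in> X \<and> rot (rot v) \<in> X"
      unfolding X3 using dd by (elim disjE) (auto simp: rr)
    then show "?N v \<inter> cl v = {rot v, rot (rot v)}" "rot v \<noteq> v" "rot (rot v) \<noteq> v" "rot v \<noteq> rot (rot v)"
      "rot (rot (rot v)) = v" "rot v \<in> cl v" "rot (rot v) \<in> cl v"
      using N unfolding X_def by auto
  qed
  have rotT: "rot v \<in> Tp" if "v \<in> Tp" for v
    using insideT(6)[OF that] that unfolding Tp_cl
    using clT V_cl by (metis (no_types, lifting) PV TDP(1) UnionI subsetD)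
  have dia: "z1 X \<noteq> z2 X" "z1 X \<noteq> z3 X" "z1 X \<noteq> z4 X" "z2 X \<noteq> z3 X" "z2 X \<noteq> z4 X" "z3 X \<noteq> z4 X"
    "X = {z1 X, z2 X, z3 X, z4 X}" if "X \<in> DD" for X using D[OF that] by auto
  have adD: "u \<in> ?N v \<longleftrightarrow> v \<noteq> u \<and> {v, u} \<noteq> {z1 X, z3 X}" if "X \<in> DD" "v \<in> X" "u \<in> X" for u v X
    using D[OF that(1)] that(2,3) by (simp add: open_nbhd_def)
  have NX: "?N (z1 X) \<inter> X = {z2 X, z4 X}" "?N (z3 X) \<inter> X = {z2 X, z4 X}"
    "?N (z2 X) \<inter> X = {z1 X, z3 X, z4 X}" "?N (z4 X) \<inter> X = {z1 X, z3 X, z2 X}" if X: "X \<in> DD" for X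
  proof -
    obtain p q r w where pqr: "z1 X = p" "z2 X = q" "z3 X = r" "z4 X = w" by blast
    have X4: "X = {p, q, r, w}" and dd: "p \<noteq> q" "p \<noteq> r" "p \<noteq> w" "q \<noteq> r" "q \<noteq> w" "r \<noteq> w"
      using dia[OF X] unfolding pqr by blast+
    have mem: "u \<in> ?N v \<longleftrightarrow> v \<noteq> u \<and> {v, u} \<noteq> {p, r}" if "v \<in> X" "u \<in> X" for u v
      using adD[OF X that] unfolding pqr .
    show "?N (z1 X) \<inter> X = {z2 X, z4 X}" "?N (z3 X) \<inter> X = {z2 X, z4 X}"
      "?N (z2 X) \<inter> X = {z1 X, z3 X, z4 X}" "?N (z4 X) \<inter> X = {z1 X, z3 X, z2 X}"
      unfolding pqr using dd mem[unfolded X4] unfolding X4 by (auto simp: doubleton_eq_iff)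
  qed
  have N24: "?N (z2 X) = {z1 X, z3 X, z4 X}" "?N (z4 X) = {z1 X, z3 X, z2 X}" if X: "X \<in> DD" for X
  proof -
    have V: "z2 X \<in> ?V" "z4 X \<in> ?V" using inD[OF X] X TDP PV by blast+
    have "card {z1 X, z3 X, z4 X} = 3" "card {z1 X, z3 X, z2 X} = 3" using dia(1-6)[OF X] by auto
    then show "?N (z2 X) = {z1 X, z3 X, z4 X}" "?N (z4 X) = {z1 X, z3 X, z2 X}"
      using card_subset_eq[OF N_fin, of "{z1 X, z3 X, z4 X}" "z2 X"] card_subset_eq[OF N_fin, of "{z1 X, z3 X, z2 X}" "z4 X"]
        NX(3,4)[OF X] N_card[OF V(1)] N_card[OF V(2)] by auto
  qed
  have Dp_ex: "\<exists>X \<in> DD. v \<in> X \<and> cl v = X \<and> (v = z1 X \<or> v = z3 X)" if v: "v \<in> Dp" for v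
  proof -
    obtain X where X: "X \<in> DD" "v = z1 X \<or> v = z3 X" using v unfolding Dp_def by blast
    then have "v \<in> X" using inD[OF X(1)] by auto
    then show ?thesis using X clD[OF X(1)] by blast
  qed
  have portD: "opp (z1 X) = z3 X" "opp (z3 X) = z1 X" "m1 (z1 X) = z2 X" "m1 (z3 X) = z2 X" "m2 (z1 X) = z4 X" "m2 (z3 X) = z4 X"
    if X: "X \<in> DD" for X
    using clD[OF X] inD[OF X] dia(2)[OF X] by (simp_all add: opp_def m1_def m2_def)
  have two: "card (?N v \<inter> cl v) = 2" if v: "v \<in> Tp \<union> Dp" for v
  proof (cases "v \<in> Tp")
    case True then show ?thesis using insideT[OF True] by (auto simp: card_insert_if)
  next
    case False
    then obtain X where X: "X \<in> DD" "cl v = X" "v = z1 X \<or> v = z3 X" using v Dp_ex by blast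
    have "?N v \<inter> cl v = {z2 X, z4 X}" unfolding X(2) using X(3) NX(1,2)[OF X(1)] by (elim disjE) simp_all
    then show ?thesis using dia(5)[OF X(1)] by simp
  qed
  have portV: "v \<in> ?V" if "v \<in> Tp \<union> Dp" for v
    using that Tp_cl Dp_ex PV TDP(2) by (metis UnE UnionI subsetD)
  have mu_out: "?N v - cl v = {mu v}" if v: "v \<in> Tp \<union> Dp" for v
  proof -
    have "card (?N v - cl v) = 1"
      using card_Diff_subset_Int[of "?N v" "cl v"] two[OF v] N_card[OF portV[OF v]] N_fin by simp
    then obtain u where "?N v - cl v = {u}" by (auto simp: card_1_singleton_iff)
    then show ?thesis by (simp add: mu_def)
  qed
  have mu_in: "mu v \<in> ?N v" "mu v \<notin> cl v" if v: "v \<in> Tp \<union> Dp" for v using mu_out[OF v] by blast+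
  have cl_same: "cl w = cl v" if "v \<in> ?V" "w \<in> cl v" for v w using cl V_cl that by blast
  have mu_port: "mu v \<in> Tp \<union> Dp" if v: "v \<in> Tp \<union> Dp" for v
  proof -
    let ?w = "mu v"
    have w: "?w \<in> ?V" using mu_in[OF v] N_V by blast
    have vw: "v \<in> ?N ?w" using mu_in[OF v] N_sym by blast
    have vcl: "v \<notin> cl ?w" using mu_in(2)[OF v] cl_same[OF w] V_cl[OF w] by metis
    show ?thesis
    proof (cases "cl ?w \<in> TT")
      case True then show ?thesis using w Tp_cl by blast
    next
      case False
      define X where "X = cl ?w"
      have X: "X \<in> DD" "?w \<in> X" using False V_cl[OF w] TDP by (auto simp: X_def)
      have "?w \<noteq> z2 X" "?w \<noteq> z4 X" using vw vcl N24[OF X(1)] inD[OF X(1)] unfolding X_def[symmetric] by auto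
      then have "?w = z1 X \<or> ?w = z3 X" using X dia(7)[OF X(1)] by blast
      then show ?thesis using X(1) unfolding Dp_def by blast
    qed
  qed
  have mu_mu: "mu (mu v) = v" if v: "v \<in> Tp \<union> Dp" for v
  proof -
    have w: "mu v \<in> ?V" using portV[OF mu_port[OF v]] .
    have "v \<in> ?N (mu v)" using mu_in[OF v] N_sym by blast
    moreover have "v \<notin> cl (mu v)" using mu_in(2)[OF v] cl_same[OF w] V_cl[OF w] by metis
    ultimately show ?thesis using mu_out[OF mu_port[OF v]] by (metis DiffI singletonD)
  qed
  have Dp_X: "v \<in> Dp \<Longrightarrow> (\<And>X. X \<in> DD \<Longrightarrow> v = z1 X \<Longrightarrow> R) \<Longrightarrow> (\<And>X. X \<in> DD \<Longrightarrow> v = z3 X \<Longrightarrow> R) \<Longrightarrow> R" for v R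
    using Dp_ex by metis
  have Nport: "?N v = (?N v \<inter> cl v) \<union> {mu v}" if "v \<in> Tp \<union> Dp" for v using mu_out[OF that] by blast
  have mids: "z2 X \<notin> Tp \<union> Dp" "z4 X \<notin> Tp \<union> Dp" if X: "X \<in> DD" for X
  proof -
    have "z2 X \<notin> Tp" "z4 X \<notin> Tp" using sepTD X inD[OF X] unfolding Tp_def by blast+
    moreover have "z2 X \<notin> Dp" "z4 X \<notin> Dp"
      using Dp_ex[of "z2 X"] Dp_ex[of "z4 X"] clD[OF X] inD[OF X] dia[OF X] by metis+
    ultimately show "z2 X \<notin> Tp \<union> Dp" "z4 X \<notin> Tp \<union> Dp" by auto
  qed
  have "triangle_diamond_graph ?V ?N Tp Dp rot mu opp m1 m2"
  proof
    have "m1 ` Dp = (\<Union>X \<in> DD. m1 ` {z1 X, z3 X})" "m2 ` Dp = (\<Union>X \<in> DD. m2 ` {z1 X, z3 X})"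
      unfolding Dp_def by (rule image_UN)+
    moreover have "m1 ` {z1 X, z3 X} = {z2 X}" "m2 ` {z1 X, z3 X} = {z4 X}" if "X \<in> DD" for X
      using portD[OF that] by simp_all
    ultimately have m: "m1 ` Dp = z2 ` DD" "m2 ` Dp = z4 ` DD" by (simp_all add: UNION_singleton_eq_range)
    have DDu: "\<Union>DD = Dp \<union> z2 ` DD \<union> z4 ` DD"
    proof
      show "\<Union>DD \<subseteq> Dp \<union> z2 ` DD \<union> z4 ` DD"
      proof
        fix v assume "v \<in> \<Union>DD"
        then obtain X where X: "X \<in> DD" "v \<in> X" by blast
        then have "v = z1 X \<or> v = z2 X \<or> v = z3 X \<or> v = z4 X" using dia(7)[OF X(1)] by blast
        then show "v \<in> Dp \<union> z2 ` DD \<union> z4 ` DD" using X(1) unfolding Dp_def by blast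
      qed
      show "Dp \<union> z2 ` DD \<union> z4 ` DD \<subseteq> \<Union>DD"
      proof
        fix v assume "v \<in> Dp \<union> z2 ` DD \<union> z4 ` DD"
        then obtain X where "X \<in> DD" "v = z1 X \<or> v = z2 X \<or> v = z3 X \<or> v = z4 X" unfolding Dp_def by blast
        then show "v \<in> \<Union>DD" using inD[of X] by auto
      qed
    qed
    have V2: "?V = Tp \<union> \<Union>DD" unfolding Tp_def by (metis PV TDP(3) Union_Un_distrib)
    show "?V = Tp \<union> Dp \<union> m1 ` Dp \<union> m2 ` Dp" unfolding V2 DDu m by (simp only: Un_assoc)
    show "finite ?V" using pair_finite_verts .
    show "Tp \<inter> Dp = {}" using sepTD inD unfolding Tp_def Dp_def by blast
    show "m1 c \<notin> Tp \<union> Dp" "m2 c \<notin> Tp \<union> Dp" if "c \<in> Dp" for c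
      using that by (rule Dp_X; use mids portD in simp)+
    show "m1 c \<noteq> m2 c'" if c: "c \<in> Dp" "c' \<in> Dp" for c c'
    proof -
      obtain X where X: "X \<in> DD" "m1 c = z2 X" using Dp_ex[OF c(1)] portD(3,4) by metis
      obtain X' where X': "X' \<in> DD" "m2 c' = z4 X'" using Dp_ex[OF c(2)] portD(5,6) by metis
      show ?thesis
      proof
        assume "m1 c = m2 c'"
        then have eq: "z2 X = z4 X'" using X X' by simp
        then have "X = X'" using clD[OF X(1) inD(2)[OF X(1)]] clD[OF X'(1) inD(4)[OF X'(1)]] by simp
        then show False using eq dia(5)[OF X(1)] by simp
      qed
    qed
    show "c' = c \<or> c' = opp c" if c: "c \<in> Dp" "c' \<in> Dp" "m1 c = m1 c' \<or> m2 c = m2 c'" for c c'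
    proof -
      obtain X where X: "X \<in> DD" "c = z1 X \<or> c = z3 X" using Dp_ex[OF c(1)] by blast
      obtain X' where X': "X' \<in> DD" "c' = z1 X' \<or> c' = z3 X'" using Dp_ex[OF c(2)] by blast
      have "z2 X = z2 X' \<or> z4 X = z4 X'" using c(3) X X' portD[OF X(1)] portD[OF X'(1)] by auto
      then have "X = X'" using clD[OF X(1)] clD[OF X'(1)] inD[OF X(1)] inD[OF X'(1)] by metis
      then show ?thesis using X(2) X'(2) portD[OF X(1)] by auto
    qed
    show "m1 (opp c) = m1 c" "m2 (opp c) = m2 c" "opp c \<in> Dp" "opp c \<noteq> c" "opp (opp c) = c" if c: "c \<in> Dp" for c
    proof -
      obtain X where X: "X \<in> DD" "c = z1 X \<or> c = z3 X" using Dp_ex[OF c] by blast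
      then show "m1 (opp c) = m1 c" "m2 (opp c) = m2 c" "opp c \<noteq> c" "opp (opp c) = c"
        using portD[OF X(1)] dia(2)[OF X(1)] by auto
      show "opp c \<in> Dp" using X portD[OF X(1)] unfolding Dp_def by auto
    qed
    show "rot t \<in> Tp" "rot t \<noteq> t" "rot (rot (rot t)) = t" if "t \<in> Tp" for t using rotT insideT that by auto
    show "mu p \<in> Tp \<union> Dp" "mu (mu p) = p" if "p \<in> Tp \<union> Dp" for p using mu_port mu_mu that by auto
    show "mu p \<noteq> p" if "p \<in> Tp \<union> Dp" for p using mu_in(1)[OF that] N_irr by metis
    show "mu t \<noteq> rot t" if "t \<in> Tp" for t using mu_in(2)[of t] insideT(6)[OF that] that by auto
    show "mu c \<noteq> opp c" if c: "c \<in> Dp" for c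
    proof -
      obtain X where X: "X \<in> DD" "c \<in> X" "cl c = X" "c = z1 X \<or> c = z3 X" using Dp_ex[OF c] by blast
      then have "opp c \<in> X" using portD[OF X(1)] inD[OF X(1)] by auto
      then show ?thesis using mu_in(2)[of c] c X(3) by auto
    qed
    show "?N t = {rot t, rot (rot t), mu t}" if "t \<in> Tp" for t using Nport[of t] insideT(1)[OF that] that by auto
    show "?N c = {m1 c, m2 c, mu c}" "?N (m1 c) = {c, opp c, m2 c}" "?N (m2 c) = {c, opp c, m1 c}" if c: "c \<in> Dp" for c
    proof -
      obtain X where X: "X \<in> DD" "cl c = X" "c = z1 X \<or> c = z3 X" using Dp_ex[OF c] by blast
      then have "?N c \<inter> cl c = {m1 c, m2 c}" using NX[OF X(1)] portD[OF X(1)] by auto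
      then show "?N c = {m1 c, m2 c, mu c}" using Nport[of c] c by auto
      show "?N (m1 c) = {c, opp c, m2 c}" "?N (m2 c) = {c, opp c, m1 c}"
        using X(3) N24[OF X(1)] portD[OF X(1)] by auto
    qed
    show "S = ?V" if "S \<subseteq> ?V" "S \<noteq> {}" "\<And>v. v \<in> S \<Longrightarrow> ?N v \<subseteq> S" for S
      using connected_closed[OF G(1,2) that] .
    show "Tp \<noteq> {}" using P(3) T unfolding Tp_def TT_def by (metis (mono_tags, lifting) Sup_upper empty_iff insertI1 mem_Collect_eq subset_empty)
    show "Dp \<noteq> {}" using P(4) unfolding Dp_def DD_def by blast
  qed
  then show ?thesis by blast
qed

section \<open>The exceptional dumbbells\<close>

context triangle_diamond_graph
begin

lemma exceptionalD:
  assumes "exceptional a g h b x y"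
  shows "triangle a g h" "triangle b x y" "nu g = h" "nu x = y" "nu a = b" "tri a \<noteq> tri b" "length (ch x) = 1"
    "ch a = [] \<or> length (ch a) = 1 \<and> length (ch g) = 1"
  using assms by (simp_all add: exceptional_def)

lemma dumbbell_apart:
  assumes t: "triangle a g h" and u: "triangle b x y" and loops: "nu g = h" "nu x = y" and ab: "nu a = b"
    and ne: "tri a \<noteq> tri b"
  shows "distinct [a, g, h, b, x, y]" "K g \<inter> K x = {}" "K a \<inter> K g = {}" "K a \<inter> K x = {}"
proof -
  note T = triangleD[OF t] and U = triangleD[OF u]
  have dis: "e \<noteq> e'" if "e \<in> {a, g, h}" "e' \<in> {b, x, y}" for e e'
    using tri_mem[OF t that(1)] tri_mem[OF u] that(2) ne by metis
  have e: "a \<noteq> b" "a \<noteq> x" "a \<noteq> y" "g \<noteq> b" "g \<noteq> x" "g \<noteq> y" "h \<noteq> b" "h \<noteq> x" "h \<noteq> y"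
    using dis[of a b] dis[of a x] dis[of a y] dis[of g b] dis[of g x] dis[of g y] dis[of h b] dis[of h x] dis[of h y]
    by blast+
  show "distinct [a, g, h, b, x, y]" using e T(4,5,6) U(4,5,6) by simp
  show "K g \<inter> K x = {}" using K_meet[OF T(2) U(2), unfolded loops] e by blast
  show "K a \<inter> K g = {}" using K_meet[OF T(2,1), unfolded loops] T(4,5) by blast
  show "K a \<inter> K x = {}" using K_meet[OF U(2) T(1), unfolded loops] e by blast
qed

text \<open>
  Staller takes the port \<open>mu g\<close> of the loop diamond, with tempo, and then \<open>a\<close> against \<open>h\<close>. She crosses the bridge
  to the other triangle, takes \<open>x\<close> against \<open>y\<close>, and goes around the loop there, which ends at \<open>y\<close>.
\<close>

lemma dumbbell_staller_first:
  assumes t: "triangle a g h" and u: "triangle b x y" and loops: "nu g = h" "nu x = y" and ab: "nu a = b"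
    and ne: "tri a \<noteq> tri b"
  shows "wins {} {}"
proof -
  note T = triangleD[OF t] and U = triangleD[OF u] and L = loop_ch[OF t loops(1)]
  note apart = dumbbell_apart[OF assms]
  have tg: "triangle g h a" using t triangle_rotate by blast
  have ty: "triangle y b x" using u triangle_rotate by blast
  have KT: "K z \<inter> Tp = {}" if "z \<in> Tp" for z using K_subset[OF that] by blast
  show ?thesis
  proof (rule diamond_start[OF L(2)])
    fix b' assume b': "b' \<in> cell (mu g)" "b' \<noteq> mu g"
    have inK: "mu g \<in> K g" "b' \<in> K g" using L(4) b' by (auto simp: cell_def)
    then have out: "mu g \<notin> Tp" "b' \<notin> Tp" "mu g \<notin> K a" "b' \<notin> K a" "mu g \<notin> K x" "b' \<notin> K x"
      using KT[OF T(2)] apart(2,3) by blast+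
    have "wins {a, mu g} {h, b'}"
    proof (rule push[OF T(1)])
      show "a \<in> {a, mu g}" by simp
      show "K a \<inter> ({a, mu g} \<union> {h, b'}) = {}" using out KT[OF T(1)] T(1,3) by blast
      fix A B assume AB: "{a, mu g} \<subseteq> A" "A \<subseteq> {a, mu g} \<union> K a" "{h, b'} \<subseteq> B" "B \<subseteq> {h, b'} \<union> K a" "mu (nu a) \<in> A"
      have free: "z \<notin> A \<union> B" if "z \<in> {b, x, y}" for z
      proof -
        have "z \<in> Tp" "z \<noteq> a" "z \<noteq> h" using that U(1,2,3) apart(1) by auto
        then show ?thesis using AB(2,4) out(1,2) KT[OF T(1)] by blast
      qed
      show "wins A B"
      proof (rule force[of b y x])
        show "N b \<subseteq> insert y (insert x A)" using triangle_N[OF u] AB(5) ab by simp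
        show "b \<in> V" "y \<in> V - (A \<union> B)" "x \<in> V - (A \<union> B)" "y \<noteq> x" using free[of x] free[of y] U by simp_all
        show "wins (insert x A) (insert y B)"
        proof (rule walk_closes[OF ty U(2) _ loops(2)])
          show "K x \<inter> (insert x A \<union> insert y B) = {}"
          proof -
            have "A \<subseteq> insert (mu g) (Tp \<union> K a)" "B \<subseteq> insert b' (Tp \<union> K a)" using AB(2,4) T(1,3) by blast+
            then show ?thesis using out(5,6) KT[OF U(2)] apart(4) U(2,3) by blast
          qed
          show "b \<notin> insert x A" "b \<notin> insert y B" using free[of b] U(4,5) by simp_all
        qed simp_all
      qed
    qed
    then have "forced_line [(g, a, h)] wins {mu g} {b'}"
      using T out(1,2) triangle_N[OF tg] by auto
    from forced_line_wins[OF this] show "wins (insert (mu g) {}) (insert b' {})" by simp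
  qed simp
qed

text \<open>
  The corners of a diamond, numbered from its entrance \<open>c\<close> in the cyclic order used for the labelled diamonds.
\<close>

definition corner :: "'a \<Rightarrow> nat \<Rightarrow> 'a" where
  "corner c j = (if j = 1 then c else if j = 2 then m1 c else if j = 3 then opp c else m2 c)"

lemma corner_simps [simp]:
  "corner c 1 = c" "corner c (Suc 0) = c" "corner c 2 = m1 c" "corner c 3 = opp c" "corner c 4 = m2 c"
  by (simp_all add: corner_def)

lemma corner_inj: "c \<in> Dp \<Longrightarrow> j \<in> {1, 2, 3, 4} \<Longrightarrow> j' \<in> {1, 2, 3, 4} \<Longrightarrow> corner c j = corner c j' \<Longrightarrow> j = j'"
  by (auto simp: corner_def split: if_splits)

lemma corner_cell: "corner c j \<in> cell c"
  by (simp add: corner_def cell_def)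

lemma corner_N:
  "c \<in> Dp \<Longrightarrow> N (corner c 1) = {corner c 2, corner c 4, mu c}"
  "c \<in> Dp \<Longrightarrow> N (corner c 2) = {corner c 1, corner c 3, corner c 4}"
  "c \<in> Dp \<Longrightarrow> N (corner c 3) = {corner c 2, corner c 4, mu (opp c)}"
  "c \<in> Dp \<Longrightarrow> N (corner c 4) = {corner c 1, corner c 3, corner c 2}"
  using N_diamond[of c] N_diamond(1)[of "opp c"] by auto

lemma chain_ends:
  assumes p: "p \<in> Tp" and ne: "ch p \<noteq> []"
  shows "mu p = hd (ch p)" "mu (hd (ch p)) = p" "mu (nu p) = opp (last (ch p))" "mu (opp (last (ch p))) = nu p"
proof -
  show 1: "mu p = hd (ch p)" using chain_nil_iff(3)[OF p ne] by simp
  then show "mu (hd (ch p)) = p" using mu_mu[of p] p by simp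
  show 2: "mu (nu p) = opp (last (ch p))" using mu_nu_last[OF p ne] .
  then show "mu (opp (last (ch p))) = nu p" using mu_mu[of "nu p"] p by simp
qed

lemma chain_single:
  assumes p: "p \<in> Tp" and len: "length (ch p) = 1"
  obtains c where "ch p = [c]" "c \<in> Dp" "K p = cell c" "mu p = c" "mu c = p" "mu (nu p) = opp c" "mu (opp c) = nu p"
proof -
  obtain c where c: "ch p = [c]" using len by (auto simp: length_Suc_conv)
  then have "c \<in> Dp" "K p = cell c" using ch_Dp[OF p] by (auto simp: K_def)
  then show ?thesis using that c chain_ends[OF p] by simp
qed

text \<open>
  The bijection sends \<open>Y\<close> to the triangle of \<open>a\<close>, \<open>W\<close> to that of \<open>b\<close>, the diamond \<open>H\<close> to the bridge and \<open>K\<close>, \<open>M\<close> to the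
  two loops, each diamond being read from its entrance.
\<close>

lemma exceptional_eta:
  assumes e: "exceptional a g h b x y" and ne: "ch a \<noteq> []"
  shows "\<exists>F. inj_on F (pverts eta) \<and> F ` pverts eta = V \<and> (\<forall>v \<in> pverts eta. N (F v) = F ` open_nbhd eta v)"
proof -
  note E = exceptionalD[OF e]
  note T = triangleD[OF E(1)] and U = triangleD[OF E(2)]
  note apart = dumbbell_apart[OF E(1-6)]
  have len: "length (ch a) = 1" "length (ch g) = 1" using E(8) ne by auto
  obtain c where c: "c \<in> Dp" "K a = cell c" "mu a = c" "mu c = a" "mu b = opp c" "mu (opp c) = b"
    using chain_single[OF T(1) len(1)] E(5) by metis
  obtain k where k: "k \<in> Dp" "K g = cell k" "mu g = k" "mu k = g" "mu h = opp k" "mu (opp k) = h"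
    using chain_single[OF T(2) len(2)] E(3) by metis
  obtain m where m: "m \<in> Dp" "K x = cell m" "mu x = m" "mu m = x" "mu y = opp m" "mu (opp m) = y"
    using chain_single[OF U(2) E(7)] E(4) by metis
  define F where "F v = (case v of eY j \<Rightarrow> (if j = 1 then a else if j = 2 then g else h)
    | eW j \<Rightarrow> (if j = 1 then b else if j = 2 then x else y)
    | eH j \<Rightarrow> corner c j | eK j \<Rightarrow> corner k j | eM j \<Rightarrow> corner m j)" for v
  have F [simp]: "F (eY 1) = a" "F (eY (Suc 0)) = a" "F (eY 2) = g" "F (eY 3) = h"
    "F (eW 1) = b" "F (eW (Suc 0)) = b" "F (eW 2) = x" "F (eW 3) = y"
    "F (eH j) = corner c j" "F (eK j) = corner k j" "F (eM j) = corner m j" for j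
    by (simp_all add: F_def)
  have Ns: "N a = {g, h, c}" "N g = {a, h, k}" "N h = {a, g, opp k}" "N b = {x, y, opp c}" "N x = {b, y, m}" "N y = {b, x, opp m}"
    using triangle_N[OF E(1)] triangle_N[OF triangle_rotate[OF E(1)]] triangle_N[OF triangle_rotate[OF triangle_rotate[OF E(1)]]]
      triangle_N[OF E(2)] triangle_N[OF triangle_rotate[OF E(2)]] triangle_N[OF triangle_rotate[OF triangle_rotate[OF E(2)]]]
      c k m by auto
  have six: "Tp = {a, g, h, b, x, y}" and V: "V = Tp \<union> cell c \<union> cell k \<union> cell m"
    using dumbbell_cover[OF E(1-5)] c k m by auto
  have blocks: "v \<in> pverts eta \<longleftrightarrow> v \<in> {eY 1, eY 2, eY 3, eW 1, eW 2, eW 3} \<or>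
      (\<exists>j \<in> {1, 2, 3, 4}. v = eH j) \<or> (\<exists>j \<in> {1, 2, 3, 4}. v = eK j) \<or> (\<exists>j \<in> {1, 2, 3, 4}. v = eM j)" for v
    unfolding eta_verts by auto
  let ?S = "{eY 1, eY 2, eY 3, eW 1, eW 2, eW 3}"
  have inS: "F v \<in> Tp" if "v \<in> ?S" for v using that six by auto
  have injS: "v = w" if "v \<in> ?S" "w \<in> ?S" "F v = F w" for v w
    using that apart(1) by auto
  have cT: "corner c j \<notin> Tp" "corner k j \<notin> Tp" "corner m j \<notin> Tp" for j
    using cell_Tp[OF c(1)] cell_Tp[OF k(1)] cell_Tp[OF m(1)] corner_cell by blast+
  have cc: "corner c i \<noteq> corner k j" "corner c i \<noteq> corner m j" "corner k i \<noteq> corner m j" for i j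
  proof -
    have "cell c \<inter> cell k = {}" "cell c \<inter> cell m = {}" "cell k \<inter> cell m = {}"
      using apart(2-4) c(2) k(2) m(2) by simp_all
    then show "corner c i \<noteq> corner k j" "corner c i \<noteq> corner m j" "corner k i \<noteq> corner m j"
      using corner_cell by (metis disjoint_iff)+
  qed
  have outS: "F v \<notin> Tp" if "v \<in> pverts eta" "v \<notin> ?S" for v
    using that cT unfolding blocks by (elim disjE bexE) simp_all
  have "inj_on F (pverts eta)"
  proof (rule inj_onI)
    fix v w assume v: "v \<in> pverts eta" "w \<in> pverts eta" and eq: "F v = F w"
    show "v = w"
    proof (cases "v \<in> ?S")
      case True
      then have "w \<in> ?S" using inS[OF True] outS[OF v(2)] eq by metis
      then show ?thesis using injS True eq by blast
    next
      case False
      then have w: "w \<notin> ?S" using inS[of w] outS[OF v(1)] eq by metis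
      consider j where "j \<in> {1, 2, 3, 4}" "v = eH j" | j where "j \<in> {1, 2, 3, 4}" "v = eK j"
        | j where "j \<in> {1, 2, 3, 4}" "v = eM j"
        using v(1) False unfolding blocks by blast
      then show ?thesis
      proof cases
        case (1 j)
        have Fv: "F v = corner c j" using 1 by simp
        have "w \<noteq> eK j'" "w \<noteq> eM j'" for j' using cc[of j j'] cc[of j' j] Fv eq by auto
        then obtain j' where "j' \<in> {1, 2, 3, 4}" "w = eH j'" using v(2) w unfolding blocks by blast
        then show ?thesis using corner_inj[OF c(1) 1(1)] Fv eq 1 by simp
      next
        case (2 j)
        have Fv: "F v = corner k j" using 2 by simp
        have "w \<noteq> eH j'" "w \<noteq> eM j'" for j' using cc[of j j'] cc[of j' j] Fv eq by auto
        then obtain j' where "j' \<in> {1, 2, 3, 4}" "w = eK j'" using v(2) w unfolding blocks by blast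
        then show ?thesis using corner_inj[OF k(1) 2(1)] Fv eq 2 by simp
      next
        case (3 j)
        have Fv: "F v = corner m j" using 3 by simp
        have "w \<noteq> eH j'" "w \<noteq> eK j'" for j' using cc[of j j'] cc[of j' j] Fv eq by auto
        then obtain j' where "j' \<in> {1, 2, 3, 4}" "w = eM j'" using v(2) w unfolding blocks by blast
        then show ?thesis using corner_inj[OF m(1) 3(1)] Fv eq 3 by simp
      qed
    qed
  qed
  moreover have "F ` pverts eta = V"
    unfolding eta_verts V six cell_def by auto
  moreover have "N (F v) = F ` open_nbhd eta v" if "v \<in> pverts eta" for v
  proof -
    have cs: "N (corner c 1) = {m1 c, m2 c, a}" "N (corner c 2) = {c, opp c, m2 c}" "N (corner c 3) = {m1 c, m2 c, b}" "N (corner c 4) = {c, opp c, m1 c}"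
      "N (corner k 1) = {m1 k, m2 k, g}" "N (corner k 2) = {k, opp k, m2 k}" "N (corner k 3) = {m1 k, m2 k, h}" "N (corner k 4) = {k, opp k, m1 k}"
      "N (corner m 1) = {m1 m, m2 m, x}" "N (corner m 2) = {m, opp m, m2 m}" "N (corner m 3) = {m1 m, m2 m, y}" "N (corner m 4) = {m, opp m, m1 m}"
      using corner_N[OF c(1)] corner_N[OF k(1)] corner_N[OF m(1)] c k m by simp_all
    show ?thesis
      using that unfolding eta_verts
      by (elim insertE) (simp_all only: F Ns cs eta_nbhd image_insert image_empty, simp_all)
  qed
  ultimately show ?thesis by blast
qed

text \<open>
  The bijection sends \<open>A\<close> to the triangle of \<open>a\<close>, \<open>B\<close> to that of \<open>b\<close>, \<open>H\<close> to the diamond of the short loop and \<open>D\<^sub>i\<close> to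
  the \<open>i\<close>-th diamond of the chain from \<open>g\<close> to \<open>h\<close>.
\<close>

lemma exceptional_omega:
  assumes e: "exceptional a g h b x y" and na: "ch a = []"
  defines "k \<equiv> length (ch g)"
  shows "k \<ge> 1 \<and> (\<exists>F. inj_on F (pverts (omega k)) \<and> F ` pverts (omega k) = V \<and>
    (\<forall>v \<in> pverts (omega k). N (F v) = F ` open_nbhd (omega k) v))"
proof -
  note E = exceptionalD[OF e]
  note T = triangleD[OF E(1)] and U = triangleD[OF E(2)]
  note apart = dumbbell_apart[OF E(1-6)]
  obtain c where c: "c \<in> Dp" "K x = cell c" "mu x = c" "mu c = x" "mu y = opp c" "mu (opp c) = y"
    using chain_single[OF U(2) E(7)] E(4) by metis
  have ab: "mu a = b" "mu b = a" using chain_nil_iff(2)[OF T(1) na] E(5) mu_mu[of a] T by auto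
  have chg: "ch g \<noteq> []" using loop_ch[OF E(1,3)] by blast
  then have k1: "k \<ge> 1" by (simp add: k_def Suc_le_eq)
  define z where "z i = ch g ! (i - 1)" for i
  have zset: "z i \<in> set (ch g)" if "i \<in> {1..k}" for i using that by (auto simp: z_def k_def)
  then have zD: "z i \<in> Dp" if "i \<in> {1..k}" for i using ch_Dp[OF T(2)] that by blast
  have z1: "z 1 = hd (ch g)" and zk: "z k = last (ch g)" using chg by (simp_all add: z_def k_def hd_conv_nth last_conv_nth)
  note ends = chain_ends[OF T(2) chg, folded z1 zk, unfolded E(3)]
  have step: "z (i + 1) = mu (opp (z i))" if "1 \<le> i" "i < k" for i
    using chain_nth_Suc[OF chain_ch[OF T(2)], of "i - 1"] that by (simp add: z_def k_def)
  have back_step: "mu (z (i + 1)) = opp (z i)" if "1 \<le> i" "i < k" for i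
    using step[OF that] mu_mu[of "opp (z i)"] zD[of i] that by simp
  have zinj: "i = i'" if i: "i \<in> {1..k}" "i' \<in> {1..k}" "v \<in> cell (z i)" "v \<in> cell (z i')" for i i' v
  proof -
    have "z i' = z i \<or> z i' = opp (z i)" using cells_meet[OF zD[OF i(1)] zD[OF i(2)] i(3,4)] .
    then have "z i' = z i" using opp_notin_ch[OF T(2) zset[OF i(1)]] zset[OF i(2)] by auto
    then have "i' - 1 = i - 1"
      using nth_eq_iff_index_eq[OF distinct_ch[OF T(2)], of "i' - 1" "i - 1"] i(1,2) by (auto simp: z_def k_def)
    then show ?thesis using i(1,2) by auto
  qed
  have Kg: "K g = (\<Union>i \<in> {1..k}. cell (z i))"
  proof
    show "K g \<subseteq> (\<Union>i \<in> {1..k}. cell (z i))"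
    proof
      fix v assume "v \<in> K g"
      then obtain n where "n < length (ch g)" "v \<in> cell (ch g ! n)" by (auto simp: K_def in_set_conv_nth)
      then have "n + 1 \<in> {1..k}" "v \<in> cell (z (n + 1))" by (auto simp: z_def k_def)
      then show "v \<in> (\<Union>i \<in> {1..k}. cell (z i))" by blast
    qed
    show "(\<Union>i \<in> {1..k}. cell (z i)) \<subseteq> K g"
      unfolding K_def by (rule UN_least, rule UN_upper, rule zset)
  qed
  define F where "F v = (case v of oA j \<Rightarrow> (if j = 1 then a else if j = 2 then g else h)
    | oB j \<Rightarrow> (if j = 1 then b else if j = 2 then x else y)
    | oH j \<Rightarrow> corner c j | oZ i j \<Rightarrow> corner (z i) j)" for v
  have F [simp]: "F (oA 1) = a" "F (oA (Suc 0)) = a" "F (oA 2) = g" "F (oA 3) = h"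
    "F (oB 1) = b" "F (oB (Suc 0)) = b" "F (oB 2) = x" "F (oB 3) = y"
    "F (oH j) = corner c j" "F (oZ i j) = corner (z i) j" for i j
    by (simp_all add: F_def)
  have Ns: "N a = {g, h, b}" "N g = {a, h, z 1}" "N h = {a, g, opp (z k)}" "N b = {x, y, a}" "N x = {b, y, c}" "N y = {b, x, opp c}"
    using triangle_N[OF E(1)] triangle_N[OF triangle_rotate[OF E(1)]] triangle_N[OF triangle_rotate[OF triangle_rotate[OF E(1)]]]
      triangle_N[OF E(2)] triangle_N[OF triangle_rotate[OF E(2)]] triangle_N[OF triangle_rotate[OF triangle_rotate[OF E(2)]]]
      c ab ends by auto
  note cover = dumbbell_cover[OF E(1-5)]
  have six: "Tp = {a, g, h, b, x, y}" by (rule cover(1))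
  have "K a = {}" using na by (simp add: K_def)
  then have V: "V = Tp \<union> cell c \<union> (\<Union>i \<in> {1..k}. cell (z i))" using cover(2) unfolding Kg c(2) by blast
  let ?S = "{oA 1, oA 2, oA 3, oB 1, oB 2, oB 3}"
  have blocks: "v \<in> pverts (omega k) \<longleftrightarrow> v \<in> ?S \<or> (\<exists>j \<in> {1, 2, 3, 4}. v = oH j) \<or>
      (\<exists>i \<in> {1..k}. \<exists>j \<in> {1, 2, 3, 4}. v = oZ i j)" for v
    unfolding omega_verts by auto
  have inS: "F v \<in> Tp" if "v \<in> ?S" for v using that six by auto
  have injS: "v = w" if "v \<in> ?S" "w \<in> ?S" "F v = F w" for v w
    using that apart(1) by auto
  have cT: "corner c j \<notin> Tp" for j using cell_Tp[OF c(1)] corner_cell by blast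
  have zT: "corner (z i) j \<notin> Tp" if "i \<in> {1..k}" for i j using cell_Tp[OF zD[OF that]] corner_cell by blast
  have cz: "corner c j \<noteq> corner (z i) j'" if "i \<in> {1..k}" for i j j'
  proof -
    have "cell (z i) \<subseteq> K g" unfolding Kg using that by (rule UN_upper)
    moreover have "K g \<inter> cell c = {}" using apart(2) c(2) by simp
    ultimately show ?thesis using corner_cell by (metis disjoint_iff subsetD)
  qed
  have outS: "F v \<notin> Tp" if "v \<in> pverts (omega k)" "v \<notin> ?S" for v
    using that cT zT unfolding blocks by (elim disjE bexE) simp_all
  have "inj_on F (pverts (omega k))"
  proof (rule inj_onI)
    fix v w assume v: "v \<in> pverts (omega k)" "w \<in> pverts (omega k)" and eq: "F v = F w"
    consider "v \<in> ?S" | j where "j \<in> {1, 2, 3, 4}" "v = oH j" | i j where "i \<in> {1..k}" "j \<in> {1, 2, 3, 4}" "v = oZ i j"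
      using v(1) unfolding blocks by blast
    then show "v = w"
    proof cases
      case 1
      have "w \<in> ?S" using inS[OF 1] outS[OF v(2)] eq by metis
      then show ?thesis using injS 1 eq by blast
    next
      case (2 j)
      have Fv: "F v = corner c j" using 2 by simp
      have "w \<notin> ?S" using inS[of w] cT[of j] Fv eq by auto
      moreover have "w \<noteq> oZ i' j'" if "i' \<in> {1..k}" for i' j' using cz[OF that, of j j'] Fv eq by auto
      ultimately obtain j' where "j' \<in> {1, 2, 3, 4}" "w = oH j'" using v(2) unfolding blocks by blast
      then show ?thesis using corner_inj[OF c(1) 2(1)] Fv eq 2 by simp
    next
      case (3 i j)
      have Fv: "F v = corner (z i) j" using 3 by simp
      have "w \<notin> ?S" using inS[of w] zT[OF 3(1), of j] Fv eq by auto
      moreover have "w \<noteq> oH j'" for j' using cz[OF 3(1), of j' j] Fv eq by auto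
      ultimately obtain i' j' where w: "i' \<in> {1..k}" "j' \<in> {1, 2, 3, 4}" "w = oZ i' j'" using v(2) unfolding blocks by blast
      then have eq': "corner (z i) j = corner (z i') j'" using Fv eq by simp
      then have "i = i'" using zinj[OF 3(1) w(1), of "corner (z i) j"] corner_cell by metis
      then show ?thesis using corner_inj[OF zD[OF 3(1)] 3(2) w(2)] eq' 3 w by simp
    qed
  qed
  moreover have "F ` pverts (omega k) = V"
    unfolding omega_verts V six cell_def image_Un image_UN by auto
  moreover have "N (F v) = F ` open_nbhd (omega k) v" if v: "v \<in> pverts (omega k)" for v
  proof -
    have cs: "N (corner c 1) = {m1 c, m2 c, x}" "N (corner c 2) = {c, opp c, m2 c}" "N (corner c 3) = {m1 c, m2 c, y}" "N (corner c 4) = {c, opp c, m1 c}"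
      using corner_N[OF c(1)] c by simp_all
    consider "v \<in> {oA 1, oA 2, oA 3, oB 1, oB 2, oB 3, oH 1, oH 2, oH 3, oH 4}"
      | i where "i \<in> {1..k}" "v \<in> {oZ i 1, oZ i 2, oZ i 3, oZ i 4}"
      using v unfolding omega_verts by blast
    then show ?thesis
    proof cases
      case 1
      then show ?thesis
        by (elim insertE) (simp_all only: F Ns cs omega_nbhd[OF k1] image_insert image_empty, simp_all)
    next
      case (2 i)
      note zi = zD[OF 2(1)]
      have before: "mu (z i) = F (if i = 1 then oA 2 else oZ (i - 1) 3)"
      proof (cases "i = 1")
        case True then show ?thesis using ends(2) by simp
      next
        case False
        then have j: "1 \<le> i - 1" "i - 1 < k" "i - 1 + 1 = i" using 2(1) by auto
        have "mu (z i) = opp (z (i - 1))" using back_step[OF j(1,2)] unfolding j(3) .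
        then show ?thesis using False by simp
      qed
      have after: "mu (opp (z i)) = F (if i = k then oA 3 else oZ (i + 1) 1)"
      proof (cases "i = k")
        case True then show ?thesis using ends(4) by simp
      next
        case False
        then show ?thesis using step[of i] 2(1) by simp
      qed
      show ?thesis
        using 2(2) corner_N[OF zi] omega_nbhd(11-14)[OF k1 2(1)] before after
        by (elim insertE) (simp_all only: F image_insert image_empty empty_iff)
    qed
  qed
  ultimately show ?thesis using k1 by blast
qed

end

section \<open>The outcome of the game\<close>

lemma exceptional_iso:
  assumes "triangle_diamond_graph (pverts G) (open_nbhd G) Tp Dp rot mu opp m1 m2" and G: "pair_wf_digraph G"
    and e: "triangle_diamond_graph.exceptional Tp Dp rot mu opp a g h b x y"
  shows "digraph_iso (with_proj G) (with_proj eta) \<or> (\<exists>k\<ge>1. digraph_iso (with_proj G) (with_proj (omega k)))"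
proof -
  interpret triangle_diamond_graph "pverts G" "open_nbhd G" Tp Dp rot mu opp m1 m2 by fact
  show ?thesis
  proof (cases "ch a = []")
    case True
    then show ?thesis using exceptional_omega[OF e True] iso_if_nbhd[OF G omega_wf] by metis
  next
    case False
    then show ?thesis using exceptional_eta[OF e False] iso_if_nbhd[OF G eta_wf] by metis
  qed
qed

theorem theorem1p3:
  fixes G :: "'a pair_pre_digraph"
  assumes "pair_graph G"
    and "connected (with_proj G)"
    and "cubic G"
    and "card (pverts G) \<ge> 6"
    and "\<exists>P. triangle_diamond_partition G P"
  shows "(if digraph_iso (with_proj G) (with_proj eta) \<or>
             (\<exists>k\<ge>1. digraph_iso (with_proj G) (with_proj (omega k)))
          then wins_MBTD G Dominator Dominator \<and> wins_MBTD G Staller Staller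
          else graph_S G)"
proof -
  let ?V = "pverts G" and ?H = "winning_sets G"
  obtain P where "triangle_diamond_partition G P" using assms(5) by blast
  then obtain Tp Dp rot mu opp m1 m2 where
    loc: "triangle_diamond_graph ?V (open_nbhd G) Tp Dp rot mu opp m1 m2"
    using triangle_diamond_structure[OF assms(1-3)] by blast
  interpret triangle_diamond_graph ?V "open_nbhd G" Tp Dp rot mu opp m1 m2 by fact
  interpret pair_graph G by fact
  have wf: "pair_wf_digraph G" by unfold_locales
  have ne: "?V \<noteq> {}" using Tp_nonempty in_V(1) by blast
  have "maker_wins ?V ?H {} {}"
    using staller_wins_or_exceptional
  proof
    assume "\<forall>d \<in> ?V. maker_wins ?V ?H {} {d}"
    then show ?thesis using ne maker_wins_antimono[of ?V ?H "{}"] by blast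
  next
    assume "\<exists>a g h b x y. exceptional a g h b x y"
    then obtain a g h b x y where "exceptional a g h b x y" by blast
    from dumbbell_staller_first[OF exceptionalD(1-6)[OF this]] show ?thesis .
  qed
  then have staller: "wins_MBTD G Staller Staller" using staller_strategy[of G Staller] by simp
  show ?thesis
  proof (cases "digraph_iso (with_proj G) (with_proj eta) \<or> (\<exists>k\<ge>1. digraph_iso (with_proj G) (with_proj (omega k)))")
    case True
    then have "wins_MBTD G Dominator Dominator"
    proof (elim disjE exE conjE)
      assume "digraph_iso (with_proj G) (with_proj eta)"
      then show ?thesis by (rule dominator_wins_if_iso[OF _ wf eta_breaker_wins])
    next
      fix k :: nat assume "1 \<le> k" "digraph_iso (with_proj G) (with_proj (omega k))"
      then show ?thesis using dominator_wins_if_iso[OF _ wf omega_breaker_wins] by metis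
    qed
    then show ?thesis using True staller by (simp only: if_True simp_thms)
  next
    case False
    then have "\<not> (\<exists>a g h b x y. exceptional a g h b x y)" using exceptional_iso[OF loc wf] by blast
    then have "\<And>d. d \<in> ?V \<Longrightarrow> maker_wins ?V ?H {} {d}" using staller_wins_or_exceptional by blast
    then have "graph_S G" using graph_S_if_maker_wins_second[OF ne] by blast
    then show ?thesis using False by (simp only: if_False)
  qed
qed

end
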